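(* Let $M$ be an oriented closed connected $n$-manifold with fundamental group $\Gamma$. Then $$ d(\Gamma) \leq \|M\|_{\mathbb{Z}}. $$
   Context: For a finitely generated group $\Gamma$, $d(\Gamma)$ denotes the minimal size of a generating set of $\Gamma$. For an oriented closed connected $n$-manifold $N$, let $[N]_{\mathbb{Z}} \in H_n(N;\mathbb{Z})$ be its integral fundamental class. A fundamental cycle of $N$ is a singular cycle in $C_n(N;\mathbb{Z})$ representing $[N]_{\mathbb{Z}}$. The integral simplicial volume of $N$ is $$\|N\|_{\mathbb{Z}} := \min\Bigl\{ \sum_{j=1}^m |a_j| \Bigm| \sum_{j=1}^m a_j\cdot\sigma_j \in C_n(N;\mathbb{Z}) \text{ is a fundamental cycle of } N\Bigr\},$$ where such sums are written in reduced form (pairwise distinct singular simplices $\sigma_j$). *)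

theory Defs
  imports "HOL-Analysis.Analysis" "HOL-Homology.Homology" "HOL-Library.Extended_Nat"
begin

section \<open>Generating sets\<close>

text \<open>The minimal size of a generating set; \<open>\<infinity>\<close> if the group is not finitely generated.\<close>

definition min_generators :: "('g, 'b) monoid_scheme \<Rightarrow> enat" where
  "min_generators G =
     Inf {enat (card S) | S. finite S \<and> S \<subseteq> carrier G \<and> generate G S = carrier G}"


section \<open>The fundamental group of an abstract topological space\<close>

definition loops_at :: "'a topology \<Rightarrow> 'a \<Rightarrow> (real \<Rightarrow> 'a) set" where
  "loops_at X a = {p. pathin X p \<and> p 0 = a \<and> p 1 = a}"

text \<open>\<^const>\<open>homotopic_paths\<close> and \<^const>\<open>joinpaths\<close> are only available for types of class
  \<^class>\<open>topological_space\<close>; these are their analogues for loops in an abstract topology.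
  Values of a loop outside \<open>{0..1}\<close> are irrelevant.\<close>

definition homotopic_loops_at ::
    "'a topology \<Rightarrow> 'a \<Rightarrow> (real \<Rightarrow> 'a) \<Rightarrow> (real \<Rightarrow> 'a) \<Rightarrow> bool" where
  "homotopic_loops_at X a =
     homotopic_with (\<lambda>r. r 0 = a \<and> r 1 = a) (top_of_set {0..1}) X"

definition join_loops :: "(real \<Rightarrow> 'a) \<Rightarrow> (real \<Rightarrow> 'a) \<Rightarrow> real \<Rightarrow> 'a" where
  "join_loops p q = (\<lambda>t. if t \<le> 1/2 then p (2 * t) else q (2 * t - 1))"

definition loop_class :: "'a topology \<Rightarrow> 'a \<Rightarrow> (real \<Rightarrow> 'a) \<Rightarrow> (real \<Rightarrow> 'a) set" where
  "loop_class X a p = {q. homotopic_loops_at X a p q}"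

definition fundamental_group :: "'a topology \<Rightarrow> 'a \<Rightarrow> (real \<Rightarrow> 'a) set monoid" where
  "fundamental_group X a =
     \<lparr> carrier = loop_class X a ` loops_at X a,
       monoid.mult = (\<lambda>A B. \<Union>p\<in>A. \<Union>q\<in>B. loop_class X a (join_loops p q)),
       one = loop_class X a (\<lambda>_. a) \<rparr>"


section \<open>Oriented manifolds\<close>

text \<open>Topological manifolds, without boundary.\<close>

definition manifold :: "nat \<Rightarrow> 'a topology \<Rightarrow> bool" where
  "manifold n M \<longleftrightarrow>
     Hausdorff_space M \<and> second_countable M \<and>
     (\<forall>x\<in>topspace M. \<exists>U. openin M U \<and> x \<in> U \<and>
        subtopology M U homeomorphic_space Euclidean_space n)"

text \<open>The homomorphism \<open>H\<^sub>n(M, M - A) \<rightarrow> H\<^sub>n(M, M - B)\<close> induced by the identity, for \<open>B \<subseteq> A\<close>;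
  its domain is \<open>H\<^sub>n(M)\<close> if \<open>A\<close> is the whole space.\<close>

definition restrict_class ::
    "nat \<Rightarrow> 'a topology \<Rightarrow> 'a set \<Rightarrow> 'a set \<Rightarrow> 'a chain set \<Rightarrow> 'a chain set" where
  "restrict_class n M A B =
     hom_induced (int n) M (topspace M - A) M (topspace M - B) id"

text \<open>A (homological) orientation is a choice of generators of the infinite cyclic groups
  \<open>H\<^sub>n(M, M - {x})\<close> that is locally induced by a single class.\<close>

definition orientation :: "nat \<Rightarrow> 'a topology \<Rightarrow> ('a \<Rightarrow> 'a chain set) \<Rightarrow> bool" where
  "orientation n M \<mu> \<longleftrightarrow>
     (\<forall>x\<in>topspace M.
        let H = relative_homology_group (int n) M (topspace M - {x})
        in \<mu> x \<in> carrier H \<and> generate H {\<mu> x} = carrier H) \<and>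
     (\<forall>x\<in>topspace M. \<exists>U. openin M U \<and> x \<in> U \<and>
        (\<exists>c \<in> carrier (relative_homology_group (int n) M (topspace M - U)).
           \<forall>y\<in>U. restrict_class n M U {y} c = \<mu> y))"

text \<open>On a closed manifold with orientation \<open>\<mu>\<close> there is exactly one such class.\<close>

definition fundamental_class ::
    "nat \<Rightarrow> 'a topology \<Rightarrow> ('a \<Rightarrow> 'a chain set) \<Rightarrow> 'a chain set \<Rightarrow> bool" where
  "fundamental_class n M \<mu> z \<longleftrightarrow>
     z \<in> carrier (homology_group (int n) M) \<and>
     (\<forall>x\<in>topspace M. restrict_class n M (topspace M) {x} z = \<mu> x)"

definition fundamental_cycle ::
    "nat \<Rightarrow> 'a topology \<Rightarrow> ('a \<Rightarrow> 'a chain set) \<Rightarrow> 'a chain \<Rightarrow> bool" where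
  "fundamental_cycle n M \<mu> c \<longleftrightarrow>
     singular_relcycle n M {} c \<and> fundamental_class n M \<mu> (homologous_rel_set n M {} c)"


section \<open>Integral simplicial volume\<close>

text \<open>Chains are finitely supported functions, so summing over \<^const>\<open>Poly_Mapping.keys\<close>
  automatically uses the reduced form.\<close>

definition chain_norm :: "'a chain \<Rightarrow> nat" where
  "chain_norm c = (\<Sum>\<sigma>\<in>Poly_Mapping.keys c. nat \<bar>Poly_Mapping.lookup c \<sigma>\<bar>)"

text \<open>An infimum of a nonempty set of natural numbers is a minimum. Taking it in \<^typ>\<open>enat\<close> means that
  no arbitrary finite value arises from an empty set.\<close>

definition integral_simplicial_volume ::
    "nat \<Rightarrow> 'a topology \<Rightarrow> ('a \<Rightarrow> 'a chain set) \<Rightarrow> enat" where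
  "integral_simplicial_volume n M \<mu> =
     Inf {enat (chain_norm c) | c. fundamental_cycle n M \<mu> c}"

end

theory Submission
  imports Defs
begin

text \<open>
  Let \<open>c\<close> be a fundamental cycle of \<open>M\<close>, and choose a path \<open>\<gamma> v\<close> from the base point \<open>a\<close> to every point
  \<open>v\<close>. These paths turn the initial edge, from vertex 0 to vertex 1, of each simplex \<open>\<sigma>\<close> of \<open>c\<close> into a
  loop at \<open>a\<close>, the \<open>edge_loop\<close> of \<open>\<sigma>\<close>. Their number is at most the norm of \<open>c\<close>, and they generate the
  fundamental group, for the following reason. (This is in positive dimension; in dimension 0, where
  simplices have no edges, \<open>M\<close> is a point.)

  Let \<open>H\<close> be the subgroup that they generate, and \<open>p : E \<rightarrow> M\<close> the connected covering that belongs to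
  \<open>H\<close>. Every simplex of \<open>M\<close> is lifted to \<open>E\<close> by starting, over its vertex 0, at the end of the lift of
  the chosen path \<open>\<gamma>\<close>. If \<open>\<sigma>\<close> belongs to \<open>c\<close>, then the faces of the lift of \<open>\<sigma>\<close> are the lifts of the faces
  of \<open>\<sigma>\<close>. This is clear for the faces that contain vertex 0, and for the face opposite to vertex 0 it holds
  because the edge loop of \<open>\<sigma>\<close> lies in \<open>H\<close> (\<open>singular_face_lift\<close>). Hence all cancellations in
  \<open>\<partial>c = 0\<close> take place in \<open>E\<close> as well, and \<open>c\<close> lifts to a cycle \<open>c'\<close> in \<open>E\<close> (\<open>lift_cycle\<close>).

  A connected covering to which a fundamental cycle lifts is injective
  (\<open>sheeted_map_injective\<close>). Indeed, \<open>c'\<close> has a local degree at every point of \<open>E\<close>: its local class,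
  pushed down to \<open>M\<close> on a sheet, is a multiple of the class of \<open>c\<close>, which generates the infinite cyclic
  local homology of \<open>M\<close>. The local degree is locally constant, hence equal to a constant \<open>k\<close>. The local
  degrees over a point of \<open>M\<close> add up to 1, the coefficient of \<open>c\<close> itself. Since \<open>c'\<close> only meets finitely
  many sheets and \<open>k \<noteq> 0\<close>, the fibre is finite; its cardinality divides 1. So \<open>p\<close> is injective. As the
  fibre over \<open>a\<close> consists of the cosets of \<open>H\<close>, the subgroup \<open>H\<close> is the whole group.

  The covering is constructed from path classes, for any subgroup \<open>H\<close>. The degree argument
  uses two facts about the local homology of manifolds: \<open>local_homology_infinite_order\<close>, and
  \<open>manifold_homology_ball\<close>, by which a class relative to the complement of a small ball is determined
  by its restriction to the centre of the ball.
\<close>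

section \<open>Excision and classes of relative cycles\<close>

lemma excision_closure_condition:
  assumes "openin X W" "X closure_of K \<subseteq> W"
  shows "X closure_of (topspace X - W) \<subseteq> X interior_of (topspace X - K)"
proof -
  have "X closure_of (topspace X - W) = topspace X - W"
    using assms(1) by (simp add: closure_of_closedin closedin_def Diff_Diff_Int openin_subset inf.absorb2)
  then show ?thesis
    using assms(2) by (auto simp: interior_of_complement)
qed

text \<open>
  Excising the complement of an open set \<open>W\<close>: local homology at \<open>K\<close> can be computed in any
  neighbourhood \<open>W\<close> of the closure of \<open>K\<close>. This lemma is the surjectivity, the next one the
  injectivity of the excision isomorphism, both for chains.
\<close>

lemma excision_relcycle_exists:
  assumes "openin X W" "X closure_of K \<subseteq> W" "K \<subseteq> topspace X"
    and z: "singular_relcycle n X (topspace X - K) z"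
  obtains z' where "singular_relcycle n (subtopology X W) (W - K) z'"
    "homologous_rel n X (topspace X - K) z z'"
proof -
  have W: "W \<subseteq> topspace X" using assms(1) openin_subset by blast
  have "singular_relcycle n (subtopology X (topspace X)) (topspace X - K) z"
    using z by simp
  then obtain z' where z': "singular_relcycle n (subtopology X (topspace X - (topspace X - W))) ((topspace X - K) - (topspace X - W)) z'"
    "homologous_rel n (subtopology X (topspace X)) (topspace X - K) z z'"
    using excised_relcycle_exists[OF excision_closure_condition[OF assms(1,2)] Diff_subset] by metis
  have "topspace X - (topspace X - W) = W" "(topspace X - K) - (topspace X - W) = W - K"
    using W by auto
  then show thesis using z' that by simp
qed

lemma excision_relboundary:
  assumes "openin X W" "X closure_of K \<subseteq> W"
    and z: "singular_relcycle n (subtopology X W) (W - K) z"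
    and b: "singular_relboundary n X (topspace X - K) z"
  shows "singular_relboundary n (subtopology X W) (W - K) z"
proof -
  have W: "W \<subseteq> topspace X" using assms(1) openin_subset by blast
  have eq: "topspace X - (topspace X - W) = W" "(topspace X - K) - (topspace X - W) = W - K"
    using W by auto
  let ?G = "relative_homology_group (int n) (subtopology X W) (W - K)"
  let ?h = "hom_induced (int n) (subtopology X W) (W - K) X (topspace X - K) id"
  have "?h \<in> iso ?G (relative_homology_group (int n) X (topspace X - K))"
    using homology_excision_axiom[OF excision_closure_condition[OF assms(1,2)] Diff_subset, of "int n"]
    by (simp add: eq)
  then have inj: "inj_on ?h (carrier ?G)"
    by (simp add: iso_def bij_betw_def)
  have cont: "continuous_map (subtopology X W) X id"
    by (simp add: continuous_map_from_subtopology)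
  have im: "id \<in> (W - K) \<rightarrow> (topspace X - K)"
    using W by auto
  have ch: "chain_map n id z = z" "chain_map n id (0::'a chain) = 0"
    using z by (auto simp: singular_relcycle intro: chain_map_ident)
  have "?h (homologous_rel_set n (subtopology X W) (W - K) z) = homologous_rel_set n X (topspace X - K) z"
    using hom_induced_chain_map[OF cont im z] ch by simp
  moreover have "?h (homologous_rel_set n (subtopology X W) (W - K) 0) = homologous_rel_set n X (topspace X - K) 0"
    using hom_induced_chain_map[OF cont im singular_relcycle_0] ch by simp
  moreover have "homologous_rel_set n X (topspace X - K) z = homologous_rel_set n X (topspace X - K) 0"
    unfolding homologous_rel_set_eq using b by (simp add: homologous_rel_def)
  ultimately have "homologous_rel_set n (subtopology X W) (W - K) z = homologous_rel_set n (subtopology X W) (W - K) 0"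
    using inj z by (auto simp: inj_on_def carrier_relative_homology_group)
  then show ?thesis
    unfolding homologous_rel_set_eq by (simp add: homologous_rel_def)
qed

lemma singular_relboundary_mono:
  assumes "singular_relboundary n X S c" "S \<subseteq> T"
  shows "singular_relboundary n X T c"
  using assms singular_chain_mono unfolding singular_relboundary by blast

lemma homologous_rel_mono:
  assumes "homologous_rel n X S c d" "S \<subseteq> T"
  shows "homologous_rel n X T c d"
  using assms singular_relboundary_mono unfolding homologous_rel_def by blast

lemma singular_relcycle_mono:
  assumes "singular_relcycle n X S c" "S \<subseteq> T"
  shows "singular_relcycle n X T c"
  using assms singular_chain_mono unfolding singular_relcycle by blast

lemma homologous_rel_chain_map:
  assumes "homologous_rel n X S c d" "continuous_map X Y g" "g \<in> S \<rightarrow> T"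
  shows "homologous_rel n Y T (chain_map n g c) (chain_map n g d)"
  using singular_relboundary_chain_map[OF _ assms(2,3)] assms(1)
  unfolding homologous_rel_def by (metis chain_map_diff)

lemma homologous_rel_cmul:
  assumes "homologous_rel n X S c d"
  shows "homologous_rel n X S (frag_cmul k c) (frag_cmul k d)"
proof -
  have "frag_cmul k (c - d) = frag_cmul k c - frag_cmul k d"
    using frag_cmul_distrib2[of k "c - d" d] by (simp add: algebra_simps)
  then show ?thesis
    using singular_relboundary_cmul[of n X S "c - d" k] assms unfolding homologous_rel_def by simp
qed

text \<open>
  Homology classes are sets of chains. This and the next lemma compute in the homology group with
  representatives.
\<close>

lemma relative_homology_mult_classes:
  assumes "singular_relcycle n X S c" "singular_relcycle n X S d"
  shows "homologous_rel_set n X S c \<otimes>\<^bsub>relative_homology_group (int n) X S\<^esub> homologous_rel_set n X S d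
    = homologous_rel_set n X S (c + d)"
proof -
  have "\<exists>r s. homologous_rel n X S c r \<and> homologous_rel n X S d s \<and> e = r + s"
    if "homologous_rel n X S (c+d) e" for e
  proof (intro exI conjI)
    show "homologous_rel n X S c c" by simp
    show "homologous_rel n X S d (e - c)"
      using homologous_rel_diff[OF that, of c c] by simp
    show "e = c + (e - c)" by simp
  qed
  then show ?thesis
    unfolding mult_relative_homology_group by (auto intro: homologous_rel_add)
qed

lemma relative_homology_inv_class:
  assumes "singular_relcycle n X S c"
  shows "inv\<^bsub>relative_homology_group (int n) X S\<^esub> homologous_rel_set n X S c
    = homologous_rel_set n X S (- c)"
proof -
  interpret group "relative_homology_group (int n) X S" by simp
  show ?thesis
  proof (rule inv_equality)
    show "homologous_rel_set n X S (- c) \<otimes>\<^bsub>relative_homology_group (int n) X S\<^esub> homologous_rel_set n X S c = \<one>\<^bsub>relative_homology_group (int n) X S\<^esub>"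
      unfolding relative_homology_mult_classes[OF singular_relcycle_minus[THEN iffD2, OF assms] assms]
        one_relative_homology_group homologous_rel_set_eq_relboundary by simp
    have "homologous_rel_set n X S d \<in> carrier (relative_homology_group (int n) X S)" if "singular_relcycle n X S d" for d
      using that unfolding carrier_relative_homology_group by blast
    then show "homologous_rel_set n X S c \<in> carrier (relative_homology_group (int n) X S)"
      "homologous_rel_set n X S (- c) \<in> carrier (relative_homology_group (int n) X S)"
      using assms singular_relcycle_minus by blast+
  qed
qed

lemma generate_homology_class:
  assumes c: "singular_relcycle n X S c"
    and "h \<in> generate (relative_homology_group (int n) X S) {homologous_rel_set n X S c}"
  shows "\<exists>k. h = homologous_rel_set n X S (frag_cmul k c)"
  using assms(2)
proof induction
  case one
  have "\<one>\<^bsub>relative_homology_group (int n) X S\<^esub> = homologous_rel_set n X S (frag_cmul 0 c)"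
    unfolding one_relative_homology_group frag_cmul_zero by (simp add: homologous_rel_def singular_relboundary_minus)
  then show ?case by blast
next
  case (incl h)
  then show ?case by (intro exI[of _ 1]) (simp only: frag_cmul_one singleton_iff)
next
  case (inv h)
  then have "h = homologous_rel_set n X S c" by blast
  then show ?case using relative_homology_inv_class[OF c] by (intro exI[of _ "-1"]) (simp only: frag_cmul_minus_one)
next
  case (eng h1 h2)
  from eng(3,4) obtain k1 k2 where h: "h1 = homologous_rel_set n X S (frag_cmul k1 c)"
    "h2 = homologous_rel_set n X S (frag_cmul k2 c)" by (elim exE)
  show ?case unfolding h
    using relative_homology_mult_classes[OF singular_relcycle_cmul[OF c, of k1] singular_relcycle_cmul[OF c, of k2]]
    by (intro exI[of _ "k1+k2"]) (simp only: frag_cmul_distrib)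
qed

lemma contractible_space_cycle_is_boundary:
  assumes "contractible_space X" "0 < n" "singular_relcycle n X {} c"
  shows "singular_relboundary n X {} c"
proof -
  have "trivial_group (homology_group (int n) X)"
    using trivial_reduced_homology_group_contractible_space[OF assms(1), of "int n"] assms(2)
    by (simp add: un_reduced_homology_group)
  then have "carrier (homology_group (int n) X) = {\<one>\<^bsub>homology_group (int n) X\<^esub>}"
    by (simp add: trivial_group_def)
  moreover have "homologous_rel_set n X {} c \<in> carrier (homology_group (int n) X)"
    unfolding carrier_relative_homology_group by (rule imageI) (use assms(3) in simp)
  ultimately have "homologous_rel_set n X {} c = singular_relboundary_set n X {}"
    unfolding one_relative_homology_group by (simp only: singleton_iff)
  then show ?thesis by (simp only: homologous_rel_set_eq_relboundary)
qed

text \<open>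
  Write \<open>w = \<partial>d + v\<close> with \<open>v\<close> in \<open>A\<close>. Since \<open>\<partial>w = \<partial>v\<close> already lies in \<open>B\<close>, retracting \<open>v\<close> into \<open>B\<close> does
  not change its boundary, so \<open>w\<close> minus the retracted \<open>v\<close> is an absolute cycle in a contractible space.
  The map \<open>r\<close> is defined on \<open>A\<close> only: a retraction of a punctured ball onto a neighbourhood of its
  boundary does not extend continuously to the centre.
\<close>

lemma relboundary_through_retraction:
  assumes U: "contractible_space U" "0 < n"
    and r: "continuous_map (subtopology U A) (subtopology U B) r" "\<And>x. x \<in> topspace U \<Longrightarrow> x \<in> B \<Longrightarrow> r x = x"
    and w: "singular_relcycle n U B w" and b: "singular_relboundary n U A w" and BA: "B \<subseteq> A"
  shows "singular_relboundary n U B w"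
proof -
  obtain d v where d: "singular_chain (Suc n) U d" and v: "singular_chain n (subtopology U A) v"
    and w_eq: "chain_boundary (Suc n) d + v = w"
    using b unfolding singular_relboundary by blast
  let ?v = "chain_map n r v"
  have v': "singular_chain n (subtopology U B) ?v"
    using singular_chain_chain_map[OF v r(1)] .
  have bw: "chain_boundary n w = chain_boundary n v"
    using chain_boundary_boundary_alt[OF d] by (simp add: chain_boundary_add flip: w_eq)
  have wB: "singular_chain (n-1) (subtopology U B) (chain_boundary n w)" and wU: "singular_chain n U w"
    using w by (auto simp: singular_relcycle)
  have "chain_boundary n ?v = chain_map (n-1) r (chain_boundary n w)"
    using chain_boundary_chain_map[OF v, of r] bw by simp
  also have "\<dots> = chain_boundary n w"
    by (rule chain_map_id_gen[OF wB]) (use r(2) in auto)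
  finally have "chain_boundary n (w - ?v) = 0" by (simp add: chain_boundary_diff)
  moreover have vU: "singular_chain n U ?v" using v' singular_chain_subtopology by blast
  ultimately have "singular_relcycle n U {} (w - ?v)"
    using wU by (simp add: singular_cycle singular_chain_diff)
  then have "singular_relboundary n U {} (w - ?v)"
    using contractible_space_cycle_is_boundary U by blast
  then have "singular_relboundary n U B (w - ?v)"
    using singular_relboundary_mono by blast
  then have "singular_relboundary n U B (w - ?v + ?v)"
    using singular_chain_imp_relboundary[OF v'] singular_relboundary_add by blast
  then show ?thesis by simp
qed

text \<open>
  The top reduced homology group of the sphere is infinite cyclic; \<open>s\<close> represents a generator. That the
  class is reduced makes \<open>s\<close> a boundary in Euclidean space also when \<open>m = 0\<close>.
\<close>

lemma sphere_cycle_infinite_order: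
  obtains s where "singular_relcycle m (nsphere m) {} s"
    "homologous_rel_set m (nsphere m) {} s \<in> carrier (reduced_homology_group (int m) (nsphere m))"
    "\<And>k. singular_relboundary m (nsphere m) {} (frag_cmul k s) \<Longrightarrow> k = 0"
proof -
  let ?X = "nsphere m"
  let ?G = "reduced_homology_group (int m) ?X"
  obtain g where g: "g \<in> iso ?G integer_group"
    using reduced_homology_group_nsphere(1)[of m] unfolding is_iso_def by blast
  have ghom: "g \<in> hom ?G integer_group" and gbij: "bij_betw g (carrier ?G) UNIV"
    using g by (auto simp: iso_def)
  obtain A where A: "A \<in> carrier ?G" "g A = 1"
    using gbij unfolding bij_betw_def by (metis UNIV_I imageE)
  then obtain s where s: "singular_relcycle m ?X {} s" "A = homologous_rel_set m ?X {} s"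
    using carrier_reduced_homology_group_subset[of "int m" ?X]
    unfolding carrier_relative_homology_group by blast
  let ?c = "\<lambda>k. homologous_rel_set m ?X {} (frag_cmul k s)"
  interpret G: group ?G by simp
  have mult: "?c j \<otimes>\<^bsub>?G\<^esub> ?c k = ?c (j + k)" for j k
  proof -
    have "?c j \<otimes>\<^bsub>?G\<^esub> ?c k = ?c j \<otimes>\<^bsub>homology_group (int m) ?X\<^esub> ?c k"
      by (simp add: reduced_homology_group_def)
    then show ?thesis
      using relative_homology_mult_classes[OF singular_relcycle_cmul[OF s(1), of j] singular_relcycle_cmul[OF s(1), of k]]
      by (simp only: frag_cmul_distrib)
  qed
  have one: "?c 0 = \<one>\<^bsub>?G\<^esub>"
    unfolding one_reduced_homology_group one_relative_homology_group homologous_rel_set_eq_relboundary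
    by simp
  have c1: "?c 1 \<in> carrier ?G" using A(1) unfolding s(2) frag_cmul_one .
  have cm1: "?c (-1) = inv\<^bsub>?G\<^esub> ?c 1 "
  proof -
    have "?c (-1) = inv\<^bsub>homology_group (int m) ?X\<^esub> ?c 1"
      using relative_homology_inv_class[OF s(1)] by (simp only: frag_cmul_minus_one frag_cmul_one)
    also have "\<dots> = inv\<^bsub>?G\<^esub> ?c 1"
    proof -
      interpret H: group "homology_group (int m) ?X" by simp
      show ?thesis
        using H.inv_subgroup_generated[OF c1[unfolded reduced_homology_group_def]]
        unfolding reduced_homology_group_def by (rule sym)
    qed
    finally show ?thesis .
  qed
  define cl where "cl k = ?c k" for k
  have cl: "cl j \<otimes>\<^bsub>?G\<^esub> cl k = cl (j + k)" "cl 0 = \<one>\<^bsub>?G\<^esub>" "cl 1 \<in> carrier ?G"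
    "cl (-1) = inv\<^bsub>?G\<^esub> cl 1" "g (cl 1) = 1" for j k
    unfolding cl_def using mult one c1 cm1 A(2) by (simp_all only: frag_cmul_one s(2))
  have clm: "cl (-1) \<in> carrier ?G" using cl(3,4) by simp
  have g0: "g (cl 0) = 0" unfolding cl(2) using hom_one[OF ghom] by simp
  have gm: "g (cl (-1)) = -1"
    using hom_mult[OF ghom clm cl(3)] cl(1)[of "-1" 1] cl(5) g0 by simp
  \<comment> \<open>\<open>k \<mapsto> g (cl k)\<close> is an additive map on the integers with value 1 at 1\<close>
  have gk: "cl k \<in> carrier ?G \<and> g (cl k) = k" for k
  proof (induction k rule: int_induct[where k=0])
    case base
    then show ?case using g0 cl(2) G.one_closed by simp
  next
    case (step1 i)
    then show ?case
      using cl(1)[of i 1] hom_mult[OF ghom _ cl(3), of "cl i"] G.m_closed[OF _ cl(3), of "cl i"] cl(5) by simp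
  next
    case (step2 i)
    then show ?case
      using cl(1)[of i "-1"] hom_mult[OF ghom _ clm, of "cl i"] G.m_closed[OF _ clm, of "cl i"] gm by simp
  qed
  show thesis
  proof (rule that[OF s(1)])
    show "homologous_rel_set m ?X {} s \<in> carrier ?G"
      using A(1) unfolding s(2) .
    fix k assume "singular_relboundary m ?X {} (frag_cmul k s)"
    then have "cl k = cl 0"
      unfolding cl_def homologous_rel_set_eq by (simp add: homologous_rel_def)
    then have "g (cl k) = g (cl 0)" by (rule arg_cong)
    then show "k = 0" using gk[of k] g0 by linarith
  qed
qed

section \<open>Local homology of manifolds\<close>

lemma powertop_real_box:
  fixes z :: "'i \<Rightarrow> real"
  assumes "openin (powertop_real UNIV) T" "z \<in> T"
  obtains I e where "finite I" "e > 0" "\<And>y. (\<And>i. i \<in> I \<Longrightarrow> \<bar>y i - z i\<bar> < e) \<Longrightarrow> y \<in> T"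
proof -
  obtain X where X: "z \<in> PiE UNIV X" "\<And>i. open (X i)" "finite {i. X i \<noteq> UNIV}" "PiE UNIV X \<subseteq> T"
    using product_topology_open_contains_basis[OF assms] by auto
  let ?I = "{i. X i \<noteq> UNIV}"
  have "\<exists>e>0. ball (z i) e \<subseteq> X i" for i
    using X(1,2) by (metis PiE_E UNIV_I open_contains_ball)
  then obtain e where e: "\<And>i. e i > 0" "\<And>i. ball (z i) (e i) \<subseteq> X i" by metis
  show thesis
  proof
    show "finite ?I" by fact
    \<comment> \<open>the element 1 keeps the set nonempty if all factors are unrestricted\<close>
    show "Min (insert 1 (e ` ?I)) > 0" using X(3) e by auto
    fix y assume y: "\<And>i. i \<in> ?I \<Longrightarrow> \<bar>y i - z i\<bar> < Min (insert 1 (e ` ?I))"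
    have "y i \<in> X i" for i
    proof (cases "i \<in> ?I")
      case True
      then have "\<bar>y i - z i\<bar> < e i" using y[OF True] X(3) by auto
      then have "y i \<in> ball (z i) (e i)" by (simp add: dist_real_def abs_minus_commute)
      then show ?thesis using e by blast
    qed auto
    then show "y \<in> T" using X(4) by auto
  qed
qed

abbreviation enorm :: "nat \<Rightarrow> (nat \<Rightarrow> real) \<Rightarrow> real" where
  "enorm n v \<equiv> L2_set v {..<n}"

lemma continuous_map_enorm:
  assumes "continuous_map X (Euclidean_space n) f"
  shows "continuous_map X euclideanreal (\<lambda>x. enorm n (f x))"
proof -
  have "continuous_map X euclideanreal (\<lambda>x. f x i)" for i
    using assms by (simp add: Euclidean_space_def continuous_map_in_subtopology continuous_map_componentwise_UNIV)
  then show ?thesis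
    unfolding L2_set_def by (intro continuous_intros) auto
qed

lemma abs_component_le_enorm:
  assumes "i < n" shows "\<bar>v i\<bar> \<le> enorm n v"
  using member_le_L2_set[of "{..<n}" i "\<lambda>i. \<bar>v i\<bar>"] assms by (simp add: L2_set_def)

lemma enorm_eq_0_iff:
  assumes "v \<in> topspace (Euclidean_space n)"
  shows "enorm n v = 0 \<longleftrightarrow> v = (\<lambda>_. 0)"
  using assms by (auto simp: L2_set_eq_0_iff topspace_Euclidean_space fun_eq_iff) (metis lessThan_iff not_le)

lemma enorm_scale: "enorm n (\<lambda>i. c * v i) = \<bar>c\<bar> * enorm n v"
  using L2_set_right_distrib[of "\<bar>c\<bar>" v "{..<n}"] by (simp add: L2_set_def power_mult_distrib)

lemma compactin_Euclidean_ball: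
  "compactin (Euclidean_space n) {v \<in> topspace (Euclidean_space n). enorm n v \<le> r}" (is "compactin _ ?C")
proof -
  have "closedin (Euclidean_space n) {v \<in> topspace (Euclidean_space n). enorm n v \<in> {..r}}"
    by (rule closedin_continuous_map_preimage[OF continuous_map_enorm[OF continuous_map_id, unfolded id_def]]) simp
  then have "closedin (Euclidean_space n) ?C" by simp
  then have "closedin (powertop_real UNIV) ?C"
    by (simp add: closedin_Euclidean_space_iff euclidean_product_topology)
  \<comment> \<open>coordinates from \<open>n\<close> on are 0, which has to lie in the interval even if \<open>r\<close> is negative\<close>
  moreover have "?C \<subseteq> UNIV \<rightarrow>\<^sub>E {-max r 0..max r 0}"
  proof -
    have "\<bar>v i\<bar> \<le> max r 0" if "v \<in> topspace (Euclidean_space n)" "enorm n v \<le> r" for v i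
      using that abs_component_le_enorm[of i n v] by (cases "i < n") (auto simp: topspace_Euclidean_space)
    then show ?thesis by (force simp: abs_le_iff)
  qed
  moreover have "compactin (powertop_real UNIV) (UNIV \<rightarrow>\<^sub>E {-max r 0..max r 0})"
    by (simp add: compactin_PiE)
  ultimately have "compactin (powertop_real UNIV) ?C"
    using closed_compactin by blast
  then show ?thesis
    by (auto simp: Euclidean_space_def compactin_subtopology)
qed

lemma Euclidean_open_contains_ball:
  assumes "openin (Euclidean_space n) T" "(\<lambda>_. 0) \<in> T"
  obtains r where "r > 0" "\<And>v. v \<in> topspace (Euclidean_space n) \<Longrightarrow> enorm n v \<le> r \<Longrightarrow> v \<in> T"
proof -
  obtain T' where T': "openin (powertop_real UNIV) T'" "T = T' \<inter> {x. \<forall>i\<ge>n. x i = 0}"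
    using assms(1) unfolding Euclidean_space_def openin_subtopology by blast
  have "(\<lambda>_. 0) \<in> T'" using assms(2) T'(2) by simp
  from powertop_real_box[OF T'(1) this] obtain I e
    where e: "e > 0" "\<And>y. (\<And>i. i \<in> I \<Longrightarrow> \<bar>y i - 0\<bar> < e) \<Longrightarrow> y \<in> T'"
    by metis
  show thesis
  proof
    show "e / 2 > 0" using e by simp
    fix v :: "nat \<Rightarrow> real" assume v: "v \<in> topspace (Euclidean_space n)" "enorm n v \<le> e / 2"
    have "\<bar>v i - 0\<bar> < e" for i
      using v e(1) abs_component_le_enorm[of i n v] by (cases "i < n") (auto simp: topspace_Euclidean_space)
    then show "v \<in> T" using e(2) T'(2) v(1) by (auto simp: topspace_Euclidean_space)
  qed
qed

lemma manifold_centered_chart: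
  assumes M: "manifold n M" and T: "openin M T" "x \<in> T"
  obtains U \<phi> \<psi> r where "openin M U" "x \<in> U" 
    "homeomorphic_maps (subtopology M U) (Euclidean_space n) \<phi> \<psi>" "\<phi> x = (\<lambda>_. 0)"
    "r > 0" "\<And>v. v \<in> topspace (Euclidean_space n) \<Longrightarrow> enorm n v \<le> r \<Longrightarrow> \<psi> v \<in> T"
proof -
  let ?E = "Euclidean_space n"
  have x: "x \<in> topspace M" using T openin_subset by blast
  obtain U f g where U: "openin M U" "x \<in> U" and fg: "homeomorphic_maps (subtopology M U) ?E f g"
    using M x unfolding manifold_def homeomorphic_space_def by blast
  have UM: "U \<subseteq> topspace M" using U openin_subset by blast
  have f: "continuous_map (subtopology M U) ?E f" and g: "continuous_map ?E (subtopology M U) g"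
    and gf: "\<And>y. y \<in> U \<Longrightarrow> g (f y) = y" and fgv: "\<And>v. v \<in> topspace ?E \<Longrightarrow> f (g v) = v"
    using fg UM unfolding homeomorphic_maps_def by auto
  define \<phi> where "\<phi> y = (\<lambda>i. f y i - f x i)" for y
  define \<psi> where "\<psi> v = g (\<lambda>i. v i + f x i)" for v
  have fx: "f x \<in> topspace ?E" using f U UM by (auto simp: continuous_map_def)
  have \<phi>: "continuous_map (subtopology M U) ?E \<phi>"
    unfolding \<phi>_def by (rule continuous_map_Euclidean_space_diff[OF f]) (use fx in simp)
  have add: "continuous_map ?E ?E (\<lambda>v i. v i + f x i)"
    by (rule continuous_map_Euclidean_space_add[OF continuous_map_id[unfolded id_def]]) (use fx in simp)
  have \<psi>: "continuous_map ?E (subtopology M U) \<psi>"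
    using continuous_map_compose[OF add g] by (simp add: \<psi>_def[abs_def] o_def)
  have hm: "homeomorphic_maps (subtopology M U) ?E \<phi> \<psi>"
    unfolding homeomorphic_maps_def
  proof (intro conjI ballI \<phi> \<psi>)
    show "\<psi> (\<phi> y) = y" if "y \<in> topspace (subtopology M U)" for y
      using that gf by (simp add: \<phi>_def \<psi>_def)
    show "\<phi> (\<psi> v) = v" if "v \<in> topspace ?E" for v
    proof -
      have "(\<lambda>i. v i + f x i) \<in> topspace ?E"
        using add that by (auto simp: continuous_map_def)
      then show ?thesis using fgv by (simp add: \<phi>_def \<psi>_def)
    qed
  qed
  have "openin ?E {v \<in> topspace ?E. \<psi> v \<in> T \<inter> U}"
    by (rule openin_continuous_map_preimage[OF \<psi>]) (use T U in \<open>auto simp: openin_subtopology\<close>)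
  moreover have "(\<lambda>_. 0) \<in> {v \<in> topspace ?E. \<psi> v \<in> T \<inter> U}"
    using gf[OF U(2)] U T by (simp add: \<psi>_def topspace_Euclidean_space)
  ultimately obtain r where "r > 0" "\<And>v. v \<in> topspace ?E \<Longrightarrow> enorm n v \<le> r \<Longrightarrow> v \<in> {v \<in> topspace ?E. \<psi> v \<in> T \<inter> U}"
    using Euclidean_open_contains_ball by blast
  with U hm show thesis by (intro that[of U \<phi> \<psi> r]) (auto simp: \<phi>_def)
qed

lemma homeomorphic_mapsD:
  assumes "homeomorphic_maps (subtopology M U) E \<phi> \<psi>" "U \<subseteq> topspace M"
  shows "continuous_map (subtopology M U) E \<phi>" "continuous_map E (subtopology M U) \<psi>"
    "\<And>y. y \<in> U \<Longrightarrow> \<psi> (\<phi> y) = y" "\<And>v. v \<in> topspace E \<Longrightarrow> \<phi> (\<psi> v) = v"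
    "\<And>y. y \<in> U \<Longrightarrow> \<phi> y \<in> topspace E" "\<And>v. v \<in> topspace E \<Longrightarrow> \<psi> v \<in> U"
  using assms unfolding homeomorphic_maps_def by (auto simp: continuous_map_def Pi_iff)

text \<open>
  Classes in \<open>H\<^sub>n(M, M - V)\<close> are detected at the single point \<open>x\<close> if \<open>V\<close> is a round ball around \<open>x\<close> in a
  chart: the radial retraction of the punctured chart onto the complement of \<open>V\<close> allows an
  application of \<open>relboundary_through_retraction\<close>. This is the source of the local constancy of
  degrees.
\<close>

lemma manifold_homology_ball:
  assumes M: "manifold n M" and n: "0 < n" and T: "openin M T" "x \<in> T"
  obtains V where "openin M V" "x \<in> V" "M closure_of V \<subseteq> T"
    "\<And>z. \<lbrakk>singular_relcycle n M (topspace M - V) z; singular_relboundary n M (topspace M - {x}) z\<rbrakk>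
      \<Longrightarrow> singular_relboundary n M (topspace M - V) z"
proof -
  let ?E = "Euclidean_space n"
  obtain U \<phi> \<psi> r where U: "openin M U" "x \<in> U" 
    and hm: "homeomorphic_maps (subtopology M U) ?E \<phi> \<psi>" and x0: "\<phi> x = (\<lambda>_. 0)"
    and r: "r > 0" "\<And>v. v \<in> topspace ?E \<Longrightarrow> enorm n v \<le> r \<Longrightarrow> \<psi> v \<in> T"
    using manifold_centered_chart[OF M T] by blast
  have UM: "U \<subseteq> topspace M" using U openin_subset by blast
  note h = homeomorphic_mapsD[OF hm UM]
  define V where "V = {y \<in> U. enorm n (\<phi> y) < r}"
  have VU: "V \<subseteq> U" by (auto simp: V_def)
  have Haus: "Hausdorff_space M" using M by (simp add: manifold_def)
  have "openin (subtopology M U) {y \<in> topspace (subtopology M U). enorm n (\<phi> y) \<in> {..<r}}"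
    by (rule openin_continuous_map_preimage[OF continuous_map_enorm[OF h(1)]]) simp
  moreover have "{y \<in> topspace (subtopology M U). enorm n (\<phi> y) \<in> {..<r}} = V"
    using UM by (auto simp: V_def)
  ultimately have Vo: "openin M V" using U(1) openin_trans_full by metis
  have xV: "x \<in> V" using U r(1) by (simp add: V_def x0 L2_set_def)
  have cl: "M closure_of V \<subseteq> \<psi> ` {v \<in> topspace ?E. enorm n v \<le> r}" (is "_ \<subseteq> ?C")
  proof (rule closure_of_minimal)
    show "V \<subseteq> ?C"
    proof
      fix y assume "y \<in> V"
      then show "y \<in> ?C" using h(3,5) by (intro image_eqI[of _ _ "\<phi> y"]) (auto simp: V_def)
    qed
    have "continuous_map ?E M \<psi>" using h(2) continuous_map_in_subtopology by blast
    then have "compactin M ?C" using compactin_Euclidean_ball image_compactin by blast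
    then show "closedin M ?C" using Haus compactin_imp_closedin by blast
  qed
  then have clT: "M closure_of V \<subseteq> T" and clU: "M closure_of V \<subseteq> U" using r h(6) by auto
  have clx: "M closure_of {x} \<subseteq> U"
    using closure_of_mono[of "{x}" V M] xV clU by auto
  have contr: "contractible_space (subtopology M U)"
    using hm homeomorphic_maps_imp_homeomorphic_space homeomorphic_space_contractibility contractible_Euclidean_space by blast
  \<comment> \<open>radial retraction: the factor exceeds 1 exactly inside the ball of radius \<open>r\<close>\<close>
  define \<rho> where "\<rho> y = \<psi> (\<lambda>i. max 1 (r / enorm n (\<phi> y)) * \<phi> y i)" for y
  have scale: "(\<lambda>i. c * v i) \<in> topspace ?E" if "v \<in> topspace ?E" for c v
    using that by (simp add: topspace_Euclidean_space)
  have pos: "enorm n (\<phi> y) > 0" if "y \<in> U - {x}" for y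
  proof -
    have "\<phi> y \<noteq> (\<lambda>_. 0)" using that U h(3) x0 by (metis DiffE insertI1)
    then show ?thesis using enorm_eq_0_iff[OF h(5), of y] that by (simp add: order_less_le)
  qed
  let ?A = "subtopology M (U - {x})"
  have phiA: "continuous_map ?A ?E \<phi>"
    using h(1) continuous_map_from_subtopology_mono by blast
  have topA: "topspace ?A = U - {x}" using UM by auto
  have c1: "continuous_map ?A euclideanreal (\<lambda>y. max 1 (r / enorm n (\<phi> y)))"
    using continuous_map_enorm[OF phiA]
  proof (intro continuous_intros)
    fix y assume "y \<in> topspace ?A"
    then show "enorm n (\<phi> y) \<noteq> 0" using pos[of y] unfolding topA by simp
  qed auto
  have "continuous_map ?A ?E (\<lambda>y i. max 1 (r / enorm n (\<phi> y)) * \<phi> y i)"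
    unfolding Euclidean_space_def continuous_map_in_subtopology continuous_map_componentwise_UNIV
  proof (intro conjI allI)
    fix i
    have "continuous_map ?A euclideanreal (\<lambda>y. \<phi> y i)"
      using phiA by (simp add: Euclidean_space_def continuous_map_in_subtopology continuous_map_componentwise_UNIV)
    then show "continuous_map ?A euclideanreal (\<lambda>y. max 1 (r / enorm n (\<phi> y)) * \<phi> y i)"
      by (rule continuous_map_real_mult[OF c1])
    show "(\<lambda>y i. max 1 (r / enorm n (\<phi> y)) * \<phi> y i) \<in> topspace ?A \<rightarrow> {x. \<forall>i\<ge>n. x i = 0}"
      using h(5) unfolding topA by (auto simp: topspace_Euclidean_space)
  qed
  from continuous_map_compose[OF this h(2)] have "continuous_map ?A (subtopology M U) \<rho>"
    by (simp add: \<rho>_def[abs_def] o_def)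
  moreover have "\<rho> y \<in> U - V" if "y \<in> U - {x}" for y
  proof -
    let ?v = "\<lambda>i. max 1 (r / enorm n (\<phi> y)) * \<phi> y i"
    have vE: "?v \<in> topspace ?E" using scale h(5) that by blast
    have "r / enorm n (\<phi> y) * enorm n (\<phi> y) \<le> max 1 (r / enorm n (\<phi> y)) * enorm n (\<phi> y)"
      using pos[OF that] by (intro mult_right_mono) auto
    then have "enorm n ?v \<ge> r" using pos[OF that] by (simp add: enorm_scale)
    then show ?thesis using h(4)[OF vE] h(6)[OF vE] by (simp add: \<rho>_def V_def)
  qed
  ultimately have rho: "continuous_map ?A (subtopology M (U - V)) \<rho>"
    by (auto simp: continuous_map_in_subtopology topA)
  have sub: "subtopology (subtopology M U) (U - {x}) = ?A" "subtopology (subtopology M U) (U - V) = subtopology M (U - V)"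
    by (simp_all add: subtopology_subtopology Int_absorb1)
  have rho_id: "\<rho> y = y" if "y \<in> U - V" for y
  proof -
    have e: "enorm n (\<phi> y) \<ge> r" using that by (auto simp: V_def)
    then have "r / enorm n (\<phi> y) \<le> 1" using r(1) by (simp add: divide_le_eq)
    then show ?thesis using h(3) that by (simp add: \<rho>_def max_absorb1)
  qed
  show thesis
  proof
    fix z assume z: "singular_relcycle n M (topspace M - V) z" "singular_relboundary n M (topspace M - {x}) z"
    have "V \<subseteq> topspace M" using VU UM by blast
    then obtain w where w: "singular_relcycle n (subtopology M U) (U - V) w" "homologous_rel n M (topspace M - V) z w"
      by (rule excision_relcycle_exists[OF U(1) clU _ z(1)])
    have "homologous_rel n M (topspace M - {x}) z w"
      using w(2) by (rule homologous_rel_mono) (use xV in auto)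
    then have "singular_relboundary n M (topspace M - {x}) (z - (z - w))"
      using singular_relboundary_diff[OF z(2)] unfolding homologous_rel_def by blast
    then have "singular_relboundary n M (topspace M - {x}) w" by simp
    moreover have "singular_relcycle n (subtopology M U) (U - {x}) w"
      using w(1) by (rule singular_relcycle_mono) (use xV in auto)
    ultimately have wb: "singular_relboundary n (subtopology M U) (U - {x}) w"
      using excision_relboundary[OF U(1) clx] by blast
    have "singular_relboundary n (subtopology M U) (U - V) w"
    proof (rule relboundary_through_retraction[OF contr n])
      show "continuous_map (subtopology (subtopology M U) (U - {x})) (subtopology (subtopology M U) (U - V)) \<rho>"
        unfolding sub by (rule rho)
      show "\<rho> y = y" if "y \<in> topspace (subtopology M U)" "y \<in> U - V" for y
        using rho_id[OF that(2)] .
      show "U - V \<subseteq> U - {x}" using xV by blast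
    qed (rule w(1) wb)+
    then have "singular_relboundary n M (topspace M - V) (chain_map n id w)"
      by (rule singular_relboundary_chain_map) (use UM in \<open>auto simp: continuous_map_from_subtopology\<close>)
    moreover have "chain_map n id w = w"
      using w(1) chain_map_ident by (auto simp: singular_relcycle)
    ultimately have "singular_relboundary n M (topspace M - V) (w + (z - w))"
      using w(2) by (simp only: singular_relboundary_add homologous_rel_def)
    then show "singular_relboundary n M (topspace M - V) z" by simp
  qed (fact Vo xV clT)+
qed

text \<open>
  The cycle \<open>s\<close> of infinite order on the sphere bounds a chain \<open>u\<close> in Euclidean space. If a multiple of
  \<open>u\<close> vanished relative to the punctured space, then radial projection to the sphere would make the
  same multiple of \<open>s\<close> a boundary there.
\<close>

lemma local_homology_infinite_order:
  assumes M: "manifold n M" and n: "0 < n" and x: "x \<in> topspace M"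
  obtains z where "singular_relcycle n M (topspace M - {x}) z"
    "\<And>k. singular_relboundary n M (topspace M - {x}) (frag_cmul k z) \<Longrightarrow> k = 0"
proof -
  obtain m where m: "n = Suc m" using n gr0_implies_Suc by blast
  let ?E = "Euclidean_space n"
  let ?S = "nsphere m"
  let ?Q = "{v. (\<Sum>i\<le>m. v i ^ 2) = (1::real)}"
  have SE: "?S = subtopology ?E ?Q" by (simp add: nsphere_def m)
  have enorm1: "(\<Sum>i\<le>m. v i ^ 2) = (enorm n v)^2" for v
    by (simp add: L2_set_def m lessThan_Suc_atMost sum_nonneg)
  obtain s where s: "singular_relcycle m ?S {} s"
    "homologous_rel_set m ?S {} s \<in> carrier (reduced_homology_group (int m) ?S)"
    and s0: "\<And>k. singular_relboundary m ?S {} (frag_cmul k s) \<Longrightarrow> k = 0"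
    using sphere_cycle_infinite_order by blast
  have contE: "continuous_map ?S ?E id" unfolding SE by (simp add: continuous_map_from_subtopology)
  have sS: "singular_chain m ?S s" and s_bd: "chain_boundary m s = 0" using s(1) by (simp_all add: singular_cycle)
  have "hom_induced (int m) ?S {} ?E {} id (homologous_rel_set m ?S {} s) \<in> carrier (reduced_homology_group (int m) ?E)"
    using hom_induced_reduced[OF s(2)] .
  moreover have "hom_induced (int m) ?S {} ?E {} id (homologous_rel_set m ?S {} s) = homologous_rel_set m ?E {} s"
    using hom_induced_chain_map[OF contE _ s(1), of "{}"] chain_map_ident[OF sS] by simp
  moreover have "carrier (reduced_homology_group (int m) ?E) = {\<one>\<^bsub>reduced_homology_group (int m) ?E\<^esub>}"
    using trivial_reduced_homology_group_contractible_space[OF contractible_Euclidean_space] by (simp only: trivial_group_def)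
  ultimately have "homologous_rel_set m ?E {} s = singular_relboundary_set m ?E {}"
    by (simp only: one_reduced_homology_group one_relative_homology_group singleton_iff)
  then have "singular_relboundary m ?E {} s" by (simp only: homologous_rel_set_eq_relboundary)
  then obtain u where u: "singular_chain n ?E u" "chain_boundary n u = s"
    unfolding singular_boundary m by blast
  let ?P = "topspace ?E - {\<lambda>_. 0}"
  have S_E0: "?Q \<subseteq> - {\<lambda>_. 0}" by auto
  have sub0: "subtopology ?E ?P = subtopology ?E (- {\<lambda>_. 0})"
    by (metis Diff_eq subtopology_subtopology subtopology_topspace)
  have "singular_chain m (subtopology ?E ?P) s"
    using singular_chain_mono[OF sS[unfolded SE] S_E0] unfolding sub0 .
  then have u_rel: "singular_relcycle n ?E ?P u"
    using u by (simp add: singular_relcycle m)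
  obtain U \<phi> \<psi> where U: "openin M U" "x \<in> U" 
    and hm: "homeomorphic_maps (subtopology M U) ?E \<phi> \<psi>" and x0: "\<phi> x = (\<lambda>_. 0)"
    by (rule manifold_centered_chart[OF M openin_topspace x]) blast
  have UM: "U \<subseteq> topspace M" using U openin_subset by blast
  note h = homeomorphic_mapsD[OF hm UM]
  have clx: "M closure_of {x} \<subseteq> U"
  proof -
    have "closedin M {x}" using M x by (simp add: manifold_def closedin_Hausdorff_singleton)
    then show ?thesis using U(2) closure_of_closedin[of M "{x}"] by simp
  qed
  have psi0: "\<psi> \<in> ?P \<rightarrow> U - {x}"
    using h(4,6) x0 by fastforce
  have phi0: "\<phi> \<in> U - {x} \<rightarrow> ?P"
  proof
    fix y assume y: "y \<in> U - {x}"
    have "\<phi> y \<noteq> (\<lambda>_. 0)"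
    proof
      assume "\<phi> y = (\<lambda>_. 0)"
      then have "\<psi> (\<phi> y) = \<psi> (\<phi> x)" using x0 by simp
      then show False using h(3)[of y] h(3)[OF U(2)] y by simp
    qed
    then show "\<phi> y \<in> ?P" using h(5) y by simp
  qed
  let ?z = "chain_map n \<psi> u"
  have zU: "singular_relcycle n (subtopology M U) (U - {x}) ?z"
    using singular_relcycle_chain_map[OF u_rel h(2) psi0] .
  have psiM: "continuous_map ?E M \<psi>" using h(2) continuous_map_in_subtopology by blast
  show thesis
  proof
    have "\<psi> \<in> ?P \<rightarrow> topspace M - {x}" using psi0 UM by auto
    then show "singular_relcycle n M (topspace M - {x}) ?z"
      using singular_relcycle_chain_map[OF u_rel psiM] by blast
    fix k assume "singular_relboundary n M (topspace M - {x}) (frag_cmul k ?z)"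
    then have "singular_relboundary n (subtopology M U) (U - {x}) (frag_cmul k ?z)"
      using excision_relboundary[OF U(1) clx singular_relcycle_cmul[OF zU]] by blast
    then have "singular_relboundary n ?E ?P (chain_map n \<phi> (frag_cmul k ?z))"
      by (rule singular_relboundary_chain_map[OF _ h(1) phi0])
    moreover have "chain_map n \<phi> ?z = u"
    proof -
      have "chain_map n \<phi> ?z = chain_map n (\<phi> \<circ> \<psi>) u" by (simp add: chain_map_compose)
      also have "\<dots> = u" by (rule chain_map_id_gen[OF u(1)]) (simp add: h(4))
      finally show ?thesis .
    qed
    ultimately have "singular_relboundary n ?E ?P (frag_cmul k u)" by simp
    then obtain d e where d: "singular_chain (Suc n) ?E d" and e: "singular_chain n (subtopology ?E ?P) e"
      and de: "chain_boundary (Suc n) d + e = frag_cmul k u"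
      unfolding singular_relboundary by blast
    have ks: "frag_cmul k s = chain_boundary n e"
    proof -
      have "frag_cmul k s = chain_boundary n (chain_boundary (Suc n) d + e)"
        by (simp add: de chain_boundary_cmul u(2))
      then show ?thesis using chain_boundary_boundary_alt[OF d] by (simp add: chain_boundary_add)
    qed
    define g where "g v = (\<lambda>i. v i / enorm n v)" for v :: "nat \<Rightarrow> real"
    have nz: "enorm n v \<noteq> 0" if "v \<in> ?P" for v using that enorm_eq_0_iff[of v n] by blast
    let ?A = "subtopology ?E ?P"
    have topA: "topspace ?A = ?P" by auto
    have idA: "continuous_map ?A ?E (\<lambda>v. v)" by (simp add: continuous_map_from_subtopology)
    have gE: "continuous_map ?A ?E g"
      unfolding Euclidean_space_def continuous_map_in_subtopology continuous_map_componentwise_UNIV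
    proof (intro conjI allI)
      fix i
      have "continuous_map ?A euclideanreal (\<lambda>y. y i)"
        using idA by (simp add: Euclidean_space_def continuous_map_in_subtopology continuous_map_componentwise_UNIV)
      then have "continuous_map ?A euclideanreal (\<lambda>y. y i / enorm n y)"
        by (rule continuous_map_real_divide[OF _ continuous_map_enorm[OF idA]]) (use nz topA in blast)
      then show "continuous_map (subtopology (subtopology (powertop_real UNIV) {x. \<forall>i\<ge>n. x i = 0})
          (topspace (subtopology (powertop_real UNIV) {x. \<forall>i\<ge>n. x i = 0}) - {\<lambda>_. 0})) euclideanreal (\<lambda>x. g x i)"
        unfolding g_def by (simp only: Euclidean_space_def)
    qed (auto simp: g_def)
    have gS: "continuous_map ?A ?S g"
      unfolding SE continuous_map_in_subtopology topA
    proof (intro conjI gE funcsetI)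
      fix v assume v: "v \<in> ?P"
      have "enorm n (g v) = \<bar>1 / enorm n v\<bar> * enorm n v"
        using enorm_scale[where c = "1 / enorm n v" and n = n and v = v] by (simp add: g_def)
      also have "\<dots> = 1" using nz[OF v] by simp
      finally show "g v \<in> ?Q" by (simp add: enorm1)
    qed
    have e': "singular_chain n ?S (chain_map n g e)" using singular_chain_chain_map[OF e gS] .
    have "chain_boundary n (chain_map n g e) = chain_map m g (frag_cmul k s)"
      using chain_boundary_chain_map[OF e] by (simp add: ks m)
    also have "\<dots> = frag_cmul k s"
    proof (rule chain_map_id_gen[OF singular_chain_cmul[OF sS]])
      fix v assume "v \<in> topspace ?S"
      then have "(enorm n v)^2 = 1" unfolding SE enorm1[symmetric] by simp
      then have "enorm n v = 1" using L2_set_nonneg[of v "{..<n}"] by (simp add: power2_eq_1_iff)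
      then show "g v = v" by (simp add: g_def)
    qed
    finally have "singular_relboundary m ?S {} (frag_cmul k s)"
      using e' unfolding singular_boundary m by blast
    then show "k = 0" by (rule s0)
  qed
qed

section \<open>Splitting chains along disjoint open sets\<close>

definition chain_part :: "nat \<Rightarrow> 'b set \<Rightarrow> 'b chain \<Rightarrow> 'b chain" where
  "chain_part n W z = frag_extend (\<lambda>\<sigma>. if \<sigma> \<in> standard_simplex n \<rightarrow> W then frag_of \<sigma> else 0) z"

lemma pairwise_disjnt_unique:
  "\<lbrakk>pairwise disjnt \<W>; V \<in> \<W>; W \<in> \<W>; x \<in> V; x \<in> W\<rbrakk> \<Longrightarrow> V = W"
  by (auto simp: pairwise_def disjnt_def)

lemma singular_chain_chain_part:
  assumes "singular_chain n (subtopology X S) z"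
  shows "singular_chain n (subtopology X (S \<inter> W)) (chain_part n W z)"
proof -
  have "Poly_Mapping.keys (chain_part n W z) \<subseteq> {\<sigma> \<in> Poly_Mapping.keys z. \<sigma> \<in> standard_simplex n \<rightarrow> W}"
    unfolding chain_part_def using keys_frag_extend[of "\<lambda>\<sigma>. if \<sigma> \<in> standard_simplex n \<rightarrow> W then frag_of \<sigma> else 0" z]
    by (fastforce split: if_splits)
  then show ?thesis
    using assms unfolding singular_chain_def by (fastforce simp: singular_simplex_subtopology)
qed

text \<open>
  A face of a small simplex lies in \<open>W\<close> exactly if the simplex does, because different members of
  \<open>\<W>\<close> are disjoint.
\<close>

lemma chain_boundary_chain_part:
  assumes disj: "pairwise disjnt \<W>" and W: "W \<in> \<W>" and n: "0 < n"
    and z: "\<And>\<sigma>. \<sigma> \<in> Poly_Mapping.keys z \<Longrightarrow> \<exists>V\<in>\<W>. \<sigma> \<in> standard_simplex n \<rightarrow> V"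
  shows "chain_boundary n (chain_part n W z) = chain_part (n - 1) W (chain_boundary n z)"
proof -
  have "Poly_Mapping.keys z \<subseteq> {\<sigma>. \<exists>V\<in>\<W>. \<sigma> \<in> standard_simplex n \<rightarrow> V}" using z by blast
  then show ?thesis
  proof (induction z rule: frag_induction)
    case zero
    then show ?case by (simp add: chain_part_def)
  next
    case (one \<sigma>)
    then obtain V where V: "V \<in> \<W>" "\<sigma> \<in> standard_simplex n \<rightarrow> V" by blast
    have face: "singular_face n k \<sigma> \<in> standard_simplex (n - 1) \<rightarrow> V" if "k \<le> n" for k
      using V(2) n that simplical_face_in_standard_simplex[of n k] by (auto simp: singular_face_def)
    show ?case
    proof (cases "V = W")
      case True
      then show ?thesis
        using n V face by (simp add: chain_part_def chain_boundary_of frag_extend_sum frag_extend_cmul)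
    next
      case False
      then have VW: "V \<inter> W = {}" using disj V(1) W by (auto simp: pairwise_def disjnt_def)
      have "\<tau> \<notin> standard_simplex m \<rightarrow> W" if "\<tau> \<in> standard_simplex m \<rightarrow> V" for m \<tau>
        using that VW nonempty_standard_simplex[of m] by (force simp: Pi_iff)
      then show ?thesis
        using n V(2) face by (simp add: chain_part_def chain_boundary_of frag_extend_sum frag_extend_cmul)
    qed
  next
    case (diff a b)
    then show ?case by (simp add: chain_part_def chain_boundary_diff frag_extend_diff)
  qed
qed

lemma singular_simplex_in_sheet:
  assumes op: "\<And>W. W \<in> \<W> \<Longrightarrow> openin X W" and disj: "pairwise disjnt \<W>"
    and s: "singular_simplex n (subtopology X (\<Union>\<W>)) \<sigma>"
  shows "\<exists>W\<in>\<W>. \<sigma> \<in> standard_simplex n \<rightarrow> W"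
proof -
  have s': "continuous_map (subtopology (powertop_real UNIV) (standard_simplex n)) X \<sigma>"
    "\<sigma> ` standard_simplex n \<subseteq> \<Union>\<W>"
    using s unfolding singular_simplex_subtopology unfolding singular_simplex_def by blast+
  have "connectedin (subtopology (powertop_real UNIV) (standard_simplex n)) (standard_simplex n)"
    using connectedin_standard_simplex by (simp add: connectedin_subtopology)
  then have con: "connectedin X (\<sigma> ` standard_simplex n)"
    using connectedin_continuous_map_image s'(1) by blast
  obtain t where t: "t \<in> standard_simplex n" using nonempty_standard_simplex by blast
  then obtain W where W: "W \<in> \<W>" "\<sigma> t \<in> W" using s'(2) by blast
  let ?V = "\<Union>(\<W> - {W})"
  have "?V \<inter> \<sigma> ` standard_simplex n = {}"
  proof (rule ccontr)
    assume "?V \<inter> \<sigma> ` standard_simplex n \<noteq> {}"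
    moreover have "openin X W" "openin X ?V" using op W by auto
    moreover have "\<sigma> ` standard_simplex n \<subseteq> W \<union> ?V" using s'(2) by blast
    moreover have "W \<inter> ?V \<inter> \<sigma> ` standard_simplex n = {}"
      using disj W(1) by (auto simp: pairwise_def disjnt_def)
    moreover have "W \<inter> \<sigma> ` standard_simplex n \<noteq> {}" using W t by blast
    ultimately show False using con unfolding connectedin by blast
  qed
  then have "\<sigma> ` standard_simplex n \<subseteq> W" using s'(2) by blast
  then show ?thesis using W(1) by blast
qed

lemma chain_is_sum_of_parts:
  assumes disj: "pairwise disjnt \<W>"
    and z: "\<And>\<sigma>. \<sigma> \<in> Poly_Mapping.keys z \<Longrightarrow> \<exists>V\<in>\<W>. \<sigma> \<in> standard_simplex n \<rightarrow> V"
  defines "T \<equiv> {W \<in> \<W>. \<exists>\<sigma> \<in> Poly_Mapping.keys z. \<sigma> \<in> standard_simplex n \<rightarrow> W}"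
  shows "finite T" "(\<Sum>W\<in>T. chain_part n W z) = z"
    "\<And>W. W \<in> \<W> - T \<Longrightarrow> chain_part n W z = 0"
proof -
  have uniq: "V = W" if "V \<in> \<W>" "W \<in> \<W>" "\<sigma> \<in> standard_simplex n \<rightarrow> V" "\<sigma> \<in> standard_simplex n \<rightarrow> W" for V W \<sigma>
  proof (rule ccontr)
    assume "V \<noteq> W"
    then have "V \<inter> W = {}" using disj that by (auto simp: pairwise_def disjnt_def)
    then show False using that(3,4) nonempty_standard_simplex[of n] by fastforce
  qed
  have "T \<subseteq> (\<lambda>\<sigma>. THE W. W \<in> \<W> \<and> \<sigma> \<in> standard_simplex n \<rightarrow> W) ` Poly_Mapping.keys z"
  proof
    fix W assume "W \<in> T"
    then obtain \<sigma> where \<sigma>: "W \<in> \<W>" "\<sigma> \<in> Poly_Mapping.keys z" "\<sigma> \<in> standard_simplex n \<rightarrow> W"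
      unfolding T_def by blast
    have "(THE W. W \<in> \<W> \<and> \<sigma> \<in> standard_simplex n \<rightarrow> W) = W"
    proof (rule the_equality)
      show "W \<in> \<W> \<and> \<sigma> \<in> standard_simplex n \<rightarrow> W" using \<sigma> by simp
      show "V = W" if "V \<in> \<W> \<and> \<sigma> \<in> standard_simplex n \<rightarrow> V" for V
        using that uniq[OF _ \<sigma>(1) _ \<sigma>(3)] by simp
    qed
    from this[symmetric] \<sigma>(2) show "W \<in> (\<lambda>\<sigma>. THE W. W \<in> \<W> \<and> \<sigma> \<in> standard_simplex n \<rightarrow> W) ` Poly_Mapping.keys z"
      by (rule image_eqI)
  qed
  then show T: "finite T" using finite_surj[OF finite_keys] by blast
  have "(\<Sum>W\<in>T. chain_part n W a) = a" if "Poly_Mapping.keys a \<subseteq> {\<sigma>. \<exists>W\<in>T. \<sigma> \<in> standard_simplex n \<rightarrow> W}" for a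
    using that
  proof (induction a rule: frag_induction)
    case zero
    then show ?case by (simp add: chain_part_def)
  next
    case (one \<sigma>)
    then obtain W where W: "W \<in> T" "\<sigma> \<in> standard_simplex n \<rightarrow> W" by blast
    have "(\<sigma> \<in> standard_simplex n \<rightarrow> V) \<longleftrightarrow> V = W" if "V \<in> T" for V
      using uniq[of V W \<sigma>] that W unfolding T_def by auto
    then have "(\<Sum>V\<in>T. chain_part n V (frag_of \<sigma>)) = (\<Sum>V\<in>T. if V = W then frag_of \<sigma> else 0)"
      by (intro sum.cong) (auto simp: chain_part_def)
    then show ?case using T W(1) by simp
  next
    case (diff a b)
    then show ?case by (simp add: chain_part_def frag_extend_diff sum_subtractf)
  qed
  then show "(\<Sum>W\<in>T. chain_part n W z) = z"
    using z unfolding T_def by blast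
  show "chain_part n W z = 0" if "W \<in> \<W> - T" for W
    unfolding chain_part_def by (rule frag_extend_eq_0) (use that in \<open>auto simp: T_def\<close>)
qed

section \<open>Local degrees of a lifted cycle\<close>

text \<open>
  The form of even covering on which local degrees depend: disjoint open sheets, each of which is mapped
  injectively to \<open>U\<close>, possibly not onto \<open>U\<close>.
\<close>

definition sheets :: "'b topology \<Rightarrow> ('b \<Rightarrow> 'a) \<Rightarrow> 'a set \<Rightarrow> 'b set set \<Rightarrow> bool" where
  "sheets E p U \<W> \<longleftrightarrow> (\<forall>W\<in>\<W>. openin E W \<and> inj_on p W) \<and> pairwise disjnt \<W>
     \<and> \<Union>\<W> = {e \<in> topspace E. p e \<in> U}"

definition sheeted_map :: "'b topology \<Rightarrow> 'a topology \<Rightarrow> ('b \<Rightarrow> 'a) \<Rightarrow> bool" where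
  "sheeted_map E M p \<longleftrightarrow> continuous_map E M p \<and>
     (\<forall>x\<in>topspace M. \<exists>U \<W>. openin M U \<and> x \<in> U \<and> sheets E p U \<W>)"

text \<open>
  The assumption \<open>gen\<close> is how an orientation enters: the class of a fundamental cycle generates all local
  homology groups of \<open>M\<close>.
\<close>

locale lifted_cycle =
  fixes n :: nat and M :: "'a topology" and E :: "'b topology" and p :: "'b \<Rightarrow> 'a" and c c'
  assumes M: "manifold n M" and n: "0 < n" and p: "sheeted_map E M p" and conn: "connected_space E"
    and c': "singular_relcycle n E {} c'" and c: "c = chain_map n p c'"
    and gen: "\<And>x z. \<lbrakk>x \<in> topspace M; singular_relcycle n M (topspace M - {x}) z\<rbrakk>
      \<Longrightarrow> \<exists>k. homologous_rel n M (topspace M - {x}) z (frag_cmul k c)"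
begin

lemma continuous_p: "continuous_map E M p" using p by (simp add: sheeted_map_def)

lemma p_in_topspace: "e \<in> topspace E \<Longrightarrow> p e \<in> topspace M" using continuous_p by (auto simp: continuous_map_def)

lemma c_cycle: "singular_relcycle n M {} c"
  unfolding c by (rule singular_relcycle_chain_map[OF c' continuous_p]) simp

lemma c_infinite_order:
  assumes x: "x \<in> topspace M" and k: "singular_relboundary n M (topspace M - {x}) (frag_cmul k c)"
  shows "k = 0"
proof -
  obtain z where z: "singular_relcycle n M (topspace M - {x}) z"
    and z0: "\<And>k. singular_relboundary n M (topspace M - {x}) (frag_cmul k z) \<Longrightarrow> k = 0"
    by (rule local_homology_infinite_order[OF M n x]) blast
  obtain l where "homologous_rel n M (topspace M - {x}) z (frag_cmul l c)"
    using gen[OF x z] by blast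
  then have "homologous_rel n M (topspace M - {x}) (frag_cmul k z) (frag_cmul k (frag_cmul l c))"
    by (rule homologous_rel_cmul)
  moreover have "singular_relboundary n M (topspace M - {x}) (frag_cmul k (frag_cmul l c))"
    using singular_relboundary_cmul[OF k, of l] by (simp add: mult.commute)
  ultimately have "singular_relboundary n M (topspace M - {x}) (frag_cmul k z - frag_cmul k (frag_cmul l c) + frag_cmul k (frag_cmul l c))"
    unfolding homologous_rel_def by (rule singular_relboundary_add)
  then show "k = 0" by (intro z0) simp
qed

text \<open>
  The class of \<open>c\<close> in the local homology group at \<open>x\<close> has infinite order, so that local classes have
  well-defined coefficients with respect to it.
\<close>

lemma c_coefficient_unique:
  assumes x: "x \<in> topspace M" and "homologous_rel n M (topspace M - {x}) z (frag_cmul k c)"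
    "homologous_rel n M (topspace M - {x}) z (frag_cmul l c)"
  shows "k = l"
proof -
  have "homologous_rel n M (topspace M - {x}) (z - z) (frag_cmul k c - frag_cmul l c)"
    using homologous_rel_diff assms(2,3) by blast
  then have "singular_relboundary n M (topspace M - {x}) (- frag_cmul (k - l) c)"
    by (simp add: homologous_rel_def frag_cmul_diff_distrib)
  then show ?thesis using c_infinite_order[OF x, of "k - l"] by (simp only: singular_relboundary_minus) simp
qed

lemma sheets_at:
  assumes "x \<in> topspace M"
  obtains U \<W> where "openin M U" "x \<in> U" "sheets E p U \<W>"
  using assms p unfolding sheeted_map_def by blast

lemma closedin_point:
  assumes e: "e \<in> topspace E" shows "closedin E {e}"
proof -
  obtain U \<W> where U: "openin M U" "p e \<in> U" "sheets E p U \<W>" using sheets_at p_in_topspace e by metis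
  obtain W where W: "W \<in> \<W>" "e \<in> W" using U e unfolding sheets_def by blast
  have "closedin M {p e}" using M p_in_topspace[OF e] by (simp add: manifold_def closedin_Hausdorff_singleton)
  then have "closedin E {y \<in> topspace E. p y \<in> {p e}}"
    using closedin_continuous_map_preimage continuous_p by blast
  moreover have "openin E (\<Union>(\<W> - {W}))" using U(3) by (auto simp: sheets_def)
  ultimately have "closedin E ({y \<in> topspace E. p y \<in> {p e}} - \<Union>(\<W> - {W}))"
    by (rule closedin_diff)
  moreover have "{y \<in> topspace E. p y \<in> {p e}} - \<Union>(\<W> - {W}) = {e}"
  proof
    show "{y \<in> topspace E. p y \<in> {p e}} - \<Union>(\<W> - {W}) \<subseteq> {e}"
    proof
      fix y assume y: "y \<in> {y \<in> topspace E. p y \<in> {p e}} - \<Union>(\<W> - {W})"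
      then have "y \<in> \<Union>\<W>" using U(2,3) unfolding sheets_def by auto
      then have "y \<in> W" using y by blast
      moreover have "inj_on p W" using U(3) W(1) by (simp add: sheets_def)
      ultimately show "y \<in> {e}" using W(2) y by (auto dest: inj_onD)
    qed
    have "e \<notin> \<Union>(\<W> - {W})" using U(3) W pairwise_disjnt_unique[of \<W>] unfolding sheets_def by blast
    then show "{e} \<subseteq> {y \<in> topspace E. p y \<in> {p e}} - \<Union>(\<W> - {W})" using e by blast
  qed
  ultimately show ?thesis by simp
qed

text \<open>
  The local degree at \<open>e\<close> is the coefficient with respect to \<open>c\<close> of the image of \<open>c'\<close> under
  \<open>H\<^sub>n(E) \<rightarrow> H\<^sub>n(E, E - e) \<cong> H\<^sub>n(W, W - e) \<rightarrow> H\<^sub>n(M, M - p(e))\<close>; the middle map is excision. As a relation, it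
  leaves the choice of \<open>W\<close> and of a representative \<open>z\<close> open; independence of the choices is
  \<open>local_degree_unique\<close>.
\<close>

definition local_degree :: "'b \<Rightarrow> int \<Rightarrow> bool" where
  "local_degree e k \<longleftrightarrow> (\<exists>W z. openin E W \<and> e \<in> W \<and> inj_on p W \<and>
     singular_relcycle n (subtopology E W) (W - {e}) z \<and>
     homologous_rel n E (topspace E - {e}) c' z \<and>
     homologous_rel n M (topspace M - {p e}) (chain_map n p z) (frag_cmul k c))"

lemma push_homologous:
  assumes W: "openin E W" "e \<in> W" "inj_on p W" and h: "homologous_rel n (subtopology E W) (W - {e}) z z'"
  shows "homologous_rel n M (topspace M - {p e}) (chain_map n p z) (chain_map n p z')"
proof (rule homologous_rel_chain_map[OF h])
  show "continuous_map (subtopology E W) M p" using continuous_p continuous_map_from_subtopology by blast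
  show "p \<in> W - {e} \<rightarrow> topspace M - {p e}"
    using W openin_subset[OF W(1)] p_in_topspace by (auto dest: inj_onD)
qed

text \<open>
  Both choices are compared with a representative supported in the intersection of the two sheets.
\<close>

lemma local_degree_unique:
  assumes "local_degree e k" "local_degree e l" shows "k = l"
proof -
  obtain V z where V: "openin E V" "e \<in> V" "inj_on p V"
    and z: "singular_relcycle n (subtopology E V) (V - {e}) z" "homologous_rel n E (topspace E - {e}) c' z"
     "homologous_rel n M (topspace M - {p e}) (chain_map n p z) (frag_cmul k c)"
    using assms(1) unfolding local_degree_def by blast
  obtain V' z' where V': "openin E V'" "e \<in> V'" "inj_on p V'"
    and z': "singular_relcycle n (subtopology E V') (V' - {e}) z'" "homologous_rel n E (topspace E - {e}) c' z'"
     "homologous_rel n M (topspace M - {p e}) (chain_map n p z') (frag_cmul l c)"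
    using assms(2) unfolding local_degree_def by blast
  let ?W = "V \<inter> V'"
  have e: "e \<in> topspace E" using V openin_subset by blast
  have cl: "E closure_of {e} = {e}" using closedin_point[OF e] closure_of_closedin by blast
  have W: "openin E ?W" "E closure_of {e} \<subseteq> ?W" using V V' cl by auto
  have "singular_relcycle n E (topspace E - {e}) c'" using c' by (rule singular_relcycle_mono) simp
  then obtain w where w: "singular_relcycle n (subtopology E ?W) (?W - {e}) w" "homologous_rel n E (topspace E - {e}) c' w"
    using excision_relcycle_exists[OF W] e by blast
  have *: "homologous_rel n M (topspace M - {p e}) (chain_map n p y) (chain_map n p w)"
    if Y: "openin E Y" "e \<in> Y" "inj_on p Y" "?W \<subseteq> Y"
    and y: "singular_relcycle n (subtopology E Y) (Y - {e}) y" "homologous_rel n E (topspace E - {e}) c' y" for Y y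
  proof (rule push_homologous[OF Y(1-3)])
    have "singular_chain n (subtopology E Y) w" "singular_chain (n-1) (subtopology (subtopology E Y) (Y - {e})) (chain_boundary n w)"
    proof -
      have w1: "singular_chain n (subtopology E ?W) w" and w2: "singular_chain (n-1) (subtopology E (?W \<inter> (?W - {e}))) (chain_boundary n w)"
        using w(1) by (simp_all add: singular_relcycle subtopology_subtopology)
      show "singular_chain n (subtopology E Y) w" using singular_chain_mono[OF w1 Y(4)] .
      show "singular_chain (n-1) (subtopology (subtopology E Y) (Y - {e})) (chain_boundary n w)"
        unfolding subtopology_subtopology by (rule singular_chain_mono[OF w2]) (use Y(4) in blast)
    qed
    then have wY: "singular_relcycle n (subtopology E Y) (Y - {e}) w" by (simp add: singular_relcycle)
    \<comment> \<open>\<open>y\<close> and \<open>w\<close> both represent \<open>c'\<close> at \<open>e\<close>; excision into \<open>Y\<close> makes them homologous there\<close>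
    have "homologous_rel n E (topspace E - {e}) y w"
      using y(2) w(2) homologous_rel_sym homologous_rel_trans by metis
    then show "homologous_rel n (subtopology E Y) (Y - {e}) y w"
      unfolding homologous_rel_def
      by (intro excision_relboundary singular_relcycle_diff Y(1) y(1) wY) (use cl Y(2) in auto)
  qed
  have "homologous_rel n M (topspace M - {p e}) (chain_map n p w) (frag_cmul k c)"
    using *[OF V _ z(1,2)] z(3) homologous_rel_sym homologous_rel_trans by (metis Int_lower1)
  moreover have "homologous_rel n M (topspace M - {p e}) (chain_map n p w) (frag_cmul l c)"
    using *[OF V' _ z'(1,2)] z'(3) homologous_rel_sym homologous_rel_trans by (metis Int_lower2)
  ultimately show ?thesis using c_coefficient_unique p_in_topspace[OF e] by blast
qed

text \<open>
  Let \<open>V\<close> be a ball around \<open>p e\<close> as in \<open>manifold_homology_ball\<close>, and \<open>Y\<close> the part of its preimage in the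
  sheet of \<open>e\<close>. One chain \<open>z\<close> represents \<open>c'\<close> relative to the complement of \<open>Y\<close>, hence at all points of
  \<open>Y\<close>. Its image is a multiple of \<open>c\<close> at \<open>p e\<close>, therefore it is the same multiple of \<open>c\<close> over the
  whole ball \<open>V\<close>.
\<close>

lemma local_degree_exists_locally:
  assumes e: "e \<in> topspace E"
  obtains Y k where "openin E Y" "e \<in> Y" "\<And>y. y \<in> Y \<Longrightarrow> local_degree y k"
proof -
  let ?x = "p e"
  have x: "?x \<in> topspace M" using p_in_topspace e by blast
  obtain U \<W> where U: "openin M U" "?x \<in> U" "sheets E p U \<W>" by (rule sheets_at[OF x])
  obtain W where W: "W \<in> \<W>" "e \<in> W" using U e unfolding sheets_def by blast
  have Wo: "openin E W" "inj_on p W" using U(3) W(1) by (auto simp: sheets_def)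
  have WE: "W \<subseteq> topspace E" using Wo openin_subset by blast
  obtain V where V: "openin M V" "?x \<in> V" "M closure_of V \<subseteq> U"
    and inj: "\<And>z. \<lbrakk>singular_relcycle n M (topspace M - V) z; singular_relboundary n M (topspace M - {?x}) z\<rbrakk>
      \<Longrightarrow> singular_relboundary n M (topspace M - V) z"
    by (rule manifold_homology_ball[OF M n U(1,2)]) blast
  define Y where "Y = {y \<in> W. p y \<in> V}"
  have "openin E {y \<in> topspace E. p y \<in> V}" using openin_continuous_map_preimage[OF continuous_p V(1)] .
  then have "openin E (W \<inter> {y \<in> topspace E. p y \<in> V})" using Wo(1) by blast
  moreover have "W \<inter> {y \<in> topspace E. p y \<in> V} = Y" using WE by (auto simp: Y_def)
  ultimately have Yo: "openin E Y" by simp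
  have YE: "Y \<subseteq> topspace E" using Yo openin_subset by blast
  \<comment> \<open>the closed preimage of the closure of \<open>V\<close> is covered by the sheets, and the others are open\<close>
  have clY: "E closure_of Y \<subseteq> W"
  proof -
    have "closedin E ({y \<in> topspace E. p y \<in> M closure_of V} - \<Union>(\<W> - {W}))"
    proof (rule closedin_diff)
      show "closedin E {y \<in> topspace E. p y \<in> M closure_of V}"
        by (rule closedin_continuous_map_preimage[OF continuous_p]) simp
      show "openin E (\<Union>(\<W> - {W}))" using U(3) by (auto simp: sheets_def)
    qed
    moreover have "Y \<subseteq> {y \<in> topspace E. p y \<in> M closure_of V} - \<Union>(\<W> - {W})"
    proof
      fix y assume y: "y \<in> Y"
      have "p y \<in> M closure_of V" using y closure_of_subset[OF openin_subset[OF V(1)]] by (auto simp: Y_def)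
      moreover have "y \<notin> \<Union>(\<W> - {W})"
        using y U(3) W(1) pairwise_disjnt_unique[of \<W>] unfolding sheets_def Y_def by blast
      ultimately show "y \<in> {y \<in> topspace E. p y \<in> M closure_of V} - \<Union>(\<W> - {W})" using y YE by blast
    qed
    ultimately have "E closure_of Y \<subseteq> {y \<in> topspace E. p y \<in> M closure_of V} - \<Union>(\<W> - {W})"
      by (intro closure_of_minimal)
    also have "\<dots> \<subseteq> W"
    proof
      fix y assume y: "y \<in> {y \<in> topspace E. p y \<in> M closure_of V} - \<Union>(\<W> - {W})"
      then have "y \<in> \<Union>\<W>" using V(3) U(3) unfolding sheets_def by auto
      then show "y \<in> W" using y by blast
    qed
    finally show ?thesis .
  qed
  have "singular_relcycle n E (topspace E - Y) c'" using c' by (rule singular_relcycle_mono) simp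
  then obtain z where z: "singular_relcycle n (subtopology E W) (W - Y) z" "homologous_rel n E (topspace E - Y) c' z"
    using excision_relcycle_exists[OF Wo(1) clY YE] by blast
  let ?pz = "chain_map n p z"
  have pz: "singular_relcycle n M (topspace M - V) ?pz"
  proof (rule singular_relcycle_chain_map[OF z(1)])
    show "continuous_map (subtopology E W) M p" using continuous_p continuous_map_from_subtopology by blast
    show "p \<in> W - Y \<rightarrow> topspace M - V" using WE p_in_topspace by (auto simp: Y_def)
  qed
  have "singular_relcycle n M (topspace M - {?x}) ?pz"
    using pz by (rule singular_relcycle_mono) (use V(2) in blast)
  then obtain k where k: "homologous_rel n M (topspace M - {?x}) ?pz (frag_cmul k c)"
    using gen[OF x] by blast
  have "singular_relcycle n M (topspace M - V) (?pz - frag_cmul k c)"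
    using pz c_cycle singular_relcycle_mono[of n M "{}"] by (intro singular_relcycle_diff singular_relcycle_cmul) auto
  then have kV: "homologous_rel n M (topspace M - V) ?pz (frag_cmul k c)"
    using inj k unfolding homologous_rel_def by blast
  have "local_degree y k" if y: "y \<in> Y" for y
    unfolding local_degree_def
  proof (intro exI conjI)
    show "openin E W" "y \<in> W" "inj_on p W" using Wo y by (auto simp: Y_def)
    show "singular_relcycle n (subtopology E W) (W - {y}) z"
      using z(1) by (rule singular_relcycle_mono) (use y in blast)
    show "homologous_rel n E (topspace E - {y}) c' z"
      using z(2) by (rule homologous_rel_mono) (use y in blast)
    show "homologous_rel n M (topspace M - {p y}) ?pz (frag_cmul k c)"
      using kV by (rule homologous_rel_mono) (use y in \<open>auto simp: Y_def\<close>)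
  qed
  moreover have "e \<in> Y" using W(2) V(2) by (simp add: Y_def)
  ultimately show thesis using that Yo by blast
qed

lemma local_degree_constant: "\<exists>k. \<forall>e\<in>topspace E. local_degree e k"
proof (cases "topspace E = {}")
  case False
  then obtain e0 where e0: "e0 \<in> topspace E" by blast
  then obtain k where k: "local_degree e0 k" using local_degree_exists_locally by metis
  define A where "A = {e \<in> topspace E. local_degree e k}"
  define B where "B = {e \<in> topspace E. \<exists>l. l \<noteq> k \<and> local_degree e l}"
  have "openin E A"
  proof (subst openin_subopen, intro ballI)
    fix e assume e: "e \<in> A"
    then obtain Y l where Y: "openin E Y" "e \<in> Y" "\<And>y. y \<in> Y \<Longrightarrow> local_degree y l"
      using local_degree_exists_locally unfolding A_def by blast
    have "l = k" using Y(2,3) e local_degree_unique unfolding A_def by blast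
    then have "Y \<subseteq> A" using Y(3) openin_subset[OF Y(1)] by (auto simp: A_def)
    then show "\<exists>T. openin E T \<and> e \<in> T \<and> T \<subseteq> A" using Y by blast
  qed
  moreover have "openin E B"
  proof (subst openin_subopen, intro ballI)
    fix e assume e: "e \<in> B"
    then obtain Y l where Y: "openin E Y" "e \<in> Y" "\<And>y. y \<in> Y \<Longrightarrow> local_degree y l"
      using local_degree_exists_locally unfolding B_def by blast
    have "l \<noteq> k" using Y(2,3) e local_degree_unique unfolding B_def by blast
    then have "Y \<subseteq> B" using Y(3) openin_subset[OF Y(1)] by (auto simp: B_def)
    then show "\<exists>T. openin E T \<and> e \<in> T \<and> T \<subseteq> B" using Y by blast
  qed
  moreover have "A \<inter> B = {}" using local_degree_unique by (auto simp: A_def B_def)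
  moreover have "topspace E \<subseteq> A \<union> B"
  proof
    fix e assume e: "e \<in> topspace E"
    then obtain l where "local_degree e l" using local_degree_exists_locally by metis
    then show "e \<in> A \<union> B" using e by (auto simp: A_def B_def)
  qed
  moreover have "A \<noteq> {}" using e0 k by (auto simp: A_def)
  ultimately have "B = {}" using conn unfolding connected_space_def by blast
  then have "topspace E \<subseteq> A" using \<open>topspace E \<subseteq> A \<union> B\<close> by blast
  then show ?thesis unfolding A_def by blast
qed simp

text \<open>
  If \<open>z\<close> represents \<open>c'\<close> near the whole fibre, then its part in the sheet of \<open>e\<close> represents \<open>c'\<close> near
  \<open>e\<close>, since the other parts avoid \<open>e\<close>.
\<close>

lemma part_local_degree:
  assumes U: "sheets E p U \<W>" "p e \<in> U" and W: "W \<in> \<W>" "e \<in> W"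
    and z: "singular_relcycle n (subtopology E (\<Union>\<W>)) (\<Union>\<W> - {y \<in> topspace E. p y = p e}) z"
      "homologous_rel n E (topspace E - {y \<in> topspace E. p y = p e}) c' z"
    and k: "local_degree e k"
  shows "homologous_rel n M (topspace M - {p e}) (chain_map n p (chain_part n W z)) (frag_cmul k c)"
proof -
  let ?F = "{y \<in> topspace E. p y = p e}"
  have op: "\<And>W. W \<in> \<W> \<Longrightarrow> openin E W" and disj: "pairwise disjnt \<W>" and inj: "inj_on p W"
    using U(1) W by (auto simp: sheets_def)
  have WE: "W \<subseteq> topspace E" using op W openin_subset by blast
  have zU: "singular_chain n (subtopology E (\<Union>\<W>)) z"
    and zb: "singular_chain (n-1) (subtopology E (\<Union>\<W> \<inter> (\<Union>\<W> - ?F))) (chain_boundary n z)"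
    using z(1) by (simp_all add: singular_relcycle subtopology_subtopology)
  have small: "\<exists>V\<in>\<W>. \<sigma> \<in> standard_simplex n \<rightarrow> V" if "\<sigma> \<in> Poly_Mapping.keys z" for \<sigma>
    using singular_simplex_in_sheet[OF op disj] zU that unfolding singular_chain_def by blast
  note parts = chain_is_sum_of_parts[OF disj small]
  let ?T = "{W \<in> \<W>. \<exists>\<sigma>\<in>Poly_Mapping.keys z. \<sigma> \<in> standard_simplex n \<rightarrow> W}"
  let ?w = "chain_part n W z"
  have w: "singular_relcycle n (subtopology E W) (W - {e}) ?w"
    unfolding singular_relcycle
  proof
    show "singular_chain n (subtopology E W) ?w"
      using singular_chain_mono[OF singular_chain_chain_part[OF zU, of W]] by blast
    have "singular_chain (n-1) (subtopology E (\<Union>\<W> \<inter> (\<Union>\<W> - ?F) \<inter> W)) (chain_part (n-1) W (chain_boundary n z))"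
      by (rule singular_chain_chain_part[OF zb])
    then have "singular_chain (n-1) (subtopology E (\<Union>\<W> \<inter> (\<Union>\<W> - ?F) \<inter> W)) (chain_boundary n ?w)"
      by (simp only: chain_boundary_chain_part[OF disj W(1) n small])
    moreover have "\<Union>\<W> \<inter> (\<Union>\<W> - ?F) \<inter> W \<subseteq> W \<inter> (W - {e})" using WE W(2) by blast
    ultimately show "singular_chain (n-1) (subtopology (subtopology E W) (W - {e})) (chain_boundary n ?w)"
      unfolding subtopology_subtopology by (rule singular_chain_mono)
  qed
  have "singular_chain n (subtopology E (topspace E - {e})) (z - ?w)"
  proof -
    have eq: "z - ?w = (\<Sum>V\<in>?T - {W}. chain_part n V z)"
    proof (cases "W \<in> ?T")
      case True
      then show ?thesis using parts(1,2) by (simp add: sum_diff1)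
    next
      case False
      then have "?w = 0" using parts(3) W(1) by blast
      then show ?thesis using parts(2) False by simp
    qed
    show ?thesis
      unfolding eq
    proof (rule singular_chain_sum)
      fix V assume V: "V \<in> ?T - {W}"
      then have "e \<notin> V" using disj W pairwise_disjnt_unique[of \<W>] by blast
      moreover have "V \<subseteq> topspace E" using V op[THEN openin_subset] by simp
      ultimately have "\<Union>\<W> \<inter> V \<subseteq> topspace E - {e}" by blast
      then show "singular_chain n (subtopology E (topspace E - {e})) (chain_part n V z)"
        by (rule singular_chain_mono[OF singular_chain_chain_part[OF zU]])
    qed
  qed
  then have "homologous_rel n E (topspace E - {e}) z ?w"
    unfolding homologous_rel_def by (rule singular_chain_imp_relboundary)
  moreover have "homologous_rel n E (topspace E - {e}) c' z"
    using z(2) by (rule homologous_rel_mono) (use W(2) WE in blast)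
  ultimately have c'w: "homologous_rel n E (topspace E - {e}) c' ?w"
    using homologous_rel_trans by blast
  have eM: "p e \<in> topspace M" using p_in_topspace W(2) WE by blast
  have "singular_relcycle n M (topspace M - {p e}) (chain_map n p ?w)"
  proof (rule singular_relcycle_chain_map[OF w])
    show "continuous_map (subtopology E W) M p" using continuous_p continuous_map_from_subtopology by blast
    show "p \<in> W - {e} \<rightarrow> topspace M - {p e}" using inj W(2) WE p_in_topspace by (auto dest: inj_onD)
  qed
  then obtain l where l: "homologous_rel n M (topspace M - {p e}) (chain_map n p ?w) (frag_cmul l c)"
    using gen[OF eM] by blast
  then have "local_degree e l"
    unfolding local_degree_def using op[OF W(1)] W(2) inj w c'w by blast
  then have "l = k" using k local_degree_unique by blast
  then show ?thesis using l by simp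
qed

text \<open>
  Represent \<open>c'\<close> near the fibre over \<open>x\<close> by a chain \<open>z\<close> in the union of the sheets and split it into its
  parts. A sheet that contains a simplex of \<open>z\<close> and a point of the fibre contributes the constant local
  degree \<open>k\<close> to the coefficient of the image of \<open>z\<close> at \<open>x\<close>, all others contribute nothing. As this image is
  homologous to \<open>c\<close> at \<open>x\<close>, \<open>m * k = 1\<close> for the number \<open>m\<close> of contributing sheets, so \<open>m = 1\<close>. A point of
  the fibre whose sheet contains no simplex of \<open>z\<close> would have local degree \<open>0\<close>, but \<open>k \<noteq> 0\<close>.
\<close>

theorem sheeted_map_injective: "inj_on p (topspace E)"
proof -
  obtain k where k: "\<And>e. e \<in> topspace E \<Longrightarrow> local_degree e k" using local_degree_constant by blast
  have "e1 = e2" if e12: "e1 \<in> topspace E" "e2 \<in> topspace E" "p e1 = p e2" for e1 e2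
  proof -
    define x where "x = p e1"
    have x: "x \<in> topspace M" using p_in_topspace e12 x_def by blast
    obtain U \<W> where U: "openin M U" "x \<in> U" "sheets E p U \<W>" by (rule sheets_at[OF x])
    have op: "\<And>W. W \<in> \<W> \<Longrightarrow> openin E W" and disj: "pairwise disjnt \<W>" and inj: "\<And>W. W \<in> \<W> \<Longrightarrow> inj_on p W"
      and Un: "\<Union>\<W> = {e \<in> topspace E. p e \<in> U}"
      using U(3) by (auto simp: sheets_def)
    let ?F = "{y \<in> topspace E. p y = x}"
    have "closedin M {x}" using M x by (simp add: manifold_def closedin_Hausdorff_singleton)
    then have "closedin E {y \<in> topspace E. p y \<in> {x}}"
      using closedin_continuous_map_preimage continuous_p by blast
    then have "E closure_of ?F = ?F" using closure_of_closedin by simp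
    then have cl: "E closure_of ?F \<subseteq> \<Union>\<W>" using U(2) Un by auto
    have opU: "openin E (\<Union>\<W>)" using op by blast
    have "singular_relcycle n E (topspace E - ?F) c'" using c' by (rule singular_relcycle_mono) simp
    then obtain z where z: "singular_relcycle n (subtopology E (\<Union>\<W>)) (\<Union>\<W> - ?F) z"
      "homologous_rel n E (topspace E - ?F) c' z"
      using excision_relcycle_exists[OF opU cl] by blast
    have zU: "singular_chain n (subtopology E (\<Union>\<W>)) z"
      using z(1) by (simp add: singular_relcycle)
    have small: "\<exists>V\<in>\<W>. \<sigma> \<in> standard_simplex n \<rightarrow> V" if "\<sigma> \<in> Poly_Mapping.keys z" for \<sigma>
      using singular_simplex_in_sheet[OF op disj] zU that unfolding singular_chain_def by blast
    define T where "T = {W \<in> \<W>. \<exists>\<sigma>\<in>Poly_Mapping.keys z. \<sigma> \<in> standard_simplex n \<rightarrow> W}"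
    have T: "finite T" "(\<Sum>W\<in>T. chain_part n W z) = z" "\<And>W. W \<in> \<W> - T \<Longrightarrow> chain_part n W z = 0"
      using chain_is_sum_of_parts[OF disj small] unfolding T_def by blast+
    \<comment> \<open>the sheets that contribute to the coefficient at \<open>x\<close>\<close>
    define T' where "T' = {W \<in> T. W \<inter> ?F \<noteq> {}}"
    have TW: "T \<subseteq> \<W>" by (auto simp: T_def)
    let ?P = "\<lambda>W. chain_map n p (chain_part n W z)"
    have deg: "homologous_rel n M (topspace M - {x}) (?P W) (frag_cmul k c)" if "W \<in> \<W>" "e \<in> W" "e \<in> ?F" for W e
      using part_local_degree[of U \<W> e W z k] U that z k by simp
    have nodeg: "homologous_rel n M (topspace M - {x}) (?P W) 0" if W: "W \<in> \<W>" "W \<inter> ?F = {}" for W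
    proof -
      have WE: "W \<subseteq> topspace E" using op W openin_subset by blast
      have "continuous_map (subtopology E (\<Union>\<W> \<inter> W)) (subtopology M (topspace M - {x})) p"
        unfolding continuous_map_in_subtopology
      proof
        show "continuous_map (subtopology E (\<Union>\<W> \<inter> W)) M p" using continuous_p continuous_map_from_subtopology by blast
        show "p \<in> topspace (subtopology E (\<Union>\<W> \<inter> W)) \<rightarrow> topspace M - {x}"
          using W(2) p_in_topspace by auto
      qed
      then have "singular_chain n (subtopology M (topspace M - {x})) (?P W)"
        using singular_chain_chain_map[OF singular_chain_chain_part[OF zU, of W]] by blast
      then show ?thesis unfolding homologous_rel_def by (simp add: singular_chain_imp_relboundary)
    qed
    have eq: "(\<Sum>W\<in>T. if W \<in> T' then frag_cmul k c else 0) = frag_cmul (int (card T') * k) c"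
    proof -
      have "(\<Sum>W\<in>T. if W \<in> T' then frag_cmul k c else 0) = (\<Sum>W\<in>T'. frag_cmul k c)"
        using T(1) by (simp add: T'_def sum.If_cases Int_def)
      also have "\<dots> = frag_cmul (int (card T') * k) c"
      proof -
        have "(\<Sum>W\<in>A. frag_cmul k c) = frag_cmul (int (card A) * k) c" if "finite A" for A :: "'b set set"
          using that by (induction A) (simp_all add: frag_cmul_distrib distrib_right)
        then show ?thesis using T(1) by (simp add: T'_def)
      qed
      finally show ?thesis .
    qed
    have "homologous_rel n M (topspace M - {x}) (\<Sum>W\<in>T. ?P W) (\<Sum>W\<in>T. if W \<in> T' then frag_cmul k c else 0)"
    proof (rule homologous_rel_sum)
      fix W assume W: "W \<in> T"
      then show "homologous_rel n M (topspace M - {x}) (?P W) (if W \<in> T' then frag_cmul k c else 0)"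
        using deg nodeg TW unfolding T'_def by (cases "W \<inter> ?F = {}") auto
    qed (use T(1) in auto)
    moreover have "(\<Sum>W\<in>T. ?P W) = chain_map n p z"
      using chain_map_sum[OF T(1), of n p "\<lambda>W. chain_part n W z"] T(2) by (simp add: o_def)
    ultimately have "homologous_rel n M (topspace M - {x}) (chain_map n p z) (frag_cmul (int (card T') * k) c)"
      by (simp only: eq)
    moreover have "homologous_rel n M (topspace M - {x}) c (chain_map n p z)"
      unfolding c by (rule homologous_rel_chain_map[OF z(2) continuous_p]) (use p_in_topspace in auto)
    ultimately have "homologous_rel n M (topspace M - {x}) c (frag_cmul (int (card T') * k) c)"
      using homologous_rel_trans by blast
    moreover have "homologous_rel n M (topspace M - {x}) c (frag_cmul 1 c)" by simp
    ultimately have mk: "int (card T') * k = 1" by (rule c_coefficient_unique[OF x])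
    then have k0: "k \<noteq> 0" by auto
    have "int (card T') dvd 1" unfolding mk[symmetric] by simp
    then have "card T' = 1" by simp
    then obtain W0 where W0: "T' = {W0}" by (rule card_1_singletonE)
    have inW0: "e \<in> W0" if e: "e \<in> ?F" for e
    proof -
      obtain W where W: "W \<in> \<W>" "e \<in> W" using e Un U(2) by blast
      have "W \<in> T"
      proof (rule ccontr)
        assume "W \<notin> T"
        then have "chain_part n W z = 0" using T(3) W by blast
        then have "homologous_rel n M (topspace M - {x}) 0 (frag_cmul k c)"
          using deg[OF W e] by simp
        moreover have "homologous_rel n M (topspace M - {x}) 0 (frag_cmul 0 c)" by simp
        ultimately show False using c_coefficient_unique[OF x] k0 by blast
      qed
      then have "W \<in> T'" using W e unfolding T'_def by blast
      then show ?thesis using W0 W by blast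
    qed
    have "e1 \<in> W0" "e2 \<in> W0" using inW0 e12 by (simp_all add: x_def)
    moreover have "W0 \<in> T'" unfolding W0 by simp
    then have "inj_on p W0" using TW unfolding T'_def by (intro inj) auto
    ultimately show ?thesis using e12(3) by (auto dest: inj_onD)
  qed
  then show ?thesis by (intro inj_onI)
qed

end

section \<open>Path homotopy in abstract topologies\<close>

abbreviation I01 :: "real topology" where "I01 \<equiv> top_of_set {0..1}"

text \<open>
  The analogue of \<^const>\<open>homotopic_loops_at\<close> for paths with arbitrary ends.
\<close>

definition path_homotopic :: "'a topology \<Rightarrow> (real \<Rightarrow> 'a) \<Rightarrow> (real \<Rightarrow> 'a) \<Rightarrow> bool" where
  "path_homotopic X p q \<longleftrightarrow> homotopic_with (\<lambda>r. r 0 = p 0 \<and> r 1 = p 1) I01 X p q"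

definition rev_path :: "(real \<Rightarrow> 'a) \<Rightarrow> real \<Rightarrow> 'a" where
  "rev_path p = (\<lambda>t. p (1 - t))"

lemma rev_path_ends [simp]: "rev_path p 0 = p 1" "rev_path p 1 = p 0"
  by (simp_all add: rev_path_def)

lemma rev_rev_path [simp]: "rev_path (rev_path p) = p"
  by (simp add: rev_path_def)

lemma join_loops_ends [simp]: "join_loops p q 0 = p 0" "join_loops p q 1 = q 1"
  by (simp_all add: join_loops_def)

lemma continuous_map_I01_real:
  assumes "continuous_map Z I01 f" shows "continuous_map Z euclideanreal f"
  using assms continuous_map_into_fulltopology by blast

lemma path_homotopicI:
  assumes "continuous_map (prod_topology I01 I01) X (\<lambda>(s, t). h s t)"
    and "\<And>t. t \<in> {0..1} \<Longrightarrow> h 0 t = p t" "\<And>t. t \<in> {0..1} \<Longrightarrow> h 1 t = q t"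
    and "\<And>s. s \<in> {0..1} \<Longrightarrow> h s 0 = p 0" "\<And>s. s \<in> {0..1} \<Longrightarrow> h s 1 = p 1"
  shows "path_homotopic X p q"
  unfolding path_homotopic_def
proof (subst homotopic_with)
  show "\<exists>h. continuous_map (prod_topology I01 I01) X h \<and>
    (\<forall>x\<in>topspace I01. h (0, x) = p x) \<and> (\<forall>x\<in>topspace I01. h (1, x) = q x) \<and>
    (\<forall>t\<in>{0..1}. h (t, 0) = p 0 \<and> h (t, 1) = p 1)"
    using assms by (intro exI[of _ "\<lambda>(s,t). h s t"]) simp
qed auto

lemma path_homotopicE:
  assumes "path_homotopic X p q"
  obtains h where "continuous_map (prod_topology I01 I01) X (\<lambda>(s, t). h s t)"
    "\<And>t. h 0 t = p t" "\<And>t. h 1 t = q t"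
    "\<And>s. s \<in> {0..1} \<Longrightarrow> h s 0 = p 0" "\<And>s. s \<in> {0..1} \<Longrightarrow> h s 1 = p 1"
proof -
  obtain k where k: "continuous_map (prod_topology I01 I01) X k" "\<And>x. k (0, x) = p x" "\<And>x. k (1, x) = q x"
    "\<And>t. t \<in> {0..1} \<Longrightarrow> k (t, 0) = p 0 \<and> k (t, 1) = p 1"
    using assms unfolding path_homotopic_def homotopic_with_def by blast
  show thesis
    by (rule that[of "\<lambda>s t. k (s, t)"]) (use k in auto)
qed

lemma path_homotopic_ends:
  assumes "path_homotopic X p q"
  shows "q 0 = p 0" "q 1 = p 1" "pathin X p" "pathin X q"
  using homotopic_with_imp_property[OF assms[unfolded path_homotopic_def]]
    homotopic_with_imp_continuous_maps[OF assms[unfolded path_homotopic_def]]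
  by (auto simp: pathin_def)

lemma path_homotopic_eq:
  assumes "pathin X p" "\<And>t. t \<in> {0..1} \<Longrightarrow> p t = q t"
  shows "path_homotopic X p q"
  unfolding path_homotopic_def
  by (rule homotopic_with_equal) (use assms in \<open>auto simp: pathin_def\<close>)

lemma path_homotopic_refl: "pathin X p \<Longrightarrow> path_homotopic X p p"
  by (simp add: path_homotopic_eq)

lemma path_homotopic_sym: "path_homotopic X p q \<Longrightarrow> path_homotopic X q p"
  using path_homotopic_ends[of X p q] homotopic_with_symD unfolding path_homotopic_def by fastforce

lemma path_homotopic_trans [trans]:
  assumes "path_homotopic X p q" "path_homotopic X q r" shows "path_homotopic X p r"
proof -
  have "homotopic_with (\<lambda>r. r 0 = p 0 \<and> r 1 = p 1) I01 X q r"
    using assms(2) path_homotopic_ends[OF assms(1)] by (simp add: path_homotopic_def)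
  then show ?thesis using assms(1) homotopic_with_trans unfolding path_homotopic_def by blast
qed

lemma path_homotopic_compose:
  assumes "path_homotopic T u v" "continuous_map T X f"
  shows "path_homotopic X (f \<circ> u) (f \<circ> v)"
  unfolding path_homotopic_def
  by (rule homotopic_with_compose_continuous_map_left[OF assms(1)[unfolded path_homotopic_def] assms(2)]) simp

lemma path_homotopic_I01:
  assumes u: "continuous_map I01 I01 u" and v: "continuous_map I01 I01 v" and e: "u 0 = v 0" "u 1 = v 1"
  shows "path_homotopic I01 u v"
proof (rule path_homotopicI)
  have u': "continuous_map (prod_topology I01 I01) euclideanreal (\<lambda>x. u (snd x))"
    and v': "continuous_map (prod_topology I01 I01) euclideanreal (\<lambda>x. v (snd x))"
    using continuous_map_I01_real[OF continuous_map_compose[OF continuous_map_snd u]]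
      continuous_map_I01_real[OF continuous_map_compose[OF continuous_map_snd v]]
    unfolding o_def by blast+
  have s: "continuous_map (prod_topology I01 I01) euclideanreal fst"
    using continuous_map_I01_real continuous_map_fst by blast
  have "continuous_map (prod_topology I01 I01) euclideanreal (\<lambda>x. (1 - fst x) * u (snd x) + fst x * v (snd x))"
    using u' v' s by (intro continuous_intros) auto
  moreover have "(1 - s) * u t + s * v t \<in> {0..1}" if "s \<in> {0..1}" "t \<in> {0..1}" for s t
  proof -
    have "u t \<in> {0..1}" "v t \<in> {0..1}" using u v that by (auto simp: continuous_map_def)
    then show ?thesis using that convex_bound_le[of "u t" 1 "v t" "1 - s" s] by auto
  qed
  ultimately show "continuous_map (prod_topology I01 I01) I01 (\<lambda>(s, t). (1 - s) * u t + s * v t)"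
    by (auto simp: continuous_map_in_subtopology case_prod_unfold)
qed (use e in \<open>auto simp: algebra_simps\<close>)

text \<open>
  The group laws for paths are instances: in each of them, both sides are reparametrisations of a single
  path.
\<close>

lemma path_reparam:
  assumes p: "pathin X p" and u: "continuous_map I01 I01 u" and v: "continuous_map I01 I01 v" and e: "u 0 = v 0" "u 1 = v 1"
  shows "path_homotopic X (p \<circ> u) (p \<circ> v)"
  using path_homotopic_compose[OF path_homotopic_I01[OF u v e]] p unfolding pathin_def by blast

lemma continuous_map_I01_I01:
  assumes "continuous_on {0..1} u" "\<And>t. t \<in> {0..1} \<Longrightarrow> u t \<in> {0..1}"
  shows "continuous_map I01 I01 u"
  using assms by (auto simp: continuous_map_in_subtopology continuous_map_iff_continuous)

lemma path_homotopic_join: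
  assumes p: "path_homotopic X p p'" and q: "path_homotopic X q q'" and e: "p 1 = q 0"
  shows "path_homotopic X (join_loops p q) (join_loops p' q')"
proof -
  obtain h where h: "continuous_map (prod_topology I01 I01) X (\<lambda>(s, t). h s t)"
    "\<And>t. h 0 t = p t" "\<And>t. h 1 t = p' t"
    "\<And>s. s \<in> {0..1} \<Longrightarrow> h s 0 = p 0" "\<And>s. s \<in> {0..1} \<Longrightarrow> h s 1 = p 1"
    by (rule path_homotopicE[OF p]) blast
  obtain k where k: "continuous_map (prod_topology I01 I01) X (\<lambda>(s, t). k s t)"
    "\<And>t. k 0 t = q t" "\<And>t. k 1 t = q' t"
    "\<And>s. s \<in> {0..1} \<Longrightarrow> k s 0 = q 0" "\<And>s. s \<in> {0..1} \<Longrightarrow> k s 1 = q 1"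
    by (rule path_homotopicE[OF q]) blast
  let ?P = "prod_topology I01 I01"
  let ?m = "\<lambda>s t. if t \<le> 1/2 then h s (2*t) else k s (2*t-1)"
  have f: "continuous_map ?P I01 fst" and s: "continuous_map ?P euclideanreal snd"
    using continuous_map_I01_real continuous_map_snd continuous_map_fst by blast+
  have "continuous_map ?P X (\<lambda>x. if snd x \<le> 1/2 then h (fst x) (2 * snd x) else k (fst x) (2 * snd x - 1))"
  proof (rule continuous_map_cases_le)
    let ?A = "subtopology ?P {x \<in> topspace ?P. snd x \<le> 1 / 2}"
    have "continuous_map ?A I01 (\<lambda>x. 2 * snd x)"
      unfolding continuous_map_in_subtopology
      by (intro conjI continuous_intros continuous_map_from_subtopology s) auto
    then have "continuous_map ?A ?P (\<lambda>x. (fst x, 2 * snd x))"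
      by (rule continuous_map_pairedI[OF continuous_map_from_subtopology[OF f]])
    from continuous_map_compose[OF this h(1)]
    show "continuous_map ?A X (\<lambda>x. h (fst x) (2 * snd x))" by (simp add: o_def)
    let ?B = "subtopology ?P {x \<in> topspace ?P. 1 / 2 \<le> snd x}"
    have "continuous_map ?B I01 (\<lambda>x. 2 * snd x - 1)"
      unfolding continuous_map_in_subtopology
      by (intro conjI continuous_intros continuous_map_from_subtopology s) auto
    then have "continuous_map ?B ?P (\<lambda>x. (fst x, 2 * snd x - 1))"
      by (rule continuous_map_pairedI[OF continuous_map_from_subtopology[OF f]])
    from continuous_map_compose[OF this k(1)]
    show "continuous_map ?B X (\<lambda>x. k (fst x) (2 * snd x - 1))" by (simp add: o_def)
    show "h (fst x) (2 * snd x) = k (fst x) (2 * snd x - 1)" if "x \<in> topspace ?P" "snd x = 1/2" for x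
    proof -
      have "2 * snd x = 1" using that(2) by simp
      then show ?thesis using that(1) h(5)[of "fst x"] k(4)[of "fst x"] e by auto
    qed
  qed (use s in auto)
  then show ?thesis
    by (intro path_homotopicI[where h = ?m]) (use h k in \<open>auto simp: join_loops_def case_prod_unfold\<close>)
qed

lemma pathin_join: "\<lbrakk>pathin X p; pathin X q; p 1 = q 0\<rbrakk> \<Longrightarrow> pathin X (join_loops p q)"
  using path_homotopic_join[OF path_homotopic_refl path_homotopic_refl] path_homotopic_ends(3) by blast

lemma path_homotopic_rev:
  assumes "path_homotopic X p q" shows "path_homotopic X (rev_path p) (rev_path q)"
proof -
  obtain h where h: "continuous_map (prod_topology I01 I01) X (\<lambda>(s, t). h s t)"
    "\<And>t. h 0 t = p t" "\<And>t. h 1 t = q t"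
    "\<And>s. s \<in> {0..1} \<Longrightarrow> h s 0 = p 0" "\<And>s. s \<in> {0..1} \<Longrightarrow> h s 1 = p 1"
    by (rule path_homotopicE[OF assms]) blast
  let ?P = "prod_topology I01 I01"
  have f: "continuous_map ?P I01 fst" and s: "continuous_map ?P euclideanreal snd"
    using continuous_map_I01_real continuous_map_snd continuous_map_fst by blast+
  have "continuous_map ?P I01 (\<lambda>x. 1 - snd x)"
    unfolding continuous_map_in_subtopology by (intro conjI continuous_intros s) auto
  then have "continuous_map ?P ?P (\<lambda>x. (fst x, 1 - snd x))"
    by (intro continuous_map_pairedI f)
  from continuous_map_compose[OF this h(1)]
  have "continuous_map ?P X (\<lambda>x. h (fst x) (1 - snd x))" by (simp add: o_def)
  then show ?thesis
    by (intro path_homotopicI[where h = "\<lambda>s t. h s (1 - t)"]) (use h in \<open>auto simp: rev_path_def case_prod_unfold\<close>)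
qed

lemma pathin_rev: "pathin X p \<Longrightarrow> pathin X (rev_path p)"
  using path_homotopic_rev[OF path_homotopic_refl] path_homotopic_ends(3) by blast

lemma join_assoc:
  assumes "pathin X p" "pathin X q" "pathin X r" "p 1 = q 0" "q 1 = r 0"
  shows "path_homotopic X (join_loops (join_loops p q) r) (join_loops p (join_loops q r))"
proof -
  let ?P = "join_loops (join_loops p q) r"
  \<comment> \<open>the reparametrisation has slopes 1/2, 1 and 2, so it is the maximum of its affine pieces\<close>
  let ?v = "\<lambda>t::real. max (t/2) (max (t - 1/4) (2*t - 1))"
  have P: "pathin X ?P" using assms by (simp add: pathin_join)
  have "path_homotopic X (?P \<circ> id) (?P \<circ> ?v)"
    by (rule path_reparam[OF P]) (auto intro!: continuous_map_I01_I01 continuous_intros simp: le_max_iff_disj)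
  moreover have "path_homotopic X (?P \<circ> ?v) (join_loops p (join_loops q r))"
  proof (rule path_homotopic_eq)
    show "pathin X (?P \<circ> ?v)" using path_homotopic_ends(4)[OF calculation] .
    show "(?P \<circ> ?v) t = join_loops p (join_loops q r) t" if "t \<in> {0..1}" for t
    proof -
      consider "t \<le> 1/2" | "1/2 < t" "t \<le> 3/4" | "3/4 < t" by linarith
      then show ?thesis
      proof cases
        case 1
        then have "?v t = t/2" by auto
        then show ?thesis using 1 by (simp add: join_loops_def)
      next
        case 2
        then have "?v t = t - 1/4" by auto
        then show ?thesis using 2 by (simp add: join_loops_def algebra_simps)
      next
        case 3
        then have "?v t = 2*t - 1" by auto
        then show ?thesis using 3 by (simp add: join_loops_def algebra_simps)
      qed
    qed
  qed
  ultimately show ?thesis using path_homotopic_trans by fastforce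
qed

lemma join_const_left:
  assumes "pathin X p" "b = p 0" shows "path_homotopic X (join_loops (\<lambda>_. b) p) p"
proof -
  let ?v = "\<lambda>t::real. max 0 (2*t - 1)"
  have *: "path_homotopic X (p \<circ> ?v) (p \<circ> id)"
    by (rule path_reparam[OF assms(1)]) (auto intro!: continuous_map_I01_I01 continuous_intros)
  have "path_homotopic X (p \<circ> ?v) (join_loops (\<lambda>_. b) p)"
  proof (rule path_homotopic_eq[OF path_homotopic_ends(3)[OF *]])
    show "(p \<circ> ?v) t = join_loops (\<lambda>_. b) p t" for t
    proof (cases "t \<le> 1/2")
      case True
      then have "?v t = 0" by simp
      then show ?thesis using True by (simp add: join_loops_def assms(2))
    qed (simp add: join_loops_def max_def)
  qed
  with * show ?thesis using path_homotopic_sym path_homotopic_trans by fastforce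
qed

lemma join_const_right:
  assumes "pathin X p" "b = p 1" shows "path_homotopic X (join_loops p (\<lambda>_. b)) p"
proof -
  let ?v = "\<lambda>t::real. min 1 (2*t)"
  have *: "path_homotopic X (p \<circ> ?v) (p \<circ> id)"
    by (rule path_reparam[OF assms(1)]) (auto intro!: continuous_map_I01_I01 continuous_intros)
  have "path_homotopic X (p \<circ> ?v) (join_loops p (\<lambda>_. b))"
  proof (rule path_homotopic_eq[OF path_homotopic_ends(3)[OF *]])
    show "(p \<circ> ?v) t = join_loops p (\<lambda>_. b) t" for t
    proof (cases "t \<le> 1/2")
      case True
      then have "?v t = 2*t" by simp
      then show ?thesis using True by (simp add: join_loops_def)
    qed (simp add: join_loops_def assms(2) min_def)
  qed
  with * show ?thesis using path_homotopic_sym path_homotopic_trans by fastforce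
qed

lemma join_rev:
  assumes "pathin X p" shows "path_homotopic X (join_loops p (rev_path p)) (\<lambda>_. p 0)"
proof -
  \<comment> \<open>\<open>p\<close> is run through up to its end and back; both ends of \<open>?v\<close> are 0, like those of a constant\<close>
  let ?v = "\<lambda>t::real. min (2*t) (2 - 2*t)"
  have *: "path_homotopic X (p \<circ> ?v) (p \<circ> (\<lambda>_. 0))"
    by (rule path_reparam[OF assms(1)]) (auto intro!: continuous_map_I01_I01 continuous_intros)
  have "path_homotopic X (p \<circ> ?v) (join_loops p (rev_path p))"
    by (rule path_homotopic_eq[OF path_homotopic_ends(3)[OF *]]) (auto simp: join_loops_def rev_path_def min_def)
  with * show ?thesis using path_homotopic_sym path_homotopic_trans by (fastforce simp: o_def)
qed

lemma join_rev_left: "pathin X p \<Longrightarrow> path_homotopic X (join_loops (rev_path p) p) (\<lambda>_. p 1)"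
  using join_rev[OF pathin_rev, of X p] by simp

lemma pathin_const: "x \<in> topspace X \<Longrightarrow> pathin X (\<lambda>_. x)"
  by (simp add: pathin_def)

lemma rev_join:
  assumes "pathin X p" "pathin X q" "p 1 = q 0"
  shows "path_homotopic X (rev_path (join_loops p q)) (join_loops (rev_path q) (rev_path p))"
proof (rule path_homotopic_eq)
  show "pathin X (rev_path (join_loops p q))" using assms pathin_join pathin_rev by blast
  fix t :: real assume "t \<in> {0..1}"
  consider "t < 1/2" | "t = 1/2" | "t > 1/2" by linarith
  then show "rev_path (join_loops p q) t = join_loops (rev_path q) (rev_path p) t"
    using assms(3) by cases (auto simp: rev_path_def join_loops_def algebra_simps)
qed

lemma join_cancel:
  assumes p: "pathin X p" and q: "pathin X q" "pathin X r" "p 1 = q 0" "r 0 = q 0"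
  shows "path_homotopic X (join_loops (join_loops p q) (join_loops (rev_path q) r)) (join_loops p r)"
proof -
  have q': "pathin X (rev_path q)" using q pathin_rev by blast
  have qr: "pathin X (join_loops (rev_path q) r)" using q q' by (simp add: pathin_join)
  have "path_homotopic X (join_loops (join_loops p q) (join_loops (rev_path q) r)) (join_loops p (join_loops q (join_loops (rev_path q) r)))"
    by (rule join_assoc) (use p q qr in auto)
  also have "path_homotopic X \<dots> (join_loops p r)"
  proof (rule path_homotopic_join[OF path_homotopic_refl[OF p]])
    have "path_homotopic X (join_loops q (join_loops (rev_path q) r)) (join_loops (join_loops q (rev_path q)) r)"
      by (rule path_homotopic_sym[OF join_assoc]) (use q q' in auto)
    also have "path_homotopic X \<dots> (join_loops (\<lambda>_. q 0) r)"
      by (rule path_homotopic_join[OF join_rev[OF q(1)] path_homotopic_refl[OF q(2)]]) (use q in simp)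
    also have "path_homotopic X \<dots> r" by (rule join_const_left) (use q in auto)
    finally show "path_homotopic X (join_loops q (join_loops (rev_path q) r)) r" .
    show "p 1 = join_loops q (join_loops (rev_path q) r) 0" using q by simp
  qed
  finally show ?thesis .
qed

section \<open>The fundamental group\<close>

lemma homotopic_loops_at_iff:
  "homotopic_loops_at X a p q \<longleftrightarrow> p 0 = a \<and> p 1 = a \<and> path_homotopic X p q"
proof
  assume "homotopic_loops_at X a p q"
  then have h: "homotopic_with (\<lambda>r. r 0 = a \<and> r 1 = a) I01 X p q" by (simp add: homotopic_loops_at_def)
  then have "p 0 = a \<and> p 1 = a" using homotopic_with_imp_property by blast
  with h show "p 0 = a \<and> p 1 = a \<and> path_homotopic X p q" by (simp add: path_homotopic_def)
qed (auto simp: homotopic_loops_at_def path_homotopic_def)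

lemma loops_atI: "\<lbrakk>pathin X p; p 0 = a; p 1 = a\<rbrakk> \<Longrightarrow> p \<in> loops_at X a"
  by (simp add: loops_at_def)

lemma loops_atD: "p \<in> loops_at X a \<Longrightarrow> pathin X p \<and> p 0 = a \<and> p 1 = a"
  by (simp add: loops_at_def)

lemma loop_class_eq_iff:
  assumes p: "p \<in> loops_at X a"
  shows "loop_class X a p = loop_class X a q \<longleftrightarrow> path_homotopic X p q"
proof
  assume eq: "loop_class X a p = loop_class X a q"
  have "p \<in> loop_class X a p"
    using loops_atD[OF p] path_homotopic_refl by (auto simp: loop_class_def homotopic_loops_at_iff)
  then have "p \<in> loop_class X a q" using eq by simp
  then show "path_homotopic X p q"
    using path_homotopic_sym by (auto simp: loop_class_def homotopic_loops_at_iff)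
next
  assume h: "path_homotopic X p q"
  then show "loop_class X a p = loop_class X a q"
  proof -
    have "path_homotopic X p r \<longleftrightarrow> path_homotopic X q r" for r
      using h path_homotopic_sym[OF h] path_homotopic_trans by blast
    then show ?thesis
      using path_homotopic_ends(1,2)[OF h] loops_atD[OF p] by (simp add: loop_class_def homotopic_loops_at_iff)
  qed
qed

lemma carrier_fundamental_group: "carrier (fundamental_group X a) = loop_class X a ` loops_at X a"
  and one_fundamental_group: "\<one>\<^bsub>fundamental_group X a\<^esub> = loop_class X a (\<lambda>_. a)"
  by (simp_all add: fundamental_group_def)

lemma loop_class_in_carrier: "p \<in> loops_at X a \<Longrightarrow> loop_class X a p \<in> carrier (fundamental_group X a)"
  by (simp add: carrier_fundamental_group)

lemma join_in_loops_at: "\<lbrakk>p \<in> loops_at X a; q \<in> loops_at X a\<rbrakk> \<Longrightarrow> join_loops p q \<in> loops_at X a"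
  by (simp add: loops_at_def pathin_join)

lemma mult_fundamental_group:
  assumes p: "p \<in> loops_at X a" and q: "q \<in> loops_at X a"
  shows "loop_class X a p \<otimes>\<^bsub>fundamental_group X a\<^esub> loop_class X a q = loop_class X a (join_loops p q)"
proof -
  have eq: "loop_class X a (join_loops p' q') = loop_class X a (join_loops p q)"
    if "p' \<in> loop_class X a p" "q' \<in> loop_class X a q" for p' q'
  proof -
    have "path_homotopic X (join_loops p q) (join_loops p' q')"
    proof (rule path_homotopic_join)
      show "path_homotopic X p p'" "path_homotopic X q q'"
        using that by (simp_all add: loop_class_def homotopic_loops_at_iff)
      show "p 1 = q 0" using loops_atD[OF p] loops_atD[OF q] by simp
    qed
    then show ?thesis using loop_class_eq_iff[OF join_in_loops_at[OF p q], of "join_loops p' q'"] by simp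
  qed
  have "p \<in> loop_class X a p" "q \<in> loop_class X a q"
    using loops_atD[OF p] loops_atD[OF q] path_homotopic_refl by (auto simp: loop_class_def homotopic_loops_at_iff)
  then have "(\<Union>p'\<in>loop_class X a p. \<Union>q'\<in>loop_class X a q. loop_class X a (join_loops p' q')) = loop_class X a (join_loops p q)"
    using eq by blast
  then show ?thesis by (simp add: fundamental_group_def)
qed

lemma group_fundamental_group:
  assumes a: "a \<in> topspace X" shows "group (fundamental_group X a)"
proof -
  let ?G = "fundamental_group X a"
  let ?c = "loop_class X a"
  have const: "(\<lambda>_. a) \<in> loops_at X a" using a pathin_const by (auto intro: loops_atI)
  show ?thesis
  proof (rule groupI)
    show "\<one>\<^bsub>?G\<^esub> \<in> carrier ?G" using const by (simp add: one_fundamental_group loop_class_in_carrier)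
    fix x assume x: "x \<in> carrier ?G"
    then obtain p where p: "x = ?c p" "p \<in> loops_at X a" by (auto simp: carrier_fundamental_group)
    note pD = loops_atD[OF p(2)]
    have "?c (join_loops (\<lambda>_. a) p) = ?c p"
      using loop_class_eq_iff[OF join_in_loops_at[OF const p(2)], of p] join_const_left[of X p a] pD by simp
    then show "\<one>\<^bsub>?G\<^esub> \<otimes>\<^bsub>?G\<^esub> x = x"
      by (simp add: one_fundamental_group p mult_fundamental_group const)
    have r: "rev_path p \<in> loops_at X a" using pD pathin_rev[of X p] by (simp add: loops_at_def)
    have "?c (join_loops (rev_path p) p) = ?c (\<lambda>_. a)"
      using loop_class_eq_iff[OF join_in_loops_at[OF r p(2)], of "\<lambda>_. a"] join_rev_left[of X p] pD by simp
    then show "\<exists>y\<in>carrier ?G. y \<otimes>\<^bsub>?G\<^esub> x = \<one>\<^bsub>?G\<^esub>"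
      using r by (intro bexI[of _ "?c (rev_path p)"]) (simp_all add: one_fundamental_group p mult_fundamental_group loop_class_in_carrier)
    fix y assume y: "y \<in> carrier ?G"
    then obtain q where q: "y = ?c q" "q \<in> loops_at X a" by (auto simp: carrier_fundamental_group)
    note qD = loops_atD[OF q(2)]
    show "x \<otimes>\<^bsub>?G\<^esub> y \<in> carrier ?G"
      using p q by (simp add: mult_fundamental_group loop_class_in_carrier join_in_loops_at)
    fix z assume z: "z \<in> carrier ?G"
    then obtain r where r: "z = ?c r" "r \<in> loops_at X a" by (auto simp: carrier_fundamental_group)
    note rD = loops_atD[OF r(2)]
    have "?c (join_loops (join_loops p q) r) = ?c (join_loops p (join_loops q r))"
      using join_assoc[of X p q r] pD qD rD p q r by (subst loop_class_eq_iff) (auto intro: join_in_loops_at)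
    then show "x \<otimes>\<^bsub>?G\<^esub> y \<otimes>\<^bsub>?G\<^esub> z = x \<otimes>\<^bsub>?G\<^esub> (y \<otimes>\<^bsub>?G\<^esub> z)"
      using p q r by (simp add: mult_fundamental_group join_in_loops_at)
  qed
qed

lemma inv_fundamental_group:
  assumes a: "a \<in> topspace X" and p: "p \<in> loops_at X a"
  shows "inv\<^bsub>fundamental_group X a\<^esub> (loop_class X a p) = loop_class X a (rev_path p)"
proof -
  interpret group "fundamental_group X a" by (rule group_fundamental_group[OF a])
  note pD = loops_atD[OF p]
  have r: "rev_path p \<in> loops_at X a" using pD pathin_rev[of X p] by (simp add: loops_at_def)
  have "loop_class X a (join_loops (rev_path p) p) = loop_class X a (\<lambda>_. a)"
    using loop_class_eq_iff[OF join_in_loops_at[OF r p], of "\<lambda>_. a"] join_rev_left[of X p] pD by simp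
  then show ?thesis
    by (intro inv_equality) (simp_all add: one_fundamental_group mult_fundamental_group loop_class_in_carrier p r)
qed

section \<open>Paths along segments\<close>

definition segment_path :: "(nat \<Rightarrow> real) \<Rightarrow> (nat \<Rightarrow> real) \<Rightarrow> real \<Rightarrow> nat \<Rightarrow> real" where
  "segment_path z w t = (\<lambda>i. (1 - t) * z i + t * w i)"

text \<open>
  Convexity, expressed coordinatewise, in the function type in which standard simplices and Euclidean
  spaces live.
\<close>

definition convex_fun :: "(nat \<Rightarrow> real) set \<Rightarrow> bool" where
  "convex_fun S \<longleftrightarrow> (\<forall>z\<in>S. \<forall>w\<in>S. \<forall>t\<in>{0..1}. segment_path z w t \<in> S)"

lemma segment_path_ends [simp]: "segment_path z w 0 = z" "segment_path z w 1 = w"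
  by (simp_all add: segment_path_def)

lemma path_homotopic_convex_fun:
  assumes S: "convex_fun S" and u: "pathin (subtopology (powertop_real UNIV) S) u"
    and v: "pathin (subtopology (powertop_real UNIV) S) v" and e: "u 0 = v 0" "u 1 = v 1"
  shows "path_homotopic (subtopology (powertop_real UNIV) S) u v"
proof (rule path_homotopicI)
  let ?P = "prod_topology I01 I01"
  have s: "continuous_map ?P euclideanreal fst"
    using continuous_map_I01_real continuous_map_fst by blast
  have comp: "continuous_map ?P euclideanreal (\<lambda>x. w (snd x) i)" if "pathin (subtopology (powertop_real UNIV) S) w" for w i
  proof -
    have "continuous_map I01 euclideanreal (\<lambda>t. w t i)"
      using that unfolding pathin_def continuous_map_in_subtopology continuous_map_componentwise_UNIV by blast
    from continuous_map_compose[OF continuous_map_snd this] show ?thesis unfolding o_def by blast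
  qed
  have in_S: "w t \<in> S" if "pathin (subtopology (powertop_real UNIV) S) w" "t \<in> {0..1}" for w t
    using that unfolding pathin_def by (auto simp: continuous_map_def)
  have "continuous_map ?P (subtopology (powertop_real UNIV) S) (\<lambda>x. segment_path (u (snd x)) (v (snd x)) (fst x))"
    unfolding continuous_map_in_subtopology continuous_map_componentwise_UNIV
  proof (intro conjI allI)
    show "continuous_map ?P euclideanreal (\<lambda>x. segment_path (u (snd x)) (v (snd x)) (fst x) i)" for i
      unfolding segment_path_def
      by (rule continuous_map_add[OF continuous_map_real_mult[OF _ comp[OF u]] continuous_map_real_mult[OF s comp[OF v]]])
        (intro continuous_map_diff s, simp)
    show "(\<lambda>x. segment_path (u (snd x)) (v (snd x)) (fst x)) \<in> topspace ?P \<rightarrow> S"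
      using S in_S[OF u] in_S[OF v] unfolding convex_fun_def by auto
  qed
  then show "continuous_map ?P (subtopology (powertop_real UNIV) S) (\<lambda>(s, t). segment_path (u t) (v t) s)"
    by (simp add: case_prod_unfold)
qed (use e in \<open>auto simp: segment_path_def algebra_simps\<close>)

lemma pathin_segment_path:
  assumes "convex_fun S" "z \<in> S" "w \<in> S"
  shows "pathin (subtopology (powertop_real UNIV) S) (segment_path z w)"
  unfolding pathin_def continuous_map_in_subtopology continuous_map_componentwise_UNIV
proof (intro conjI allI)
  show "continuous_map I01 euclideanreal (\<lambda>t. segment_path z w t i)" for i
    unfolding segment_path_def by (auto intro!: continuous_intros)
  show "segment_path z w \<in> topspace I01 \<rightarrow> S" using assms by (auto simp: convex_fun_def)
qed

lemma compose_join: "f \<circ> join_loops p q = join_loops (f \<circ> p) (f \<circ> q)"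
  by (auto simp: join_loops_def fun_eq_iff)

lemma path_homotopic_triangle:
  assumes S: "convex_fun S" and f: "continuous_map (subtopology (powertop_real UNIV) S) Y f" and z: "z \<in> S" "v \<in> S" "w \<in> S"
  shows "path_homotopic Y (join_loops (f \<circ> segment_path z v) (f \<circ> segment_path v w)) (f \<circ> segment_path z w)"
proof -
  have "path_homotopic (subtopology (powertop_real UNIV) S) (join_loops (segment_path z v) (segment_path v w)) (segment_path z w)"
    by (rule path_homotopic_convex_fun[OF S pathin_join])
      (use z in \<open>simp_all add: pathin_segment_path[OF S]\<close>)
  from path_homotopic_compose[OF this f] show ?thesis by (simp add: compose_join)
qed

lemma pathin_compose_segment:
  assumes S: "convex_fun S" and f: "continuous_map (subtopology (powertop_real UNIV) S) Y f" and "z \<in> S" "w \<in> S"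
  shows "pathin Y (f \<circ> segment_path z w)"
  using continuous_map_compose[OF pathin_segment_path[OF S assms(3,4), unfolded pathin_def] f] unfolding pathin_def .

text \<open>
  The homotopies may leave \<open>U\<close>: this is semi-local simple connectedness, stated for pairs of paths.
\<close>

definition parallel_paths_homotopic :: "'a topology \<Rightarrow> 'a set \<Rightarrow> bool" where
  "parallel_paths_homotopic X U \<longleftrightarrow> (\<forall>d d'. pathin X d \<and> pathin X d' \<and> d ` {0..1} \<subseteq> U \<and> d' ` {0..1} \<subseteq> U
     \<and> d 0 = d' 0 \<and> d 1 = d' 1 \<longrightarrow> path_homotopic X d d')"

lemma manifold_parallel_paths_homotopic:
  assumes M: "manifold n M" and x: "x \<in> topspace M"
  obtains U where "openin M U" "x \<in> U" "parallel_paths_homotopic M U"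
proof -
  let ?E = "Euclidean_space n"
  obtain U \<phi> \<psi> where U: "openin M U" "x \<in> U" and hm: "homeomorphic_maps (subtopology M U) ?E \<phi> \<psi>"
    by (rule manifold_centered_chart[OF M openin_topspace x]) blast
  have UM: "U \<subseteq> topspace M" using U openin_subset by blast
  note h = homeomorphic_mapsD[OF hm UM]
  have psi: "continuous_map ?E M \<psi>" using h(2) continuous_map_in_subtopology by blast
  have conv: "convex_fun {v. \<forall>i\<ge>n. v i = 0}" by (simp add: convex_fun_def segment_path_def)
  have chart: "pathin ?E (\<phi> \<circ> d)" "\<And>t. t \<in> {0..1} \<Longrightarrow> (\<psi> \<circ> (\<phi> \<circ> d)) t = d t" if "pathin M d" "d ` {0..1} \<subseteq> U" for d
  proof -
    have "continuous_map I01 (subtopology M U) d"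
      using that by (auto simp: pathin_def continuous_map_in_subtopology)
    then show "pathin ?E (\<phi> \<circ> d)" using continuous_map_compose h(1) unfolding pathin_def by blast
    show "(\<psi> \<circ> (\<phi> \<circ> d)) t = d t" if "t \<in> {0..1}" for t
      using that \<open>d ` {0..1} \<subseteq> U\<close> h(3)[of "d t"] by (simp add: image_subset_iff)
  qed
  have "path_homotopic M d d'" if d: "pathin M d" "d ` {0..1} \<subseteq> U" and d': "pathin M d'" "d' ` {0..1} \<subseteq> U"
    and e: "d 0 = d' 0" "d 1 = d' 1" for d d'
  proof -
    have "path_homotopic ?E (\<phi> \<circ> d) (\<phi> \<circ> d')"
      using path_homotopic_convex_fun[OF conv] chart(1)[OF d] chart(1)[OF d'] e unfolding Euclidean_space_def by simp
    then have m: "path_homotopic M (\<psi> \<circ> (\<phi> \<circ> d)) (\<psi> \<circ> (\<phi> \<circ> d'))"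
      using path_homotopic_compose psi by blast
    have "path_homotopic M d (\<psi> \<circ> (\<phi> \<circ> d))" 
      by (rule path_homotopic_eq[OF d(1)]) (simp only: chart(2)[OF d])
    also note m
    also have "path_homotopic M (\<psi> \<circ> (\<phi> \<circ> d')) d'"
      by (rule path_homotopic_eq[OF path_homotopic_ends(4)[OF m]]) (simp only: chart(2)[OF d'])
    finally show ?thesis .
  qed
  then have "parallel_paths_homotopic M U" unfolding parallel_paths_homotopic_def by blast
  with U show thesis by (rule that)
qed

section \<open>The covering of a subgroup of the fundamental group\<close>

lemma join_loops_image: "join_loops d d' ` {0..1} \<subseteq> d ` {0..1} \<union> d' ` {0..1}"
proof
  fix x assume "x \<in> join_loops d d' ` {0..1}"
  then obtain t where t: "t \<in> {0..1}" "x = join_loops d d' t" by blast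
  then show "x \<in> d ` {0..1} \<union> d' ` {0..1}"
    by (cases "t \<le> 1/2") (auto simp: join_loops_def)
qed

lemma rev_path_image: "rev_path d ` {0..1} \<subseteq> d ` {0..1}"
  by (auto simp: rev_path_def)

lemma pathin_in_topspace: "pathin X d \<Longrightarrow> t \<in> {0..1} \<Longrightarrow> d t \<in> topspace X"
  by (auto simp: pathin_def continuous_map_def)

text \<open>
  The covering of \<open>X\<close> that belongs to a subgroup \<open>H\<close> of the fundamental group: its points are classes of
  paths \<open>g\<close> from the base point, where \<open>g\<close> and \<open>h\<close> are identified if they have the same endpoint and
  the loop that follows \<open>g\<close> and returns along \<open>h\<close> belongs to \<open>H\<close>.
\<close>

locale subgroup_cover =
  fixes X :: "'a topology" and a :: 'a and H :: "(real \<Rightarrow> 'a) set set"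
  assumes a: "a \<in> topspace X" and H: "subgroup H (fundamental_group X a)"
begin

abbreviation G where "G \<equiv> fundamental_group X a"

definition based_paths :: "(real \<Rightarrow> 'a) set" where
  "based_paths = {g. pathin X g \<and> g 0 = a}"

definition same_point :: "(real \<Rightarrow> 'a) \<Rightarrow> (real \<Rightarrow> 'a) \<Rightarrow> bool" where
  "same_point g h \<longleftrightarrow> g \<in> based_paths \<and> h \<in> based_paths \<and> g 1 = h 1 \<and>
     loop_class X a (join_loops g (rev_path h)) \<in> H"

lemma based_pathsD: "g \<in> based_paths \<Longrightarrow> pathin X g" "g \<in> based_paths \<Longrightarrow> g 0 = a"
  by (auto simp: based_paths_def)

lemma based_paths_join:
  "\<lbrakk>g \<in> based_paths; pathin X d; d 0 = g 1\<rbrakk> \<Longrightarrow> join_loops g d \<in> based_paths"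
  by (simp add: based_paths_def pathin_join)

lemma loop_in_H_cong:
  assumes "loop_class X a p \<in> H" "path_homotopic X p q" "p 0 = a" "p 1 = a"
  shows "loop_class X a q \<in> H"
proof -
  have "p \<in> loops_at X a" using assms path_homotopic_ends(3)[OF assms(2)] by (simp add: loops_at_def)
  then show ?thesis using loop_class_eq_iff assms(1,2) by metis
qed

lemma join_rev_in_loops_at:
  assumes "g \<in> based_paths" "h \<in> based_paths" "g 1 = h 1"
  shows "join_loops g (rev_path h) \<in> loops_at X a"
  using assms by (auto intro!: loops_atI pathin_join pathin_rev simp: based_paths_def)

lemma same_point_homotopic:
  assumes g: "g \<in> based_paths" and h: "path_homotopic X g h"
  shows "same_point g h"
proof -
  have hP: "h \<in> based_paths" using path_homotopic_ends[OF h] g by (simp add: based_paths_def)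
  have e: "g 1 = h 1" using path_homotopic_ends[OF h] by simp
  have "path_homotopic X (join_loops g (rev_path h)) (join_loops g (rev_path g))"
    by (rule path_homotopic_join[OF path_homotopic_refl[OF based_pathsD(1)[OF g]] path_homotopic_rev[OF path_homotopic_sym[OF h]]])
      (simp add: e)
  also have "path_homotopic X \<dots> (\<lambda>_. a)"
    using join_rev[OF based_pathsD(1)[OF g]] based_pathsD(2)[OF g] by simp
  finally have "loop_class X a (join_loops g (rev_path h)) = \<one>\<^bsub>G\<^esub>"
    using loop_class_eq_iff[OF join_rev_in_loops_at[OF g hP e]] by (simp add: one_fundamental_group)
  then show ?thesis using g hP e H subgroup.one_closed by (fastforce simp: same_point_def)
qed

lemma same_point_refl: "g \<in> based_paths \<Longrightarrow> same_point g g"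
  using same_point_homotopic path_homotopic_refl based_pathsD(1) by blast

lemma same_point_sym:
  assumes "same_point g h" shows "same_point h g"
proof -
  have g: "g \<in> based_paths" and h: "h \<in> based_paths" and e: "g 1 = h 1"
    and H1: "loop_class X a (join_loops g (rev_path h)) \<in> H" using assms by (auto simp: same_point_def)
  have "inv\<^bsub>G\<^esub> (loop_class X a (join_loops g (rev_path h))) \<in> H" using H H1 subgroup.m_inv_closed by metis
  then have "loop_class X a (rev_path (join_loops g (rev_path h))) \<in> H"
    using inv_fundamental_group[OF a join_rev_in_loops_at[OF g h e]] by simp
  moreover have "path_homotopic X (rev_path (join_loops g (rev_path h))) (join_loops h (rev_path g))"
    using rev_join[OF based_pathsD(1)[OF g] pathin_rev[OF based_pathsD(1)[OF h]]] e by simp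
  ultimately have "loop_class X a (join_loops h (rev_path g)) \<in> H"
    by (rule loop_in_H_cong) (use g h based_pathsD in auto)
  then show ?thesis using g h e by (simp add: same_point_def)
qed

lemma same_point_trans:
  assumes "same_point g h" "same_point h k" shows "same_point g k"
proof -
  have P: "g \<in> based_paths" "h \<in> based_paths" "k \<in> based_paths" and e: "g 1 = h 1" "h 1 = k 1"
    and H1: "loop_class X a (join_loops g (rev_path h)) \<in> H"
    and H2: "loop_class X a (join_loops h (rev_path k)) \<in> H" using assms by (auto simp: same_point_def)
  have "loop_class X a (join_loops g (rev_path h)) \<otimes>\<^bsub>G\<^esub> loop_class X a (join_loops h (rev_path k)) \<in> H"
    using H H1 H2 subgroup.m_closed by metis
  then have "loop_class X a (join_loops (join_loops g (rev_path h)) (join_loops h (rev_path k))) \<in> H"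
    using mult_fundamental_group[OF join_rev_in_loops_at[OF P(1,2) e(1)] join_rev_in_loops_at[OF P(2,3) e(2)]] by simp
  moreover have "path_homotopic X (join_loops (join_loops g (rev_path h)) (join_loops h (rev_path k))) (join_loops g (rev_path k))"
    using join_cancel[OF based_pathsD(1)[OF P(1)] pathin_rev[OF based_pathsD(1)[OF P(2)]] pathin_rev[OF based_pathsD(1)[OF P(3)]]] e by simp
  ultimately have "loop_class X a (join_loops g (rev_path k)) \<in> H"
    by (rule loop_in_H_cong) (use P based_pathsD in auto)
  then show ?thesis using P e by (simp add: same_point_def)
qed

lemma same_point_join:
  assumes gh: "same_point g h" and d: "pathin X d" "d 0 = g 1"
  shows "same_point (join_loops g d) (join_loops h d)"
proof -
  have P: "g \<in> based_paths" "h \<in> based_paths" and e: "g 1 = h 1"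
    and H1: "loop_class X a (join_loops g (rev_path h)) \<in> H" using gh by (auto simp: same_point_def)
  have P': "join_loops g d \<in> based_paths" "join_loops h d \<in> based_paths"
    using P d e by (auto intro: based_paths_join)
  note pin = based_pathsD(1)[OF P(1)] based_pathsD(1)[OF P(2)]
  have "path_homotopic X (join_loops (join_loops g d) (rev_path (join_loops h d)))
      (join_loops (join_loops g d) (join_loops (rev_path d) (rev_path h)))"
    by (rule path_homotopic_join[OF path_homotopic_refl rev_join]) (use pin d e P' based_pathsD in auto)
  also have "path_homotopic X \<dots> (join_loops g (rev_path h))"
    by (rule join_cancel) (use pin d e pathin_rev in auto)
  finally have hm: "path_homotopic X (join_loops (join_loops g d) (rev_path (join_loops h d))) (join_loops g (rev_path h))" .
  have "loop_class X a (join_loops (join_loops g d) (rev_path (join_loops h d))) \<in> H"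
    by (rule loop_in_H_cong[OF H1 path_homotopic_sym[OF hm]]) (use P based_pathsD in auto)
  then show ?thesis using P' by (simp add: same_point_def)
qed

definition point :: "(real \<Rightarrow> 'a) \<Rightarrow> (real \<Rightarrow> 'a) set" where
  "point g = {h. same_point g h}"

lemma point_eq_iff: "g \<in> based_paths \<Longrightarrow> point g = point h \<longleftrightarrow> same_point g h"
  using same_point_refl same_point_sym same_point_trans unfolding point_def by blast

lemma point_homotopic: "\<lbrakk>g \<in> based_paths; path_homotopic X g h\<rbrakk> \<Longrightarrow> point g = point h"
  by (simp add: point_eq_iff same_point_homotopic)

lemma point_join:
  "\<lbrakk>g \<in> based_paths; point g = point h; pathin X d; d 0 = g 1\<rbrakk> \<Longrightarrow> point (join_loops g d) = point (join_loops h d)"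
  using same_point_join point_eq_iff based_paths_join by metis

lemma point_assoc:
  assumes "g \<in> based_paths" "pathin X d" "d 0 = g 1" "pathin X d'" "d' 0 = d 1"
  shows "point (join_loops (join_loops g d) d') = point (join_loops g (join_loops d d'))"
  by (rule point_homotopic) (use assms in \<open>auto intro!: based_paths_join join_assoc dest: based_pathsD\<close>)

lemma point_back:
  assumes "g \<in> based_paths" "pathin X d" "d 0 = g 1"
  shows "point (join_loops (join_loops g d) (rev_path d)) = point g"
proof -
  have "point (join_loops (join_loops g d) (rev_path d)) = point (join_loops g (join_loops d (rev_path d)))"
    by (rule point_assoc) (use assms pathin_rev in auto)
  also have "\<dots> = point g"
  proof (rule point_homotopic)
    note pin = based_pathsD(1)[OF assms(1)]
    show "join_loops g (join_loops d (rev_path d)) \<in> based_paths"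
      using assms by (auto intro!: based_paths_join pathin_join pathin_rev)
    have "path_homotopic X (join_loops g (join_loops d (rev_path d))) (join_loops g (\<lambda>_. d 0))"
      by (rule path_homotopic_join[OF path_homotopic_refl[OF pin] join_rev[OF assms(2)]]) (simp add: assms(3))
    also have "path_homotopic X \<dots> g" by (rule join_const_right[OF pin assms(3)])
    finally show "path_homotopic X (join_loops g (join_loops d (rev_path d))) g" .
  qed
  finally show ?thesis .
qed

definition endpoint :: "(real \<Rightarrow> 'a) set \<Rightarrow> 'a" where
  "endpoint e = (SOME g. g \<in> e) 1"

lemma endpoint_point: assumes "g \<in> based_paths" shows "endpoint (point g) = g 1"
proof -
  have "(SOME h. h \<in> point g) \<in> point g"
    by (rule someI[of _ g]) (use same_point_refl[OF assms] in \<open>simp add: point_def\<close>)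
  then have "g 1 = (SOME h. h \<in> point g) 1" unfolding point_def mem_Collect_eq same_point_def by blast
  then show ?thesis unfolding endpoint_def by (rule sym)
qed

text \<open>
  The points that are reached from \<open>g\<close> by continuing within \<open>U\<close>. For open \<open>U\<close> these sets are a basis of the
  topology of the covering.
\<close>

definition sheet :: "(real \<Rightarrow> 'a) \<Rightarrow> 'a set \<Rightarrow> (real \<Rightarrow> 'a) set set" where
  "sheet g U = {point (join_loops g d) | d. pathin X d \<and> d 0 = g 1 \<and> d ` {0..1} \<subseteq> U}"

lemma sheet_mono: "U \<subseteq> V \<Longrightarrow> sheet g U \<subseteq> sheet g V"
  unfolding sheet_def by blast

lemma sheet_subset: "g \<in> based_paths \<Longrightarrow> sheet g U \<subseteq> point ` based_paths"
  unfolding sheet_def using based_paths_join by blast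

lemma point_in_sheet:
  assumes g: "g \<in> based_paths" and U: "g 1 \<in> U" "U \<subseteq> topspace X"
  shows "point g \<in> sheet g U"
proof -
  have "point (join_loops g (\<lambda>_. g 1)) = point g"
    using g U by (intro point_homotopic based_paths_join join_const_right) (auto dest: based_pathsD intro: pathin_const)
  moreover have "pathin X (\<lambda>_. g 1)" using U by (auto intro: pathin_const)
  ultimately show ?thesis unfolding sheet_def using U(1) by (fastforce intro!: exI[of _ "\<lambda>_. g 1"])
qed

lemma sheet_move_subset:
  assumes g: "g \<in> based_paths" and h: "h \<in> based_paths" and hg: "point h \<in> sheet g U"
  shows "sheet h U \<subseteq> sheet g U"
proof
  fix e assume "e \<in> sheet h U"
  then obtain d' where d': "e = point (join_loops h d')" "pathin X d'" "d' 0 = h 1" "d' ` {0..1} \<subseteq> U"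
    unfolding sheet_def by blast
  obtain d where d: "point h = point (join_loops g d)" "pathin X d" "d 0 = g 1" "d ` {0..1} \<subseteq> U"
    using hg unfolding sheet_def by blast
  have h1: "h 1 = d 1" using endpoint_point[OF h] endpoint_point[OF based_paths_join[OF g d(2,3)]] d(1) by simp
  have "e = point (join_loops (join_loops g d) d')"
    unfolding d'(1) by (rule point_join[OF h d(1) d'(2,3)])
  also have "\<dots> = point (join_loops g (join_loops d d'))"
    by (rule point_assoc) (use g d d' h1 in auto)
  finally have "e = point (join_loops g (join_loops d d'))" .
  moreover have "join_loops d d' ` {0..1} \<subseteq> U" using join_loops_image[of d d'] d(4) d'(4) by blast
  ultimately show "e \<in> sheet g U"
    unfolding sheet_def using d(2,3) d'(2,3) h1 pathin_join[of X d d']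
    by (intro CollectI exI[of _ "join_loops d d'"]) simp
qed

text \<open>
  A sheet can be described from each of its points, by going back along the continuation. Hence two
  sheets over the same \<open>U\<close> are equal or disjoint.
\<close>

lemma sheet_move:
  assumes g: "g \<in> based_paths" and h: "h \<in> based_paths" and hg: "point h \<in> sheet g U"
  shows "sheet h U = sheet g U"
proof
  show "sheet h U \<subseteq> sheet g U" by (rule sheet_move_subset[OF assms])
  obtain d where d: "point h = point (join_loops g d)" "pathin X d" "d 0 = g 1" "d ` {0..1} \<subseteq> U"
    using hg unfolding sheet_def by blast
  have h1: "h 1 = d 1" using endpoint_point[OF h] endpoint_point[OF based_paths_join[OF g d(2,3)]] d(1) by simp
  have "point (join_loops h (rev_path d)) = point (join_loops (join_loops g d) (rev_path d))"
    by (rule point_join[OF h d(1)]) (use d h1 pathin_rev in auto)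
  then have "point g = point (join_loops h (rev_path d))" using point_back[OF g d(2,3)] by simp
  moreover have "rev_path d ` {0..1} \<subseteq> U" using rev_path_image d(4) by (rule subset_trans)
  ultimately have "point g \<in> sheet h U"
    unfolding sheet_def using h1 pathin_rev[OF d(2)] by (intro CollectI exI[of _ "rev_path d"]) simp
  then show "sheet g U \<subseteq> sheet h U" by (rule sheet_move_subset[OF h g])
qed

definition cover :: "(real \<Rightarrow> 'a) set topology" where
  "cover = topology (\<lambda>W. W \<subseteq> point ` based_paths \<and>
     (\<forall>g\<in>based_paths. point g \<in> W \<longrightarrow> (\<exists>U. openin X U \<and> g 1 \<in> U \<and> sheet g U \<subseteq> W)))"

lemma openin_cover:
  "openin cover W \<longleftrightarrow> W \<subseteq> point ` based_paths \<and>
     (\<forall>g\<in>based_paths. point g \<in> W \<longrightarrow> (\<exists>U. openin X U \<and> g 1 \<in> U \<and> sheet g U \<subseteq> W))"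
proof -
  have "istopology (\<lambda>W. W \<subseteq> point ` based_paths \<and>
     (\<forall>g\<in>based_paths. point g \<in> W \<longrightarrow> (\<exists>U. openin X U \<and> g 1 \<in> U \<and> sheet g U \<subseteq> W)))" (is "istopology ?L")
    unfolding istopology_def
  proof (intro conjI allI impI)
    fix S T assume S: "?L S" and T: "?L T"
    show "S \<inter> T \<subseteq> point ` based_paths" using S by blast
    show "\<forall>g\<in>based_paths. point g \<in> S \<inter> T \<longrightarrow> (\<exists>U. openin X U \<and> g 1 \<in> U \<and> sheet g U \<subseteq> S \<inter> T)"
    proof (intro ballI impI)
      fix g assume g: "g \<in> based_paths" "point g \<in> S \<inter> T"
      obtain U where "openin X U" "g 1 \<in> U" "sheet g U \<subseteq> S"
        using S g by (meson IntD1)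
      moreover obtain V where "openin X V" "g 1 \<in> V" "sheet g V \<subseteq> T"
        using T g by (meson IntD2)
      ultimately have "openin X (U \<inter> V)" "g 1 \<in> U \<inter> V" "sheet g (U \<inter> V) \<subseteq> S \<inter> T"
        using sheet_mono[of "U \<inter> V" U g] sheet_mono[of "U \<inter> V" V g] by auto
      then show "\<exists>U. openin X U \<and> g 1 \<in> U \<and> sheet g U \<subseteq> S \<inter> T" by blast
    qed
  next
    fix K assume K: "\<forall>S\<in>K. ?L S"
    then show "\<Union>K \<subseteq> point ` based_paths" by blast
    show "\<forall>g\<in>based_paths. point g \<in> \<Union>K \<longrightarrow> (\<exists>U. openin X U \<and> g 1 \<in> U \<and> sheet g U \<subseteq> \<Union>K)"
    proof (intro ballI impI)
      fix g assume g: "g \<in> based_paths" "point g \<in> \<Union>K"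
      then obtain S where S: "S \<in> K" "point g \<in> S" by blast
      then obtain U where "openin X U" "g 1 \<in> U" "sheet g U \<subseteq> S" using K g(1) by meson
      then show "\<exists>U. openin X U \<and> g 1 \<in> U \<and> sheet g U \<subseteq> \<Union>K" using S by blast
    qed
  qed
  then show ?thesis unfolding cover_def using topology_inverse' by simp
qed

lemma based_path_end: "g \<in> based_paths \<Longrightarrow> g 1 \<in> topspace X"
  using pathin_in_topspace[of X g 1] based_pathsD(1) by simp

lemma topspace_cover: "topspace cover = point ` based_paths"
proof
  show "topspace cover \<subseteq> point ` based_paths" using openin_topspace[of cover] openin_cover by blast
  have "openin cover (point ` based_paths)"
    unfolding openin_cover using sheet_subset based_path_end openin_topspace by blast
  then show "point ` based_paths \<subseteq> topspace cover" by (rule openin_subset)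
qed

lemma openin_sheet:
  assumes g: "g \<in> based_paths" and U: "openin X U" shows "openin cover (sheet g U)"
  unfolding openin_cover
proof (intro conjI ballI impI sheet_subset[OF g])
  fix h assume h: "h \<in> based_paths" "point h \<in> sheet g U"
  then obtain d where d: "point h = point (join_loops g d)" "pathin X d" "d 0 = g 1" "d ` {0..1} \<subseteq> U"
    unfolding sheet_def by blast
  have "h 1 = d 1" using endpoint_point[OF h(1)] endpoint_point[OF based_paths_join[OF g d(2,3)]] d(1) by simp
  then have "h 1 \<in> U" using d(4) by auto
  then show "\<exists>V. openin X V \<and> h 1 \<in> V \<and> sheet h V \<subseteq> sheet g U"
    using U sheet_move[OF g h] by blast
qed

lemma endpoint_sheet: assumes g: "g \<in> based_paths" and e: "e \<in> sheet g U" shows "endpoint e \<in> U"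
proof -
  obtain d where d: "e = point (join_loops g d)" "pathin X d" "d 0 = g 1" "d ` {0..1} \<subseteq> U"
    using e unfolding sheet_def by blast
  then show ?thesis using endpoint_point[OF based_paths_join[OF g d(2,3)]] by auto
qed

lemma continuous_endpoint: "continuous_map cover X endpoint"
  unfolding continuous_map
proof (intro conjI allI impI)
  show "endpoint ` topspace cover \<subseteq> topspace X"
    using endpoint_point based_path_end by (auto simp: topspace_cover)
  fix U assume U: "openin X U"
  show "openin cover {e \<in> topspace cover. endpoint e \<in> U}"
    unfolding openin_cover
  proof (intro conjI ballI impI)
    show "{e \<in> topspace cover. endpoint e \<in> U} \<subseteq> point ` based_paths" by (auto simp: topspace_cover)
    fix g assume g: "g \<in> based_paths" "point g \<in> {e \<in> topspace cover. endpoint e \<in> U}"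
    have "sheet g U \<subseteq> {e \<in> topspace cover. endpoint e \<in> U}"
      using sheet_subset[OF g(1)] endpoint_sheet[OF g(1)] topspace_cover by blast
    then show "\<exists>V. openin X V \<and> g 1 \<in> V \<and> sheet g V \<subseteq> {e \<in> topspace cover. endpoint e \<in> U}"
      using U g endpoint_point[OF g(1)] by auto
  qed
qed

text \<open>
  Points of a sheet with the same endpoint continue \<open>g\<close> along parallel paths in \<open>U\<close>, so that
  homotopy of parallel paths gives injectivity on the sheet.
\<close>

lemma sheets_cover:
  assumes U: "openin X U" and shrink: "parallel_paths_homotopic X U"
  shows "sheets cover endpoint U {sheet g U | g. g \<in> based_paths \<and> g 1 \<in> U}"
proof -
  let ?W = "{sheet g U | g. g \<in> based_paths \<and> g 1 \<in> U}"
  have inj: "inj_on endpoint (sheet g U)" if g: "g \<in> based_paths" for g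
  proof (rule inj_onI)
    fix e e' assume e: "e \<in> sheet g U" "e' \<in> sheet g U" "endpoint e = endpoint e'"
    obtain d where d: "e = point (join_loops g d)" "pathin X d" "d 0 = g 1" "d ` {0..1} \<subseteq> U"
      using e(1) unfolding sheet_def by blast
    obtain d' where d': "e' = point (join_loops g d')" "pathin X d'" "d' 0 = g 1" "d' ` {0..1} \<subseteq> U"
      using e(2) unfolding sheet_def by blast
    have "d 1 = d' 1"
      using e(3) endpoint_point[OF based_paths_join[OF g d(2,3)]] endpoint_point[OF based_paths_join[OF g d'(2,3)]] d(1) d'(1) by simp
    then have "path_homotopic X d d'" using shrink d d' unfolding parallel_paths_homotopic_def by simp
    from path_homotopic_join[OF path_homotopic_refl[OF based_pathsD(1)[OF g]] this]
    have "path_homotopic X (join_loops g d) (join_loops g d')"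
      using d(3) by simp
    then show "e = e'" unfolding d d' by (intro point_homotopic based_paths_join g d)
  qed
  have eq: "sheet g U = sheet h U" if g: "g \<in> based_paths" "e \<in> sheet g U" and h: "h \<in> based_paths" "e \<in> sheet h U" for g h e
  proof -
    obtain k where k: "k \<in> based_paths" "e = point k" using sheet_subset[OF g(1)] g(2) by blast
    then show ?thesis using sheet_move[of g k U] sheet_move[of h k U] g h by simp
  qed
  have disj: "pairwise disjnt ?W"
    unfolding pairwise_def disjnt_def using eq by blast
  have "\<Union>?W = {e \<in> topspace cover. endpoint e \<in> U}"
  proof
    show "\<Union>?W \<subseteq> {e \<in> topspace cover. endpoint e \<in> U}"
      using sheet_subset endpoint_sheet topspace_cover by blast
    show "{e \<in> topspace cover. endpoint e \<in> U} \<subseteq> \<Union>?W"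
    proof
      fix e assume "e \<in> {e \<in> topspace cover. endpoint e \<in> U}"
      then obtain g where g: "g \<in> based_paths" "e = point g" "endpoint e \<in> U" by (auto simp: topspace_cover)
      then have "g 1 \<in> U" using endpoint_point by simp
      then show "e \<in> \<Union>?W" using g point_in_sheet[OF g(1)] openin_subset[OF U] by blast
    qed
  qed
  then show ?thesis
    unfolding sheets_def using inj disj openin_sheet U by blast
qed

lemma point_segment_step:
  assumes S: "convex_fun S" and f: "continuous_map (subtopology (powertop_real UNIV) S) X f"
    and z: "z \<in> S" and v: "v \<in> S" and w: "w \<in> S" and g: "g \<in> based_paths" "g 1 = f z"
  shows "point (join_loops (join_loops g (f \<circ> segment_path z v)) (f \<circ> segment_path v w))
    = point (join_loops g (f \<circ> segment_path z w))"
proof -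
  note seg = pathin_compose_segment[OF S f]
  note tri = path_homotopic_triangle[OF S f z v w]
  have "point (join_loops (join_loops g (f \<circ> segment_path z v)) (f \<circ> segment_path v w))
      = point (join_loops g (join_loops (f \<circ> segment_path z v) (f \<circ> segment_path v w)))"
    by (rule point_assoc) (use seg z v w g in auto)
  also have "\<dots> = point (join_loops g (f \<circ> segment_path z w))"
  proof (rule point_homotopic)
    show "join_loops g (join_loops (f \<circ> segment_path z v) (f \<circ> segment_path v w)) \<in> based_paths"
      by (rule based_paths_join[OF g(1) path_homotopic_ends(3)[OF tri]]) (simp add: g(2))
    show "path_homotopic X (join_loops g (join_loops (f \<circ> segment_path z v) (f \<circ> segment_path v w))) (join_loops g (f \<circ> segment_path z w))"
      by (rule path_homotopic_join[OF path_homotopic_refl[OF based_pathsD(1)[OF g(1)]] tri]) (simp add: g(2))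
  qed
  finally show ?thesis .
qed

text \<open>
  Continuity at \<open>v\<close>: on a box around \<open>v\<close> which \<open>f\<close> maps to \<open>U\<close>, the segment from \<open>z\<close> to \<open>w\<close> can be replaced
  by the segments from \<open>z\<close> to \<open>v\<close> and from \<open>v\<close> to \<open>w\<close>, so that the lift of \<open>w\<close> lies in the sheet over \<open>U\<close>
  around the lift of \<open>v\<close>.
\<close>

theorem continuous_lift:
  assumes S: "convex_fun S" and f: "continuous_map (subtopology (powertop_real UNIV) S) X f" and z: "z \<in> S"
    and g: "g \<in> based_paths" "g 1 = f z"
  shows "continuous_map (subtopology (powertop_real UNIV) S) cover (\<lambda>w. point (join_loops g (f \<circ> segment_path z w)))"
    (is "continuous_map ?S cover ?F")
proof -
  note seg = pathin_compose_segment[OF S f]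
  note F_step = point_segment_step[OF S f z _ _ g, symmetric]
  have gF: "join_loops g (f \<circ> segment_path z w) \<in> based_paths" if "w \<in> S" for w
    using based_paths_join[OF g(1) seg[OF z that]] g(2) by simp
  show ?thesis
    unfolding continuous_map
  proof (intro conjI allI impI)
    show "?F ` topspace ?S \<subseteq> topspace cover" using gF by (auto simp: topspace_cover)
    fix W assume W: "openin cover W"
    show "openin ?S {w \<in> topspace ?S. ?F w \<in> W}"
    proof (subst openin_subopen, intro ballI)
      fix v assume "v \<in> {w \<in> topspace ?S. ?F w \<in> W}"
      then have v: "v \<in> S" "?F v \<in> W" by auto
      let ?h = "join_loops g (f \<circ> segment_path z v)"
      have "?h 1 = f v" by simp
      then obtain U where U: "openin X U" "f v \<in> U" "sheet ?h U \<subseteq> W"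
        using W v gF[OF v(1)] unfolding openin_cover by (metis (no_types, lifting))
      have "openin ?S {w \<in> topspace ?S. f w \<in> U}" by (rule openin_continuous_map_preimage[OF f U(1)])
      then obtain T where T: "openin (powertop_real UNIV) T" "{w \<in> topspace ?S. f w \<in> U} = T \<inter> S"
        unfolding openin_subtopology by blast
      have "v \<in> T" using v U T(2) by auto
      then obtain I e where e: "finite I" "e > 0" "\<And>y. (\<And>i. i \<in> I \<Longrightarrow> \<bar>y i - v i\<bar> < e) \<Longrightarrow> y \<in> T"
        by (rule powertop_real_box[OF T(1)]) blast
      \<comment> \<open>a box is convex, so it contains the segments from \<open>v\<close> to its points\<close>
      define N where "N = {w. \<forall>i\<in>I. \<bar>w i - v i\<bar> < e}"
      have proj: "continuous_map (powertop_real UNIV) euclideanreal (\<lambda>x. x i)" for i :: nat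
        by (metis UNIV_I continuous_map_product_projection)
      have "openin (powertop_real UNIV) (\<Inter>i\<in>I. {w \<in> topspace (powertop_real UNIV). w i \<in> ball (v i) e})" if "I \<noteq> {}"
        by (intro openin_INT2 e(1) that openin_continuous_map_preimage[OF proj]) simp
      moreover have "(\<Inter>i\<in>I. {w \<in> topspace (powertop_real UNIV). w i \<in> ball (v i) e}) = N"
        by (auto simp: N_def dist_real_def abs_minus_commute)
      moreover have "N = UNIV" if "I = {}" using that by (simp add: N_def)
      ultimately have "openin (powertop_real UNIV) N"
        by (cases "I = {}") (metis openin_topspace topspace_euclidean euclidean_product_topology, simp)
      then have "openin ?S (N \<inter> S)" by (rule openin_subtopology_Int)
      moreover have "v \<in> N \<inter> S" using v e(2) by (simp add: N_def)
      moreover have "N \<inter> S \<subseteq> {w \<in> topspace ?S. ?F w \<in> W}"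
      proof
        fix w assume w: "w \<in> N \<inter> S"
        have "segment_path v w t \<in> T \<inter> S" if t: "t \<in> {0..1}" for t
        proof
          show "segment_path v w t \<in> S" using S v(1) w t by (auto simp: convex_fun_def)
          show "segment_path v w t \<in> T"
          proof (rule e(3))
            fix i assume i: "i \<in> I"
            have "segment_path v w t i - v i = t * (w i - v i)" by (simp add: segment_path_def algebra_simps)
            then have "\<bar>segment_path v w t i - v i\<bar> = t * \<bar>w i - v i\<bar>" using t by (simp add: abs_mult)
            also have "\<dots> \<le> \<bar>w i - v i\<bar>" using t by (simp add: mult_left_le_one_le)
            also have "\<dots> < e" using w i by (simp add: N_def)
            finally show "\<bar>segment_path v w t i - v i\<bar> < e" .
          qed
        qed
        then have "(f \<circ> segment_path v w) ` {0..1} \<subseteq> U" using T(2) by auto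
        then have "?F w \<in> sheet ?h U"
          unfolding sheet_def using F_step[OF v(1), of w] seg[OF v(1), of w] w
          by (intro CollectI exI[of _ "f \<circ> segment_path v w"]) simp
        then show "w \<in> {w \<in> topspace ?S. ?F w \<in> W}" using U(3) w by auto
      qed
      ultimately show "\<exists>T. openin ?S T \<and> v \<in> T \<and> T \<subseteq> {w \<in> topspace ?S. ?F w \<in> W}" by blast
    qed
  qed
qed

text \<open>
  The point of the covering given by \<open>g\<close> is joined to the base point by the lift of the path \<open>g\<close>. As
  \<open>continuous_lift\<close> concerns maps on subsets of \<^typ>\<open>nat \<Rightarrow> real\<close>, the unit interval is embedded there
  as \<open>J\<close>.
\<close>

lemma connected_cover: "connected_space cover"
proof -
  define J where "J = {z :: nat \<Rightarrow> real. z 0 \<in> {0..1} \<and> (\<forall>i>0. z i = 0)}"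
  define \<iota> where "\<iota> = (\<lambda>t::real. \<lambda>i::nat. if i = 0 then t else 0)"
  let ?b = "point (\<lambda>_. a)"
  have const: "(\<lambda>_. a) \<in> based_paths" using a pathin_const by (auto simp: based_paths_def)
  have J: "convex_fun J"
  proof -
    have "(1 - t) * z 0 + t * w 0 \<in> {0..1}" if "z \<in> J" "w \<in> J" "t \<in> {0..1}" for z w and t :: real
      using that convex_bound_le[of "z 0" 1 "w 0" "1 - t" t] by (auto simp: J_def)
    then show ?thesis by (auto simp: convex_fun_def segment_path_def J_def)
  qed
  have \<iota>: "continuous_map I01 (subtopology (powertop_real UNIV) J) \<iota>"
    unfolding continuous_map_in_subtopology continuous_map_componentwise_UNIV
    by (auto simp: \<iota>_def J_def)
  have "path_component_of cover ?b (point g)" if g: "g \<in> based_paths" for g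
  proof -
    let ?f = "\<lambda>z::nat \<Rightarrow> real. g (z 0)"
    have "continuous_map (subtopology (powertop_real UNIV) J) I01 (\<lambda>z. z 0)"
      unfolding continuous_map_in_subtopology
      by (auto simp: J_def intro!: continuous_map_from_subtopology continuous_map_product_projection)
    from continuous_map_compose[OF this based_pathsD(1)[OF g, unfolded pathin_def]]
    have f: "continuous_map (subtopology (powertop_real UNIV) J) X ?f" by (simp add: o_def)
    have zJ: "(\<lambda>_. 0) \<in> J" by (simp add: J_def)
    have cl: "continuous_map (subtopology (powertop_real UNIV) J) cover
        (\<lambda>w. point (join_loops (\<lambda>_. a) (?f \<circ> segment_path (\<lambda>_. 0) w)))"
      by (rule continuous_lift[OF J f zJ const]) (simp add: based_pathsD(2)[OF g])
    let ?p = "\<lambda>t. point (join_loops (\<lambda>_. a) (?f \<circ> segment_path (\<lambda>_. 0) (\<iota> t)))"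
    have "pathin cover ?p"
      using continuous_map_compose[OF \<iota> cl] by (simp add: pathin_def o_def)
    moreover have "?p 0 = ?b"
    proof -
      have "?f \<circ> segment_path (\<lambda>_. 0) (\<iota> 0) = (\<lambda>_. a)"
        using based_pathsD(2)[OF g] by (auto simp: fun_eq_iff segment_path_def \<iota>_def)
      moreover have "join_loops (\<lambda>_. a) (\<lambda>_. a) = (\<lambda>_. a)" by (auto simp: join_loops_def)
      ultimately show ?thesis by simp
    qed
    moreover have "?p 1 = point g"
    proof -
      have "?f \<circ> segment_path (\<lambda>_. 0) (\<iota> 1) = g" by (auto simp: fun_eq_iff segment_path_def \<iota>_def)
      moreover have "point (join_loops (\<lambda>_. a) g) = point g"
        using g based_pathsD[OF g] const by (intro point_homotopic based_paths_join join_const_left) auto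
      ultimately show ?thesis by simp
    qed
    ultimately show ?thesis unfolding path_component_of_def by blast
  qed
  then have from_base: "path_component_of cover ?b x" if "x \<in> topspace cover" for x
    using that unfolding topspace_cover by (elim imageE) simp
  have "path_component_of cover x y" if "x \<in> topspace cover" "y \<in> topspace cover" for x y
    using path_component_of_trans[OF path_component_of_sym[OF from_base[OF that(1)]] from_base[OF that(2)]] .
  then have "path_connected_space cover"
    unfolding path_connected_space_iff_path_component by blast
  then show ?thesis by (rule path_connected_imp_connected_space)
qed

end

section \<open>Lifting cycles to the covering\<close>

abbreviation vertex :: "nat \<Rightarrow> nat \<Rightarrow> real" where
  "vertex k \<equiv> (\<lambda>j. if j = k then 1 else 0)"

text \<open>
  The initial edge of a simplex, made a loop by means of a chosen path \<open>\<gamma> v\<close> from the base point to every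
  point \<open>v\<close>.
\<close>

definition edge_loop :: "('a \<Rightarrow> real \<Rightarrow> 'a) \<Rightarrow> ((nat \<Rightarrow> real) \<Rightarrow> 'a) \<Rightarrow> real \<Rightarrow> 'a" where
  "edge_loop \<gamma> \<sigma> = join_loops (join_loops (\<gamma> (\<sigma> (vertex 0))) (\<sigma> \<circ> segment_path (vertex 0) (vertex 1)))
     (rev_path (\<gamma> (\<sigma> (vertex 1))))"

lemma convex_fun_standard_simplex: "convex_fun (standard_simplex m)"
  using convex_standard_simplex by (auto simp: convex_fun_def segment_path_def)

lemma simplical_face_segment_path:
  "simplical_face k (segment_path z w t) = segment_path (simplical_face k z) (simplical_face k w) t"
  by (auto simp: simplical_face_def segment_path_def fun_eq_iff)

lemma simplical_face_vertex: "simplical_face k (vertex 0) = (if k = 0 then vertex 1 else vertex 0)"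
  by (auto simp: simplical_face_def fun_eq_iff)

lemma singular_simplexD:
  assumes "singular_simplex m X \<sigma>"
  shows "continuous_map (subtopology (powertop_real UNIV) (standard_simplex m)) X \<sigma>"
    "\<And>t. t \<in> standard_simplex m \<Longrightarrow> \<sigma> t \<in> topspace X" "\<sigma> \<in> extensional (standard_simplex m)"
  using assms by (auto simp: singular_simplex_def continuous_map_def)

lemma vertex0: "vertex 0 \<in> standard_simplex m" by simp

locale simplex_lifting = subgroup_cover +
  fixes \<gamma> :: "'a \<Rightarrow> real \<Rightarrow> 'a"
  assumes \<gamma>: "\<And>v. v \<in> topspace X \<Longrightarrow> \<gamma> v \<in> based_paths" "\<And>v. v \<in> topspace X \<Longrightarrow> \<gamma> v 1 = v"
begin

definition lift_simplex :: "nat \<Rightarrow> ((nat \<Rightarrow> real) \<Rightarrow> 'a) \<Rightarrow> (nat \<Rightarrow> real) \<Rightarrow> (real \<Rightarrow> 'a) set" where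
  "lift_simplex m \<sigma> = restrict (\<lambda>t. point (join_loops (\<gamma> (\<sigma> (vertex 0))) (\<sigma> \<circ> segment_path (vertex 0) t))) (standard_simplex m)"

lemma lift_path:
  assumes \<sigma>: "singular_simplex m X \<sigma>" and t: "t \<in> standard_simplex m"
  shows "join_loops (\<gamma> (\<sigma> (vertex 0))) (\<sigma> \<circ> segment_path (vertex 0) t) \<in> based_paths"
proof (rule based_paths_join)
  have v: "\<sigma> (vertex 0) \<in> topspace X" using singular_simplexD(2)[OF \<sigma> vertex0] .
  show "\<gamma> (\<sigma> (vertex 0)) \<in> based_paths" using \<gamma>(1)[OF v] .
  show "pathin X (\<sigma> \<circ> segment_path (vertex 0) t)"
    by (rule pathin_compose_segment[OF convex_fun_standard_simplex singular_simplexD(1)[OF \<sigma>] vertex0 t])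
  show "(\<sigma> \<circ> segment_path (vertex 0) t) 0 = \<gamma> (\<sigma> (vertex 0)) 1" using \<gamma>(2)[OF v] by simp
qed

lemma singular_simplex_lift:
  assumes \<sigma>: "singular_simplex m X \<sigma>" shows "singular_simplex m cover (lift_simplex m \<sigma>)"
proof -
  have v: "\<sigma> (vertex 0) \<in> topspace X" using singular_simplexD(2)[OF \<sigma> vertex0] .
  have "continuous_map (subtopology (powertop_real UNIV) (standard_simplex m)) cover
     (\<lambda>t. point (join_loops (\<gamma> (\<sigma> (vertex 0))) (\<sigma> \<circ> segment_path (vertex 0) t)))"
    by (rule continuous_lift[OF convex_fun_standard_simplex singular_simplexD(1)[OF \<sigma>] vertex0 \<gamma>(1)[OF v] \<gamma>(2)[OF v]])
  then show ?thesis
    unfolding singular_simplex_def lift_simplex_def by (auto elim: continuous_map_eq)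
qed

lemma endpoint_lift:
  assumes \<sigma>: "singular_simplex m X \<sigma>" shows "simplex_map m endpoint (lift_simplex m \<sigma>) = \<sigma>"
proof
  fix t
  show "simplex_map m endpoint (lift_simplex m \<sigma>) t = \<sigma> t"
  proof (cases "t \<in> standard_simplex m")
    case True
    then show ?thesis using endpoint_point[OF lift_path[OF \<sigma> True]] by (simp add: simplex_map_def lift_simplex_def)
  next
    case False
    then show ?thesis using extensional_arb[OF singular_simplexD(3)[OF \<sigma>] False] by (simp add: simplex_map_def)
  qed
qed

text \<open>
  The face opposite to vertex \<open>k\<close> is lifted starting from its own first vertex, which is vertex \<open>0\<close> of
  \<open>\<sigma>\<close> unless \<open>k = 0\<close>. If \<open>k = 0\<close>, the first vertex of the face is vertex \<open>1\<close> of \<open>\<sigma>\<close>, and the two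
  lifts of this vertex agree because the class of the initial edge lies in \<open>H\<close>.
\<close>

lemma singular_face_lift:
  assumes \<sigma>: "singular_simplex n X \<sigma>" and n: "0 < n" and k: "k \<le> n"
    and edge: "loop_class X a (edge_loop \<gamma> \<sigma>) \<in> H"
  shows "singular_face n k (lift_simplex n \<sigma>) = lift_simplex (n - 1) (singular_face n k \<sigma>)"
proof
  fix t
  let ?D = "standard_simplex n"
  let ?\<tau> = "singular_face n k \<sigma>"
  show "singular_face n k (lift_simplex n \<sigma>) t = lift_simplex (n - 1) ?\<tau> t"
  proof (cases "t \<in> standard_simplex (n - 1)")
    case False
    then show ?thesis by (simp add: singular_face_def lift_simplex_def)
  next
    case True
    note D = convex_fun_standard_simplex[of n]
    note f = singular_simplexD(1)[OF \<sigma>]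
    have face: "simplical_face k s \<in> ?D" if "s \<in> standard_simplex (n - 1)" for s
      using that n k by (intro simplical_face_in_standard_simplex) auto
    let ?w = "simplical_face k t" and ?v = "simplical_face k (vertex 0)"
    have w: "?w \<in> ?D" and v: "?v \<in> ?D" using face True vertex0 by blast+
    have \<tau>: "singular_simplex (n - 1) X ?\<tau>" using singular_simplex_singular_face[OF \<sigma>] n k by simp
    have \<tau>0: "?\<tau> (vertex 0) = \<sigma> ?v" by (simp add: singular_face_def)
    have vX: "\<sigma> ?v \<in> topspace X" and v0X: "\<sigma> (vertex 0) \<in> topspace X"
      using singular_simplexD(2)[OF \<sigma>] v vertex0 by blast+
    note g = \<gamma>[OF vX] and g0 = \<gamma>[OF v0X]
    \<comment> \<open>a face is a restricted map, hence the paths agree on the unit interval only\<close>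
    have eq: "(?\<tau> \<circ> segment_path (vertex 0) t) s = (\<sigma> \<circ> segment_path ?v ?w) s" if s: "s \<in> {0..1}" for s
    proof -
      have "segment_path (vertex 0) t s \<in> standard_simplex (n - 1)"
        using convex_fun_standard_simplex True vertex0 s by (simp add: convex_fun_def)
      then show ?thesis by (simp add: singular_face_def simplical_face_segment_path)
    qed
    have "point (join_loops (\<gamma> (\<sigma> ?v)) (?\<tau> \<circ> segment_path (vertex 0) t)) = point (join_loops (\<gamma> (\<sigma> ?v)) (\<sigma> \<circ> segment_path ?v ?w))"
    proof (rule point_homotopic)
      show P: "join_loops (\<gamma> (\<sigma> ?v)) (?\<tau> \<circ> segment_path (vertex 0) t) \<in> based_paths"
        using lift_path[OF \<tau> True] by (simp add: \<tau>0)
      show "path_homotopic X (join_loops (\<gamma> (\<sigma> ?v)) (?\<tau> \<circ> segment_path (vertex 0) t)) (join_loops (\<gamma> (\<sigma> ?v)) (\<sigma> \<circ> segment_path ?v ?w))"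
      proof (rule path_homotopic_eq[OF based_pathsD(1)[OF P]])
        fix s :: real assume "s \<in> {0..1}"
        then show "join_loops (\<gamma> (\<sigma> ?v)) (?\<tau> \<circ> segment_path (vertex 0) t) s = join_loops (\<gamma> (\<sigma> ?v)) (\<sigma> \<circ> segment_path ?v ?w) s"
          using eq[of "2 * s - 1"] by (simp add: join_loops_def)
      qed
    qed
    also have "\<dots> = point (join_loops (\<gamma> (\<sigma> (vertex 0))) (\<sigma> \<circ> segment_path (vertex 0) ?w))"
    proof (cases "k = 0")
      case False
      then show ?thesis by (simp add: simplical_face_vertex)
    next
      case True
      then have v1: "?v = vertex 1" by (simp add: simplical_face_vertex)
      let ?p = "join_loops (\<gamma> (\<sigma> (vertex 0))) (\<sigma> \<circ> segment_path (vertex 0) ?v)"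
      have p: "?p \<in> based_paths" using lift_path[OF \<sigma> v] .
      have "same_point ?p (\<gamma> (\<sigma> ?v))"
        using edge p g unfolding same_point_def edge_loop_def v1 by simp
      then have "point ?p = point (\<gamma> (\<sigma> ?v))" using point_eq_iff[OF p] by blast
      then have "point (join_loops ?p (\<sigma> \<circ> segment_path ?v ?w)) = point (join_loops (\<gamma> (\<sigma> ?v)) (\<sigma> \<circ> segment_path ?v ?w))"
        by (rule point_join[OF p _ pathin_compose_segment[OF D f v w]]) simp
      then show ?thesis
        using point_segment_step[OF D f vertex0 v w g0] by simp
    qed
    finally show ?thesis
      using True w by (simp add: singular_face_def lift_simplex_def \<tau>0[unfolded singular_face_def])
  qed
qed

definition lift_chain :: "nat \<Rightarrow> 'a chain \<Rightarrow> (real \<Rightarrow> 'a) set chain" where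
  "lift_chain m c = frag_extend (frag_of \<circ> lift_simplex m) c"

lemma singular_chain_lift:
  assumes "singular_chain m X c" shows "singular_chain m cover (lift_chain m c)"
  unfolding lift_chain_def
  by (rule singular_chain_extend) (use assms singular_simplex_lift in \<open>auto simp: singular_chain_def\<close>)

lemma chain_map_lift:
  assumes "singular_chain m X c" shows "chain_map m endpoint (lift_chain m c) = c"
  using assms unfolding singular_chain_def
proof (induction c rule: frag_induction)
  case zero
  then show ?case by (simp add: lift_chain_def)
next
  case (one \<sigma>)
  then show ?case by (simp add: lift_chain_def endpoint_lift)
next
  case (diff c d)
  then show ?case by (simp add: lift_chain_def frag_extend_diff chain_map_diff)
qed

lemma chain_boundary_lift:
  assumes n: "0 < n" and c: "singular_chain n X c"
    and edge: "\<And>\<sigma>. \<sigma> \<in> Poly_Mapping.keys c \<Longrightarrow> loop_class X a (edge_loop \<gamma> \<sigma>) \<in> H"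
  shows "chain_boundary n (lift_chain n c) = lift_chain (n - 1) (chain_boundary n c)"
proof -
  have "Poly_Mapping.keys c \<subseteq> {\<sigma>. singular_simplex n X \<sigma> \<and> loop_class X a (edge_loop \<gamma> \<sigma>) \<in> H}"
    using c edge by (auto simp: singular_chain_def)
  then show ?thesis
  proof (induction c rule: frag_induction)
    case zero
    then show ?case by (simp add: lift_chain_def)
  next
    case (one \<sigma>)
    then show ?case
      using n singular_face_lift[of n \<sigma>]
      by (simp add: lift_chain_def chain_boundary_of frag_extend_sum frag_extend_cmul)
  next
    case (diff c d)
    then show ?case by (simp add: lift_chain_def frag_extend_diff chain_boundary_diff)
  qed
qed

lemma lift_cycle:
  assumes n: "0 < n" and c: "singular_relcycle n X {} c"
    and edge: "\<And>\<sigma>. \<sigma> \<in> Poly_Mapping.keys c \<Longrightarrow> loop_class X a (edge_loop \<gamma> \<sigma>) \<in> H"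
  shows "singular_relcycle n cover {} (lift_chain n c)"
proof -
  have "singular_chain n X c" "chain_boundary n c = 0" using c by (simp_all add: singular_cycle)
  then show ?thesis
    using chain_boundary_lift[OF n _ edge] singular_chain_lift by (simp add: singular_cycle lift_chain_def)
qed

text \<open>
  A loop and the constant loop define points over \<open>a\<close>. If these coincide, the loop lies in \<open>H\<close>.
\<close>

lemma injective_endpoint_imp_full:
  assumes inj: "inj_on endpoint (topspace cover)"
  shows "H = carrier G"
proof
  show "H \<subseteq> carrier G" using H subgroup.subset by blast
  show "carrier G \<subseteq> H"
  proof
    fix h assume "h \<in> carrier G"
    then obtain p where p: "h = loop_class X a p" "p \<in> loops_at X a" by (auto simp: carrier_fundamental_group)
    have P: "p \<in> based_paths" "(\<lambda>_. a) \<in> based_paths"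
      using loops_atD[OF p(2)] pathin_const[OF a] by (auto simp: based_paths_def)
    have "point p = point (\<lambda>_. a)"
    proof (rule inj_onD[OF inj])
      show "endpoint (point p) = endpoint (point (\<lambda>_. a))"
        using endpoint_point[OF P(1)] endpoint_point[OF P(2)] loops_atD[OF p(2)] by simp
    qed (use P in \<open>simp_all add: topspace_cover\<close>)
    then have "loop_class X a (join_loops p (rev_path (\<lambda>_. a))) \<in> H"
      using point_eq_iff[OF P(1)] by (simp add: same_point_def)
    moreover have "path_homotopic X (join_loops p (rev_path (\<lambda>_. a))) p"
      using join_const_right[OF based_pathsD(1)[OF P(1)], of a] loops_atD[OF p(2)] by (simp add: rev_path_def)
    ultimately show "h \<in> H"
      unfolding p(1) by (rule loop_in_H_cong) (use loops_atD[OF p(2)] in simp_all)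
  qed
qed

end

section \<open>Generators from a fundamental cycle\<close>

text \<open>
  Path components are open, and so are their complements, since charts are path connected.
\<close>

lemma manifold_path_connected:
  assumes M: "manifold n M" and conn: "connected_space M" shows "path_connected_space M"
proof -
  have nbd: "\<exists>U. openin M U \<and> x \<in> U \<and> path_connectedin M U" if x: "x \<in> topspace M" for x
  proof -
    obtain U where U: "openin M U" "x \<in> U" "subtopology M U homeomorphic_space Euclidean_space n"
      using M x unfolding manifold_def by blast
    have "path_connected_space (subtopology M U)"
      using homeomorphic_path_connected_space[OF U(3)] path_connected_Euclidean_space by blast
    then have "path_connectedin M U" using openin_subset[OF U(1)] by (simp add: path_connectedin_def)
    then show ?thesis using U by blast
  qed
  have "path_component_of M x y" if x: "x \<in> topspace M" and y: "y \<in> topspace M" for x y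
  proof -
    define A where "A = {z \<in> topspace M. path_component_of M x z}"
    have same: "path_component_of M x v \<longleftrightarrow> path_component_of M x z" if "path_connectedin M U" "v \<in> U" "z \<in> U" for U v z
    proof -
      have "path_component_of M v z" using path_component_of_maximal[OF that(1,2)] that(3) by blast
      then show ?thesis using path_component_of_trans path_component_of_sym by metis
    qed
    have "openin M A"
    proof (subst openin_subopen, intro ballI)
      fix z assume z: "z \<in> A"
      then obtain U where U: "openin M U" "z \<in> U" "path_connectedin M U" using nbd unfolding A_def by blast
      have "U \<subseteq> A" using z same[OF U(3,2)] openin_subset[OF U(1)] unfolding A_def by blast
      then show "\<exists>T. openin M T \<and> z \<in> T \<and> T \<subseteq> A" using U by blast
    qed
    moreover have "openin M (topspace M - A)"
    proof (subst openin_subopen, intro ballI)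
      fix z assume z: "z \<in> topspace M - A"
      then obtain U where U: "openin M U" "z \<in> U" "path_connectedin M U" using nbd by blast
      have "U \<subseteq> topspace M - A" using z same[OF U(3,2)] openin_subset[OF U(1)] unfolding A_def by blast
      then show "\<exists>T. openin M T \<and> z \<in> T \<and> T \<subseteq> topspace M - A" using U by blast
    qed
    moreover have "x \<in> A" using x by (simp add: A_def path_component_of_refl)
    moreover have "A \<inter> (topspace M - A) = {}" "topspace M \<subseteq> A \<union> (topspace M - A)" by auto
    ultimately have "topspace M - A = {}" using conn unfolding connected_space_def by blast
    then show ?thesis using y unfolding A_def by blast
  qed
  then show ?thesis by (simp add: path_connected_space_iff_path_component)
qed

lemma fundamental_cycle_generates_local_homology:
  assumes orient: "orientation n M \<mu>" and fc: "fundamental_cycle n M \<mu> c" and x: "x \<in> topspace M"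
    and z: "singular_relcycle n M (topspace M - {x}) z"
  shows "\<exists>k. homologous_rel n M (topspace M - {x}) z (frag_cmul k c)"
proof -
  let ?S = "topspace M - {x}"
  let ?R = "relative_homology_group (int n) M ?S"
  have c: "singular_relcycle n M {} c" and cl: "restrict_class n M (topspace M) {x} (homologous_rel_set n M {} c) = \<mu> x"
    using fc x by (auto simp: fundamental_cycle_def fundamental_class_def)
  have "hom_induced (int n) M {} M ?S id (homologous_rel_set n M {} c) = homologous_rel_set n M ?S (chain_map n id c)"
    by (rule hom_induced_chain_map[OF continuous_map_id _ c]) simp
  moreover have "chain_map n id c = c" using c chain_map_ident[of n M c] by (simp add: singular_cycle)
  ultimately have mu: "\<mu> x = homologous_rel_set n M ?S c" using cl by (simp only: restrict_class_def Diff_cancel)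
  have "generate ?R {\<mu> x} = carrier ?R"
    using orient x by (auto simp: orientation_def Let_def)
  moreover have "homologous_rel_set n M ?S z \<in> carrier ?R"
    unfolding carrier_relative_homology_group using z by (intro imageI) simp
  ultimately have "homologous_rel_set n M ?S z \<in> generate ?R {homologous_rel_set n M ?S c}"
    by (simp only: mu)
  moreover have "singular_relcycle n M ?S c" using c by (rule singular_relcycle_mono) simp
  ultimately obtain k where "homologous_rel_set n M ?S z = homologous_rel_set n M ?S (frag_cmul k c)"
    using generate_homology_class by blast
  then show ?thesis unfolding homologous_rel_set_eq by blast
qed

lemma card_keys_le_chain_norm: "card (Poly_Mapping.keys c) \<le> chain_norm c"
proof -
  have "card (Poly_Mapping.keys c) = (\<Sum>\<sigma>\<in>Poly_Mapping.keys c. 1)" by simp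
  also have "\<dots> \<le> chain_norm c"
    unfolding chain_norm_def
  proof (rule sum_mono)
    fix \<sigma> assume "\<sigma> \<in> Poly_Mapping.keys c"
    then have "Poly_Mapping.lookup c \<sigma> \<noteq> 0" by (simp add: in_keys_iff)
    then show "1 \<le> nat \<bar>Poly_Mapping.lookup c \<sigma>\<bar>" by simp
  qed
  finally show ?thesis .
qed

lemma min_generators_le:
  assumes "finite S" "S \<subseteq> carrier G" "generate G S = carrier G"
  shows "min_generators G \<le> enat (card S)"
  unfolding min_generators_def by (rule Inf_lower) (use assms in blast)

text \<open>
  For the subgroup \<open>H\<close> generated by the edge loops, \<open>c\<close> lifts to a cycle in the connected covering of \<open>H\<close>.
  Then the covering map is injective by the degree argument, which means that \<open>H\<close> is the whole group.
\<close>

lemma fundamental_cycle_edges_generate: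
  assumes M: "manifold n M" and n: "0 < n"
    and orient: "orientation n M \<mu>" and a: "a \<in> topspace M" and fc: "fundamental_cycle n M \<mu> c"
    and \<gamma>: "\<And>v. v \<in> topspace M \<Longrightarrow> pathin M (\<gamma> v) \<and> \<gamma> v 0 = a \<and> \<gamma> v 1 = v"
  defines "S \<equiv> (\<lambda>\<sigma>. loop_class M a (edge_loop \<gamma> \<sigma>)) ` Poly_Mapping.keys c"
  shows "S \<subseteq> carrier (fundamental_group M a)" "generate (fundamental_group M a) S = carrier (fundamental_group M a)"
proof -
  let ?G = "fundamental_group M a"
  interpret group ?G by (rule group_fundamental_group[OF a])
  have c: "singular_relcycle n M {} c" using fc by (simp add: fundamental_cycle_def)
  have cX: "singular_chain n M c" using c by (simp add: singular_cycle)
  show S: "S \<subseteq> carrier ?G"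
    unfolding S_def
  proof (rule image_subsetI, rule loop_class_in_carrier)
    fix \<sigma> assume "\<sigma> \<in> Poly_Mapping.keys c"
    then have \<sigma>: "singular_simplex n M \<sigma>" using cX by (auto simp: singular_chain_def)
    then have f: "continuous_map (subtopology (powertop_real UNIV) (standard_simplex n)) M \<sigma>"
      by (simp add: singular_simplex_def)
    have v: "vertex 0 \<in> standard_simplex n" "vertex 1 \<in> standard_simplex n" using n by simp_all
    have vX: "\<sigma> (vertex 0) \<in> topspace M" "\<sigma> (vertex 1) \<in> topspace M" using f v by (auto simp: continuous_map_def)
    note seg = pathin_compose_segment[OF convex_fun_standard_simplex f v]
    show "edge_loop \<gamma> \<sigma> \<in> loops_at M a"
      unfolding edge_loop_def using \<gamma>[OF vX(1)] \<gamma>[OF vX(2)] seg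
      by (intro loops_atI pathin_join pathin_rev) simp_all
  qed
  interpret subgroup_cover M a "generate ?G S"
    by (rule subgroup_cover.intro[OF a generate_is_subgroup[OF S]])
  interpret simplex_lifting M a "generate ?G S" \<gamma>
    by (intro simplex_lifting.intro simplex_lifting_axioms.intro subgroup_cover_axioms)
      (use \<gamma> in \<open>simp_all add: based_paths_def\<close>)
  have edge: "loop_class M a (edge_loop \<gamma> \<sigma>) \<in> generate ?G S" if "\<sigma> \<in> Poly_Mapping.keys c" for \<sigma>
    using that by (intro generate.incl) (simp add: S_def)
  have "lifted_cycle n M cover endpoint c (lift_chain n c)"
  proof
    show "sheeted_map cover M endpoint"
      unfolding sheeted_map_def
    proof (intro conjI ballI continuous_endpoint)
      fix x assume "x \<in> topspace M"
      then obtain U where "openin M U" "x \<in> U" "parallel_paths_homotopic M U" by (rule manifold_parallel_paths_homotopic[OF M])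
      then show "\<exists>U \<W>. openin M U \<and> x \<in> U \<and> sheets cover endpoint U \<W>" using sheets_cover by blast
    qed
    show "c = chain_map n endpoint (lift_chain n c)" using chain_map_lift[OF cX] by simp
    show "singular_relcycle n cover {} (lift_chain n c)" by (rule lift_cycle[OF n c edge])
  qed (use M n connected_cover fundamental_cycle_generates_local_homology[OF orient fc] in auto)
  then have "inj_on endpoint (topspace cover)" by (rule lifted_cycle.sheeted_map_injective)
  then show "generate ?G S = carrier ?G" by (rule injective_endpoint_imp_full)
qed

lemma manifold_0_fundamental_group:
  assumes M: "manifold 0 M" and conn: "connected_space M" and a: "a \<in> topspace M"
  shows "carrier (fundamental_group M a) = {\<one>\<^bsub>fundamental_group M a\<^esub>}"
proof -
  obtain U where U: "openin M U" "a \<in> U" "subtopology M U homeomorphic_space Euclidean_space 0"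
    using M a unfolding manifold_def by blast
  then obtain f g where fg: "homeomorphic_maps (subtopology M U) (Euclidean_space 0) f g"
    unfolding homeomorphic_space_def by blast
  note h = homeomorphic_mapsD[OF fg openin_subset[OF U(1)]]
  have "U = {a}"
  proof -
    have "f y = f a" if "y \<in> U" for y using h(5)[OF that] h(5)[OF U(2)] by (auto simp: topspace_Euclidean_space)
    then have "y = a" if "y \<in> U" for y using h(3)[OF that] h(3)[OF U(2)] that by metis
    then show ?thesis using U(2) by blast
  qed
  then have op: "openin M {a}" using U by simp
  have cl: "closedin M {a}" using M a by (simp add: manifold_def closedin_Hausdorff_singleton)
  have top: "topspace M = {a}" using conn op cl unfolding connected_space_clopen_in by auto
  have "loop_class M a p = loop_class M a (\<lambda>_. a)" if p: "p \<in> loops_at M a" for p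
  proof -
    have "p t = a" if "t \<in> {0..1}" for t
      using loops_atD[OF p] that top by (auto simp: pathin_def continuous_map_def)
    then have "path_homotopic M p (\<lambda>_. a)" using loops_atD[OF p] by (intro path_homotopic_eq) auto
    then show ?thesis using loop_class_eq_iff[OF p] by simp
  qed
  then have sub: "loop_class M a ` loops_at M a \<subseteq> {loop_class M a (\<lambda>_. a)}"
    by (intro image_subsetI) (simp only: singleton_iff)
  have "(\<lambda>_. a) \<in> loops_at M a" using pathin_const[OF a] by (simp add: loops_at_def)
  then have "loop_class M a (\<lambda>_. a) \<in> loop_class M a ` loops_at M a" by (rule imageI)
  then have "{loop_class M a (\<lambda>_. a)} \<subseteq> loop_class M a ` loops_at M a"
    by (simp only: insert_subset empty_subsetI simp_thms)
  with sub show ?thesis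
    unfolding carrier_fundamental_group one_fundamental_group by (rule equalityI)
qed

text \<open>
  The infimum is bounded from below one fundamental cycle at a time: the edge loops of \<open>c\<close> are at most as
  many as its simplices, and \<^const>\<open>chain_norm\<close> counts every simplex at least once.
\<close>

theorem lemma4p2:
  fixes n :: nat and M :: "'a topology" and \<mu> :: "'a \<Rightarrow> 'a chain set" and a :: 'a
  assumes "manifold n M" and "compact_space M" and "connected_space M"
    and "orientation n M \<mu>"
    and "a \<in> topspace M"
  shows "min_generators (fundamental_group M a) \<le> integral_simplicial_volume n M \<mu>"
proof (cases "n = 0")
  case True
  let ?G = "fundamental_group M a"
  interpret group ?G by (rule group_fundamental_group[OF assms(5)])
  have one: "carrier ?G = {\<one>\<^bsub>?G\<^esub>}" 
    by (rule manifold_0_fundamental_group[OF assms(1)[unfolded True] assms(3,5)])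
  have "generate ?G {} = carrier ?G"
  proof (rule equalityI)
    show "generate ?G {} \<subseteq> carrier ?G" by (rule generate_incl) simp
    show "carrier ?G \<subseteq> generate ?G {}" using generate.one[of ?G "{}"] unfolding one by (simp only: insert_subset empty_subsetI simp_thms)
  qed
  then have "min_generators ?G \<le> enat (card ({} :: (real \<Rightarrow> 'a) set set))" by (intro min_generators_le) simp_all
  then show ?thesis by (simp add: zero_enat_def[symmetric])
next
  case False
  then have n: "0 < n" by simp
  have "path_connected_space M" using manifold_path_connected assms by blast
  then have "\<forall>v\<in>topspace M. \<exists>g. pathin M g \<and> g 0 = a \<and> g 1 = v"
    using assms(5) unfolding path_connected_space_def by blast
  then obtain \<gamma> where \<gamma>: "\<And>v. v \<in> topspace M \<Longrightarrow> pathin M (\<gamma> v) \<and> \<gamma> v 0 = a \<and> \<gamma> v 1 = v" by metis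
  show ?thesis
    unfolding integral_simplicial_volume_def
  proof (rule Inf_greatest)
    fix k assume "k \<in> {enat (chain_norm c) | c. fundamental_cycle n M \<mu> c}"
    then obtain c where c: "k = enat (chain_norm c)" "fundamental_cycle n M \<mu> c" by blast
    let ?S = "(\<lambda>\<sigma>. loop_class M a (edge_loop \<gamma> \<sigma>)) ` Poly_Mapping.keys c"
    have "min_generators (fundamental_group M a) \<le> enat (card ?S)"
      using fundamental_cycle_edges_generate[OF assms(1) n assms(4,5) c(2) \<gamma>]
      by (intro min_generators_le) auto
    also have "card ?S \<le> chain_norm c"
      using card_image_le[OF finite_keys] card_keys_le_chain_norm le_trans by blast
    then have "enat (card ?S) \<le> k" by (simp add: c(1))
    finally show "min_generators (fundamental_group M a) \<le> k" .
  qed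
qed

end
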